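(* Let $G$ be a 3-connected planar graph with a fixed combinatorial embedding, outer face and canonical ordering, with the induced edge directions and edge labels. Then there exists a canonical ordering of the dual graph $G^*$ (for a suitable planar embedding and choice of outer face of $G^*$) such that, with respect to the edge directions and edge labels of $G^*$ induced by this canonical ordering, the following hold: (a) the dual of any intra-edge of $G$ is an S-edge in $G^*$; (b) the dual of any S-edge of $G$ is an intra-edge in $G^*$; (c) the dual of any SW-edge $e$ of $G$ is an SE-edge in $G^*$, and is directed from (the dual vertex of) the left face of $e$ to (the dual vertex of) the right face of $e$; (d) the dual of any SE-edge $e$ of $G$ is an SW-edge in $G^*$, and is directed from the right face of $e$ to the left face of $e$.
   Context: Canonical orderings are defined for any planar graph with a fixed combinatorial embedding (a clockwise cyclic order of edges at each vertex) and a fixed outer face. For such a graph $G=(V,E)$ with $n=|V|$, a canonical ordering is an ordered partition $V=V_1\cup\dots\cup V_K$ such that: (i) $V_1=\{v_1,v_2\}$ where $v_2$ is the counter-clockwise neighbour of $v_1$ on the outer face; (ii) $V_K=\{v_n\}$ where $v_n$ is the clockwise neighbour of $v_1$ on the outer face; (iii) for each $2\le k\le K$ the induced subgraph $G_k:=G[V_1\cup\dots\cup V_k]$ is 2-connected, contains the edge $(v_1,v_2)$, and all vertices of $V_k$ lie on the outer face of $G_k$; (iv) for each $2\le k\le K-1$ either $V_k=\{z\}$ is a single vertex having at least two neighbours in $V_1\cup\dots\cup V_{k-1}$ and at least one neighbour in $V_{k+1}\cup\dots\cup V_K$ (a singleton-group), or $V_k$ consists of $\ell\ge 2$ vertices inducing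 a path $z_1-z_2-\dots-z_\ell$, enumerated in clockwise order around the outer face of $G_k$, where $z_1$ and $z_\ell$ each have exactly one neighbour in $V_1\cup\dots\cup V_{k-1}$, $z_2,\dots,z_{\ell-1}$ have no such neighbour, and each $z_i$ has at least one neighbour in $V_{k+1}\cup\dots\cup V_K$ (a chain-group). $V_K$ is also regarded as a singleton-group. Edges with both endpoints in the same group are intra-edges; all other edges are inter-edges. Vertex enumeration: $V_1$ gives $v_1,v_2$. For $2\le k\le K$ let $s=|V_1|+\dots+|V_{k-1}|$. If $V_k=\{z\}$, set $v_{s+1}:=z$. If $V_k$ is a chain $z_1,\dots,z_\ell$, let $v_h,v_i$ be the neighbours of $z_1,z_\ell$ in $V_1\cup\dots\cup V_{k-1}$; if $h<i$ set $v_{s+j}:=z_j$, otherwise $v_{s+j}:=z_{\ell-j+1}$ ($j=1,\dots,\ell$). Induced edge directions: every edge is directed from its lower-indexed to its higher-indexed endpoint, except $(v_1,v_n)$, which is directed $v_n\rightarrow v_1$. At every vertex the incoming edges form a nonempty contiguous interval of the clockwise cyclic order of incident edges; the first (last) incoming edge is the first (last) edge of this interval in clockwise order. For a directed edge $e$, its left face is the face to the left when walking along $e$ from tail to head, and its right face is the other incident face. Induced edge labels (attached to edge-endpoint incidences, from $\{S,SW,W,NW,N,NE,E,SE\}$): if $V_k=\{z\}$ is a singleton-group with $2\le k\le K$, the first incoming edge of $z$ in clockwise order is labelled SE at $z$, the last incoming edge is labelled SW at $z$, and all other incoming edges are labelled S at $z$; if $V_k=\{z_1,\dots,z_\ell\}$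 is a chain-group ($2\le k<K$), the incoming inter-edge of $z_1$ is labelled SW at $z_1$, the incoming inter-edge of $z_\ell$ is labelled SE at $z_\ell$, and each intra-edge $(z_i,z_{i+1})$ is labelled E at $z_i$ and W at $z_{i+1}$; the edge $v_1\rightarrow v_2$ is labelled E at $v_1$ and W at $v_2$; the edge $v_n\rightarrow v_1$ is labelled S at $v_1$; if an inter-edge $v\rightarrow w$ is labelled SE / S / SW at $w$, it is labelled NW / N / NE, respectively, at $v$. For a label $\mathcal L$, an edge is an $\mathcal L$-edge if it is labelled $\mathcal L$ at one of its endpoints. The dual graph $G^*$ has a vertex $f^*$ for every face $f$ of $G$ and, for every edge $e$ of $G$ with incident faces $f_\ell,f_r$, an edge $e^*=(f_\ell^*,f_r^* )$ (the dual of $e$); $G^*$ is again a 3-connected planar graph. *)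

theory Defs
  imports "Graph_Theory.Graph_Theory" "HOL-Combinatorics.Orbits"
begin

text \<open>
  Undirected graphs are bidirected digraphs: an edge is a pair \<open>{a, arev a}\<close> of opposite arcs.
  An arc \<open>a\<close> plays two roles: it is an orientation of its edge (from \<open>tail G a\<close> to \<open>head G a\<close>),
  and it is the incidence of that edge with its endpoint \<open>tail G a\<close>.
\<close>

definition k_connected :: "nat \<Rightarrow> ('a, 'b) pre_digraph \<Rightarrow> bool" where
  "k_connected k G \<longleftrightarrow>
     k < card (verts G) \<and>
     (\<forall>X \<subseteq> verts G. card X < k \<longrightarrow> connected (G \<restriction> (verts G - X)))"

text \<open>
  \<open>cw a\<close> is the arc following \<open>a\<close> in the clockwise order of the arcs leaving \<open>tail G a\<close>.
  Walking along \<open>a\<close> and turning left as sharply as possible at its head leads to \<open>cw (arev a)\<close>, so the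
  orbits of \<open>cw \<circ> arev\<close> are the faces, each given as the set of the arcs that have it on
  their left. In particular, the arcs of the outer face traverse its boundary clockwise,
  and those of an inner face counter-clockwise.
\<close>

definition left_face :: "('b \<Rightarrow> 'b) \<Rightarrow> ('b \<Rightarrow> 'b) \<Rightarrow> 'b \<Rightarrow> 'b set" where
  "left_face arev cw a = orbit (cw \<circ> arev) a"

definition right_face :: "('b \<Rightarrow> 'b) \<Rightarrow> ('b \<Rightarrow> 'b) \<Rightarrow> 'b \<Rightarrow> 'b set" where
  "right_face arev cw a = left_face arev cw (arev a)"

definition faces :: "('a, 'b) pre_digraph \<Rightarrow> ('b \<Rightarrow> 'b) \<Rightarrow> ('b \<Rightarrow> 'b) \<Rightarrow> 'b set set" where
  "faces G arev cw = left_face arev cw ` arcs G"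

text \<open>
  A rotation system of a connected graph is planar iff it has Euler characteristic 2.
\<close>

definition plane_embedding :: "('a, 'b) pre_digraph \<Rightarrow> ('b \<Rightarrow> 'b) \<Rightarrow> ('b \<Rightarrow> 'b) \<Rightarrow> bool" where
  "plane_embedding G arev cw \<longleftrightarrow>
     fin_digraph G \<and> bidirected_digraph G arev \<and> connected G \<and>
     cw permutes arcs G \<and>
     (\<forall>v \<in> verts G. out_arcs G v \<noteq> {} \<longrightarrow> cyclic_on cw (out_arcs G v)) \<and>
     card (verts G) + card (faces G arev cw) = card (arcs G) div 2 + 2"

text \<open>
  The rotation that \<open>cw\<close> induces on a subgraph with arc set \<open>A\<close>: skip the arcs outside \<open>A\<close>.
\<close>

definition induced_cw :: "('b \<Rightarrow> 'b) \<Rightarrow> 'b set \<Rightarrow> 'b \<Rightarrow> 'b" where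
  "induced_cw cw A a = (cw ^^ (LEAST n. 0 < n \<and> (cw ^^ n) a \<in> A)) a"

text \<open>
  The arc \<open>a\<close> of \<open>G\<close>, seen as an arc of the dual, is the dual edge oriented from the left face to the
  right face of \<open>a\<close>; \<open>arev\<close> is the arc reversal of the dual as well. So an edge and its dual edge
  consist of the same two arcs.
\<close>

definition dual_graph ::
  "('a, 'b) pre_digraph \<Rightarrow> ('b \<Rightarrow> 'b) \<Rightarrow> ('b \<Rightarrow> 'b) \<Rightarrow> ('b set, 'b) pre_digraph" where
  "dual_graph G arev cw =
     \<lparr> verts = faces G arev cw, arcs = arcs G,
       tail = left_face arev cw, head = right_face arev cw \<rparr>"

text \<open>
  An ordered partition \<open>V\<^sub>1, \<dots>, V\<^sub>K\<close> is a list \<open>Vs\<close> of lists, with \<open>V\<^sub>k\<close> at position \<open>k - 1\<close>.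
  Each group is listed in its canonical enumeration: \<open>[v\<^sub>1, v\<^sub>2]\<close> for \<open>V\<^sub>1\<close>, \<open>[z]\<close> for a
  singleton-group, and \<open>[z\<^sub>1, \<dots>, z\<^sub>l]\<close> in clockwise order for a chain-group.
\<close>

definition earlier :: "'a list list \<Rightarrow> nat \<Rightarrow> 'a set" where
  "earlier Vs k = set (concat (take k Vs))"

definition later :: "'a list list \<Rightarrow> nat \<Rightarrow> 'a set" where
  "later Vs k = set (concat (drop (Suc k) Vs))"

definition nbrs_in :: "('a, 'b) pre_digraph \<Rightarrow> 'a \<Rightarrow> 'a set \<Rightarrow> 'a set" where
  "nbrs_in G z A = {u \<in> A. z \<rightarrow>\<^bsub>G\<^esub> u}"

definition singleton_group :: "('a, 'b) pre_digraph \<Rightarrow> 'a list list \<Rightarrow> nat \<Rightarrow> bool" where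
  "singleton_group G Vs k \<longleftrightarrow>
     (\<exists>z. Vs ! k = [z] \<and> 2 \<le> card (nbrs_in G z (earlier Vs k)) \<and> nbrs_in G z (later Vs k) \<noteq> {})"

text \<open>
  The argument \<open>F\<close> is the outer face of the subgraph induced by the groups up to this one. Its arcs run
  clockwise along it, so the path is listed clockwise iff its arcs lie in \<open>F\<close>.
\<close>

definition chain_group :: "('a, 'b) pre_digraph \<Rightarrow> 'b set \<Rightarrow> 'a list list \<Rightarrow> nat \<Rightarrow> bool" where
  "chain_group G F Vs k \<longleftrightarrow>
     (let zs = Vs ! k; l = length zs in
        2 \<le> l \<and>
        (\<forall>i < l. \<forall>j < l. zs ! i \<rightarrow>\<^bsub>G\<^esub> zs ! j \<longleftrightarrow> j = Suc i \<or> i = Suc j) \<and>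
        (\<forall>i. Suc i < l \<longrightarrow> (\<exists>a \<in> F. tail G a = zs ! i \<and> head G a = zs ! Suc i)) \<and>
        card (nbrs_in G (hd zs) (earlier Vs k)) = 1 \<and>
        card (nbrs_in G (last zs) (earlier Vs k)) = 1 \<and>
        (\<forall>i. 0 < i \<and> Suc i < l \<longrightarrow> nbrs_in G (zs ! i) (earlier Vs k) = {}) \<and>
        (\<forall>z \<in> set zs. nbrs_in G z (later Vs k) \<noteq> {}))"

text \<open>
  The outer face \<open>fo\<close> of \<open>G\<close> contains an arc \<open>r\<close> from \<open>v\<^sub>2\<close> to \<open>v\<^sub>1\<close>. Since \<open>fo\<close> lies to the left of
  \<open>r\<close>, the outer face of an induced plane subgraph containing \<open>r\<close>, being the face that includes \<open>fo\<close>,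
  is the left face of \<open>r\<close> in that subgraph.
\<close>

definition canonical_ordering ::
  "('a, 'b) pre_digraph \<Rightarrow> ('b \<Rightarrow> 'b) \<Rightarrow> ('b \<Rightarrow> 'b) \<Rightarrow> 'b set \<Rightarrow> 'a list list \<Rightarrow> bool" where
  "canonical_ordering G arev cw fo Vs \<longleftrightarrow>
     2 \<le> length Vs \<and> [] \<notin> set Vs \<and> distinct (concat Vs) \<and> set (concat Vs) = verts G \<and>
     (\<exists>v1 v2 vn. \<exists>r \<in> fo. \<exists>b \<in> fo.
        hd Vs = [v1, v2] \<and> tail G r = v2 \<and> head G r = v1 \<and>
        last Vs = [vn] \<and> tail G b = v1 \<and> head G b = vn \<and>
        (\<forall>k. 1 \<le> k \<and> k < length Vs \<longrightarrow>
           (let H = G \<restriction> earlier Vs (Suc k);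
                F = left_face arev (induced_cw cw (arcs H)) r
            in k_connected 2 H \<and> r \<in> arcs H \<and> set (Vs ! k) \<subseteq> tail G ` F \<and>
               (k < length Vs - 1 \<longrightarrow> singleton_group G Vs k \<or> chain_group G F Vs k))))"

definition intra_edge :: "('a, 'b) pre_digraph \<Rightarrow> 'a list list \<Rightarrow> 'b \<Rightarrow> bool" where
  "intra_edge G Vs a \<longleftrightarrow> (\<exists>zs \<in> set Vs. tail G a \<in> set zs \<and> head G a \<in> set zs)"

definition attach_index :: "('a, 'b) pre_digraph \<Rightarrow> 'a list \<Rightarrow> 'a \<Rightarrow> nat" where
  "attach_index G vs z = (THE j. j < length vs \<and> z \<rightarrow>\<^bsub>G\<^esub> vs ! j)"

text \<open>
  \<open>attach_index\<close> is only meaningful for the two ends of a chain; for a group \<open>[z]\<close> both branches of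
  the conditional agree.
\<close>

primrec extend_enum :: "('a, 'b) pre_digraph \<Rightarrow> 'a list \<Rightarrow> 'a list list \<Rightarrow> 'a list" where
  "extend_enum G vs [] = vs"
| "extend_enum G vs (zs # Zs) =
     extend_enum G
       (vs @ (if attach_index G vs (hd zs) < attach_index G vs (last zs) then zs else rev zs)) Zs"

definition vertex_enum :: "('a, 'b) pre_digraph \<Rightarrow> 'a list list \<Rightarrow> 'a list" where
  "vertex_enum G Vs = extend_enum G (hd Vs) (tl Vs)"

definition vertex_index :: "('a, 'b) pre_digraph \<Rightarrow> 'a list list \<Rightarrow> 'a \<Rightarrow> nat" where
  "vertex_index G Vs v = (THE j. j < length (vertex_enum G Vs) \<and> vertex_enum G Vs ! j = v)"

text \<open>The directed edges, each represented by the arc oriented according to its direction.\<close>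

definition directed_arcs :: "('a, 'b) pre_digraph \<Rightarrow> 'a list list \<Rightarrow> 'b set" where
  "directed_arcs G Vs =
     (let v1 = hd (hd Vs); vn = hd (last Vs) in
      {a \<in> arcs G.
         tail G a = vn \<and> head G a = v1 \<or>
         vertex_index G Vs (tail G a) < vertex_index G Vs (head G a) \<and>
           \<not> (tail G a = v1 \<and> head G a = vn)})"

datatype label =
  South | SouthWest | West | NorthWest | North | NorthEast | East | SouthEast

text \<open>
  \<open>labelled G arev cw Vs a L\<close>: the edge of \<open>a\<close> is labelled \<open>L\<close> at the endpoint \<open>tail G a\<close>. So the edge of
  \<open>a\<close> is incoming at \<open>tail G a\<close> iff \<open>arev a\<close> is a directed arc. Rules \<open>intra_E\<close> and \<open>intra_W\<close> also cover the
  edge from \<open>v\<^sub>1\<close> to \<open>v\<^sub>2\<close>.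
\<close>

inductive labelled ::
  "('a, 'b) pre_digraph \<Rightarrow> ('b \<Rightarrow> 'b) \<Rightarrow> ('b \<Rightarrow> 'b) \<Rightarrow> 'a list list \<Rightarrow> 'b \<Rightarrow> label \<Rightarrow> bool"
  for G arev cw Vs where
  single_first:
    "\<lbrakk> 1 \<le> k; k < length Vs; Vs ! k = [z]; b \<in> arcs G; tail G b = z;
       arev b \<notin> directed_arcs G Vs; arev (cw b) \<in> directed_arcs G Vs \<rbrakk>
     \<Longrightarrow> labelled G arev cw Vs (cw b) SouthEast"
| single_last:
    "\<lbrakk> 1 \<le> k; k < length Vs; Vs ! k = [z]; a \<in> arcs G; tail G a = z;
       arev a \<in> directed_arcs G Vs; arev (cw a) \<notin> directed_arcs G Vs \<rbrakk>
     \<Longrightarrow> labelled G arev cw Vs a SouthWest"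
| single_middle:
    "\<lbrakk> 1 \<le> k; k < length Vs; Vs ! k = [z]; b \<in> arcs G; tail G b = z;
       arev b \<in> directed_arcs G Vs; arev (cw b) \<in> directed_arcs G Vs;
       arev (cw (cw b)) \<in> directed_arcs G Vs \<rbrakk>
     \<Longrightarrow> labelled G arev cw Vs (cw b) South"
| chain_first:
    "\<lbrakk> 1 \<le> k; k < length Vs; Vs ! k = zs; 2 \<le> length zs; a \<in> arcs G; tail G a = hd zs;
       arev a \<in> directed_arcs G Vs; \<not> intra_edge G Vs a \<rbrakk>
     \<Longrightarrow> labelled G arev cw Vs a SouthWest"
| chain_last:
    "\<lbrakk> 1 \<le> k; k < length Vs; Vs ! k = zs; 2 \<le> length zs; a \<in> arcs G; tail G a = last zs;
       arev a \<in> directed_arcs G Vs; \<not> intra_edge G Vs a \<rbrakk>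
     \<Longrightarrow> labelled G arev cw Vs a SouthEast"
| intra_E:
    "\<lbrakk> zs \<in> set Vs; Suc i < length zs; a \<in> arcs G; tail G a = zs ! i; head G a = zs ! Suc i \<rbrakk>
     \<Longrightarrow> labelled G arev cw Vs a East"
| intra_W:
    "\<lbrakk> zs \<in> set Vs; Suc i < length zs; a \<in> arcs G; tail G a = zs ! Suc i; head G a = zs ! i \<rbrakk>
     \<Longrightarrow> labelled G arev cw Vs a West"
| last_to_first:
    "\<lbrakk> a \<in> arcs G; tail G a = hd (hd Vs); head G a = hd (last Vs) \<rbrakk>
     \<Longrightarrow> labelled G arev cw Vs a South"
| out_NW:
    "\<lbrakk> a \<in> directed_arcs G Vs; \<not> intra_edge G Vs a; labelled G arev cw Vs (arev a) SouthEast \<rbrakk>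
     \<Longrightarrow> labelled G arev cw Vs a NorthWest"
| out_N:
    "\<lbrakk> a \<in> directed_arcs G Vs; \<not> intra_edge G Vs a; labelled G arev cw Vs (arev a) South \<rbrakk>
     \<Longrightarrow> labelled G arev cw Vs a North"
| out_NE:
    "\<lbrakk> a \<in> directed_arcs G Vs; \<not> intra_edge G Vs a; labelled G arev cw Vs (arev a) SouthWest \<rbrakk>
     \<Longrightarrow> labelled G arev cw Vs a NorthEast"

definition label_edge ::
  "('a, 'b) pre_digraph \<Rightarrow> ('b \<Rightarrow> 'b) \<Rightarrow> ('b \<Rightarrow> 'b) \<Rightarrow> 'a list list \<Rightarrow> label \<Rightarrow> 'b \<Rightarrow> bool" where
  "label_edge G arev cw Vs L a \<longleftrightarrow>
     labelled G arev cw Vs a L \<or> labelled G arev cw Vs (arev a) L"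

end

theory Submission
  imports Defs
begin

text \<open>
  A canonical ordering, with every chain listed clockwise, numbers the vertices so that the edges are
  oriented from \<open>v\<^sub>1\<close> to \<open>v\<^sub>n\<close> without other sources and sinks. Counting the corners of such an
  orientation and comparing with Euler's formula shows that the incoming edges at each vertex are
  consecutive and that each face has exactly one top vertex. Hence each face between two consecutive
  incoming edges of \<open>z\<close> has its other vertices before \<open>z\<close>, so that a function on the arcs that sums
  to zero around every face is the gradient of a potential. This discrete Poincare lemma replaces the
  Jordan curve theorem: with 3-connectivity it shows that a face visits a vertex at most once and that
  two faces share at most one edge, and it shows that the edges between an initial segment of the
  numbering and its complement form a single dual cycle.

  The groups of the dual are the sets of faces whose top vertices lie in a common group, in reverse
  order; the two faces at the edge from \<open>v\<^sub>1\<close> to \<open>v\<^sub>n\<close> form the first group. A chain yields a single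
  face, and a vertex with \<open>m\<close> incoming edges yields the path of the \<open>m - 1\<close> faces between them. The
  prefixes of the dual ordering are 2-connected because each group is an ear, and the outer face of a
  prefix is the dual cycle around the groups of \<open>G\<close> that are still to come.
\<close>

section \<open>Cyclic orders and connectivity\<close>

text \<open>Positions are taken in \<open>concat Vs\<close>, not from \<open>vertex_index\<close>,
  which may run through a chain the other way. Both agree between different groups, and the
  directions that enter the claims are those of inter-edges, so either order serves. The definition
  directs the edge between \<open>v1\<close> and \<open>vn\<close> towards \<open>v1\<close>,
  whereas the st-numbering orients it towards \<open>vn\<close>; this is why \<open>arev b\<close>
  is excepted wherever the edges below a group are collected. The dual outer face is the one around
  \<open>v1\<close>, because then the two outer edges at \<open>v1\<close> trade roles: the dual of
  the edge to \<open>vn\<close> joins the first two dual vertices, and the dual of the edge to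
  \<open>v2\<close> joins the first to the last. The outer face of an induced subgraph is only given
  as an orbit of a first-return map, so no geometric property of it comes for free. For
  \<open>G\<close> it is exploited through faces that survive unchanged in the subgraph; for the
  dual it is computed by the potential argument. Planarity enters through Euler's formula, which
  turns a chain of counting inequalities into equalities.\<close>

lemma cyclic_on_exit:
  assumes "cyclic_on f S" "J \<subseteq> S" "J \<noteq> {}" "J \<noteq> S"
  shows "\<exists>e\<in>J. f e \<notin> J"
proof (rule ccontr)
  assume "\<not> ?thesis"
  then have closed: "\<And>e. e \<in> J \<Longrightarrow> f e \<in> J" by blast
  obtain x where x: "x \<in> J" using assms by blast
  then have "S = orbit f x" using assms orbit_cyclic_eq3 by (metis subsetD)
  moreover have "y \<in> J" if "y \<in> orbit f x" for y
    using that by induct (use x closed in auto)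
  ultimately show False using assms by blast
qed

text \<open>With a unique exit, \<open>I\<close> is one run of the cycle: iterate from the entry
  point \<open>h\<close> until the first exit. Elements left over would have an exit from their own
  set. That is either a second exit of \<open>I\<close> or a step into the run, which contradicts
  injectivity or the choice of \<open>h\<close>.\<close>

lemma cyclic_on_interval:
  assumes cyc: "cyclic_on f S" and inj: "inj f" and I: "I \<subseteq> S" "I \<noteq> {}" "I \<noteq> S"
    and uniq: "\<And>e e'. \<lbrakk>e \<in> I; f e \<notin> I; e' \<in> I; f e' \<notin> I\<rbrakk> \<Longrightarrow> e = e'"
  obtains xs where "xs \<noteq> []" "distinct xs" "set xs = I"
    "\<And>i. Suc i < length xs \<Longrightarrow> f (xs ! i) = xs ! Suc i" "f (last xs) \<notin> I"
proof -
  obtain y0 where y0: "y0 \<in> S - I" "f y0 \<notin> S - I"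
    using cyclic_on_exit[OF cyc, of "S - I"] I by blast
  define h where "h = f y0"
  have hI: "h \<in> I" using y0 cyclic_on_inI[OF cyc] by (auto simp: h_def)
  have S: "S = orbit f h" using orbit_cyclic_eq3[OF cyc, of h] hI I by auto
  have "\<exists>n. (f ^^ n) h \<notin> I" using I S by (auto simp: orbit_altdef)
  define n where "n = (LEAST n. (f ^^ n) h \<notin> I)"
  have n: "(f ^^ n) h \<notin> I" unfolding n_def using \<open>\<exists>n. _\<close> by (rule LeastI_ex)
  have below: "(f ^^ i) h \<in> I" if "i < n" for i using that not_less_Least n_def by blast
  have n0: "0 < n" using n hI by (cases n) auto
  define xs where "xs = map (\<lambda>i. (f ^^ i) h) [0..<n]"
  have len: "length xs = n" by (simp add: xs_def)
  have nth: "xs ! i = (f ^^ i) h" if "i < n" for i using that by (simp add: xs_def)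
  have step: "f (xs ! i) = xs ! Suc i" if "Suc i < length xs" for i
    using that by (simp add: len nth)
  have last: "f (last xs) \<notin> I"
  proof -
    have "last xs = (f ^^ (n - 1)) h" using n0 len by (simp add: last_conv_nth nth flip: length_greater_0_conv)
    then have "f (last xs) = (f ^^ Suc (n - 1)) h" by simp
    then show ?thesis using n n0 by simp
  qed
  have dist: "distinct xs"
  proof -
    have False if ij: "i < j" "j < n" and eq: "(f ^^ i) h = (f ^^ j) h" for i j
    proof -
      have "(f ^^ i) ((f ^^ (j - i)) h) = (f ^^ i) h"
        using ij eq by (simp add: funpow_add[symmetric, THEN fun_cong, unfolded o_def])
      moreover have "inj (f ^^ i)" using inj by (rule inj_fn)
      ultimately have per: "(f ^^ (j - i)) h = h" by (meson injD)
      have "(f ^^ n) h = (f ^^ (n mod (j - i))) h" using per by (simp add: funpow_mod_eq)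
      moreover have "n mod (j - i) < n" using ij by (meson less_trans mod_less_divisor zero_less_diff diff_le_self le_less_trans)
      ultimately show False using n below by metis
    qed
    then show ?thesis unfolding xs_def distinct_map inj_on_def
      by (auto) (metis linorder_neqE_nat)
  qed
  have sub: "set xs \<subseteq> I" using below by (auto simp: xs_def)
  have "set xs = I"
  proof (rule ccontr)
    assume "set xs \<noteq> I"
    then have "\<exists>e\<in>I - set xs. f e \<notin> I - set xs"
      using sub I by (intro cyclic_on_exit[OF cyc]) auto
    then obtain e where e: "e \<in> I" "e \<notin> set xs" "f e \<notin> I \<or> f e \<in> set xs" by blast
    have "f e \<notin> I \<Longrightarrow> False"
    proof -
      assume "f e \<notin> I"
      moreover have "last xs \<in> set xs" using n0 len by (intro last_in_set) auto
      ultimately show False using uniq[of e "last xs"] e last sub by auto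
    qed
    then obtain i where i: "i < n" "f e = (f ^^ i) h" using e by (auto simp: xs_def)
    show False
    proof (cases i)
      case 0
      then have "f e = f y0" using i by (simp add: h_def)
      then show False using inj y0 e by (auto dest: injD)
    next
      case (Suc k)
      then have "e = (f ^^ k) h" using i inj by (auto dest: injD)
      then show False using e i Suc by (auto simp: xs_def)
    qed
  qed
  then show thesis using that[of xs] n0 len dist step last by auto
qed

text \<open>Connectivity in cut form: a proper part of \<open>S\<close> yields an adjacency across
  the cut at once, and deleting vertices only changes the set \<open>S\<close> instead of nesting
  induced subgraphs. \<open>S\<close> is nonempty because \<open>connected\<close> excludes the
  empty graph.\<close>

definition cut_connected :: "('a, 'b) pre_digraph \<Rightarrow> 'a set \<Rightarrow> bool" where
  "cut_connected G S \<longleftrightarrow>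
     S \<noteq> {} \<and> (\<forall>A \<subseteq> S. A \<noteq> {} \<and> A \<noteq> S \<longrightarrow> (\<exists>u\<in>A. \<exists>v\<in>S - A. u \<rightarrow>\<^bsub>G\<^esub> v))"

lemma connected_induce_iff:
  assumes "symmetric G"
  shows "connected (G \<restriction> S) \<longleftrightarrow> cut_connected G S"
proof -
  let ?E = "(arcs_ends (G \<restriction> S))\<^sup>s"
  have symc: "(u, v) \<in> ?E \<longleftrightarrow> u \<in> S \<and> v \<in> S \<and> u \<rightarrow>\<^bsub>G\<^esub> v" for u v
    using assms unfolding symcl_def symmetric_def sym_def arcs_ends_conv by auto
  have "connected (G \<restriction> S) \<longleftrightarrow> S \<noteq> {} \<and> (\<forall>u\<in>S. \<forall>v\<in>S. (u, v) \<in> rtrancl_on S ?E)"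
    by (simp add: connected_conv)
  also have "\<dots> \<longleftrightarrow> cut_connected G S"
    unfolding cut_connected_def
  proof (intro conj_cong refl iffI allI impI ballI)
    fix A assume conn: "\<forall>u\<in>S. \<forall>v\<in>S. (u, v) \<in> rtrancl_on S ?E" and A: "A \<subseteq> S" "A \<noteq> {} \<and> A \<noteq> S"
    then obtain u v where uv: "u \<in> A" "v \<in> S - A" by blast
    then have "(u, v) \<in> rtrancl_on S ?E" using conn A by blast
    then have "v \<in> A \<or> (\<exists>u\<in>A. \<exists>v\<in>S - A. u \<rightarrow>\<^bsub>G\<^esub> v)"
      by (induct rule: rtrancl_on_induct) (use uv in \<open>auto simp: symc\<close>)
    then show "\<exists>u\<in>A. \<exists>v\<in>S - A. u \<rightarrow>\<^bsub>G\<^esub> v" using uv by blast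
  next
    fix u v assume cut: "\<forall>A \<subseteq> S. A \<noteq> {} \<and> A \<noteq> S \<longrightarrow> (\<exists>u\<in>A. \<exists>v\<in>S - A. u \<rightarrow>\<^bsub>G\<^esub> v)"
      and uv: "u \<in> S" "v \<in> S"
    define A where "A = {w \<in> S. (u, w) \<in> rtrancl_on S ?E}"
    have "A = S"
    proof (rule ccontr)
      assume "A \<noteq> S"
      moreover have "A \<noteq> {}" using uv by (auto simp: A_def)
      moreover have "A \<subseteq> S" by (auto simp: A_def)
      ultimately obtain x y where xy: "x \<in> A" "y \<in> S - A" "x \<rightarrow>\<^bsub>G\<^esub> y" using cut by blast
      then have "(x, y) \<in> ?E" by (auto simp: symc A_def)
      then have "(u, y) \<in> rtrancl_on S ?E"
        using xy by (auto simp: A_def intro: rtrancl_on_into_rtrancl_on)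
      then show False using xy by (auto simp: A_def)
    qed
    then show "(u, v) \<in> rtrancl_on S ?E" using uv by (auto simp: A_def)
  qed
  finally show ?thesis .
qed

lemma k_connected_cut:
  assumes "k_connected k G" "symmetric G" "X \<subseteq> verts G" "card X < k" "A \<subseteq> verts G - X" "A \<noteq> {}"
    "A \<noteq> verts G - X"
  obtains a where "a \<in> arcs G" "tail G a \<in> A" "head G a \<in> verts G - X - A"
proof -
  have "cut_connected G (verts G - X)"
    using assms by (auto simp: k_connected_def connected_induce_iff)
  then obtain u v where "u \<in> A" "v \<in> verts G - X - A" "u \<rightarrow>\<^bsub>G\<^esub> v"
    unfolding cut_connected_def using assms(5-7) by blast
  then show thesis using that by blast
qed

section \<open>Plane graphs and st-numberings\<close>

locale plane_graph = graph G + bidirected_digraph G arev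
  for G :: "('a, 'b) pre_digraph" and arev :: "'b \<Rightarrow> 'b" +
  fixes cw :: "'b \<Rightarrow> 'b"
  assumes connected_G: "connected G"
    and cw_permutes: "cw permutes arcs G"
    and cyclic_cw: "\<lbrakk>v \<in> verts G; out_arcs G v \<noteq> {}\<rbrakk> \<Longrightarrow> cyclic_on cw (out_arcs G v)"
    and euler: "card (verts G) + card (faces G arev cw) = card (arcs G) div 2 + 2"
begin

abbreviation nxt :: "'b \<Rightarrow> 'b" where "nxt a \<equiv> cw (arev a)"
abbreviation lf :: "'b \<Rightarrow> 'b set" where "lf \<equiv> left_face arev cw"

lemma cw_in_arcs [simp]: "cw a \<in> arcs G \<longleftrightarrow> a \<in> arcs G"
  by (rule permutes_in_image[OF cw_permutes])

lemma arev_in_arcs_iff [simp]: "arev a \<in> arcs G \<longleftrightarrow> a \<in> arcs G"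
  by (metis arev_arev arev_in_arcs)

lemma inj_cw: "inj cw"
  by (rule permutes_inj[OF cw_permutes])

lemma cw_eq_iff [simp]: "cw a = cw b \<longleftrightarrow> a = b"
  using inj_cw by (auto dest: injD)

lemma arev_eq_iff' [simp]: "arev a = arev b \<longleftrightarrow> a = b"
  by (rule arev_eq_iff)

lemma tail_cw [simp]: "a \<in> arcs G \<Longrightarrow> tail G (cw a) = tail G a"
  using cyclic_on_inI[OF cyclic_cw[of "tail G a"], of a] by (auto simp: out_arcs_def)

lemma permutes_nxt: "(cw \<circ> arev) permutes arcs G"
  by (rule permutes_compose[OF arev_permutes_arcs cw_permutes])

lemma permutation_nxt: "permutation (cw \<circ> arev)"
  using permutes_nxt finite_arcs unfolding permutation_permutes by blast

lemma lf_self [simp]: "a \<in> lf a"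
  unfolding left_face_def by (rule permutation_self_in_orbit[OF permutation_nxt])

lemma lf_nxt [simp]: "lf (nxt a) = lf a"
  unfolding left_face_def using permutation_orbit_step[OF permutation_nxt, of a] by simp

lemma cyclic_lf: "cyclic_on (cw \<circ> arev) (lf a)"
  unfolding left_face_def by (rule cyclic_on_orbit'[OF permutation_nxt])

lemma lf_eqI: "b \<in> lf a \<Longrightarrow> lf b = lf a"
  using orbit_cyclic_eq3[OF cyclic_lf] by (simp add: left_face_def)

lemma in_lf_iff: "b \<in> lf a \<longleftrightarrow> lf b = lf a"
  using lf_eqI lf_self by blast

lemma lf_subset: "a \<in> arcs G \<Longrightarrow> lf a \<subseteq> arcs G"
  unfolding left_face_def by (rule permutes_orbit_subset[OF permutes_nxt])

lemma lf_arcs: "a \<in> arcs G \<Longrightarrow> b \<in> lf a \<Longrightarrow> b \<in> arcs G"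
  using lf_subset by blast

lemma finite_lf [simp]: "finite (lf a)"
  using finite_cyclic_on[OF cyclic_lf] .

lemma nxt_in_lf [simp]: "nxt b \<in> lf a \<longleftrightarrow> b \<in> lf a"
  by (simp add: in_lf_iff)

lemma lf_cw: "lf (cw a) = lf (arev a)"
  using lf_nxt[of "arev a"] by simp

lemma nxt_surj: "\<exists>b. nxt b = a"
  using permutes_surj[OF permutes_nxt] by (metis comp_apply surjD)

lemma same_ends: "\<lbrakk>a \<in> arcs G; b \<in> arcs G; tail G a = tail G b; head G a = head G b\<rbrakk> \<Longrightarrow> a = b"
  by (rule no_multi_arcs) (auto simp: arc_to_ends_def)

lemma cyclic_out: "a \<in> arcs G \<Longrightarrow> cyclic_on cw (out_arcs G (tail G a))"
  by (rule cyclic_cw) (auto simp: out_arcs_def)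

section \<open>Sums of arc functions around faces\<close>

lemma bij_betw_nxt_lf: "bij_betw (cw \<circ> arev) (lf a) (lf a)"
proof -
  have "inj_on (cw \<circ> arev) (lf a)" by (auto simp: inj_on_def)
  moreover have "(cw \<circ> arev) ` lf a = lf a"
    using calculation by (intro endo_inj_surj) auto
  ultimately show ?thesis by (simp add: bij_betw_def)
qed

lemma sum_nxt: "(\<Sum>b\<in>lf a. g (nxt b)) = (\<Sum>b\<in>lf a. g b)"
  using sum.reindex_bij_betw[OF bij_betw_nxt_lf, of g a] by simp

text \<open>The tail of \<open>nxt b\<close> is the head of \<open>b\<close>, so the sum telescopes
  around the face.\<close>

lemma sum_gradient:
  fixes q :: "'a \<Rightarrow> int"
  assumes "a \<in> arcs G"
  shows "(\<Sum>b\<in>lf a. q (head G b) - q (tail G b)) = 0"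
proof -
  have "(\<Sum>b\<in>lf a. q (head G b)) = (\<Sum>b\<in>lf a. q (tail G (nxt b)))"
    using lf_arcs[OF assms] by (intro sum.cong) auto
  then show ?thesis using sum_nxt[of "\<lambda>b. q (tail G b)" a] by (simp add: sum_subtractf)
qed

lemma finite_faces: "finite (faces G arev cw)"
  by (simp add: faces_def)

lemma sum_faces:
  fixes w :: "'b \<Rightarrow> int"
  shows "(\<Sum>F\<in>faces G arev cw. \<Sum>a\<in>F. w a) = (\<Sum>a\<in>arcs G. w a)"
proof -
  have "\<Union> (faces G arev cw) = arcs G"
    unfolding faces_def using lf_subset by fastforce
  moreover have "A \<inter> B = {}" if "A \<in> faces G arev cw" "B \<in> faces G arev cw" "A \<noteq> B" for A B
    using that unfolding faces_def by (auto simp: in_lf_iff)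
  moreover have "finite A" if "A \<in> faces G arev cw" for A
    using that by (auto simp: faces_def)
  ultimately show ?thesis using sum.Union_disjoint[of "faces G arev cw" w] by simp
qed

text \<open>Reversal pairs up the arcs. Together with \<open>sum_faces\<close> this makes the face
  sums of an antisymmetric function add up to zero, so that they all vanish once they are
  nonnegative.\<close>

lemma sum_antisym:
  fixes w :: "'b \<Rightarrow> int"
  assumes "\<And>a. a \<in> arcs G \<Longrightarrow> w (arev a) = - w a"
  shows "(\<Sum>a\<in>arcs G. w a) = 0"
proof -
  have "bij_betw arev (arcs G) (arcs G)" using arev_permutes_arcs by (rule permutes_imp_bij)
  then have "(\<Sum>a\<in>arcs G. w a) = (\<Sum>a\<in>arcs G. w (arev a))"
    by (rule sum.reindex_bij_betw[symmetric])
  also have "\<dots> = - (\<Sum>a\<in>arcs G. w a)" using assms by (simp add: sum_negf)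
  finally show ?thesis by simp
qed

end

section \<open>st-numberings, their corners and potentials\<close>

locale st_plane = plane_graph G arev cw
  for G :: "('a, 'b) pre_digraph" and arev cw +
  fixes pos :: "'a \<Rightarrow> nat" and s t :: 'a
  assumes inj_pos: "inj_on pos (verts G)"
    and st: "s \<in> verts G" "t \<in> verts G" "s \<noteq> t"
    and lower: "\<lbrakk>v \<in> verts G; v \<noteq> s\<rbrakk> \<Longrightarrow> \<exists>a\<in>arcs G. tail G a = v \<and> pos (head G a) < pos v"
    and higher: "\<lbrakk>v \<in> verts G; v \<noteq> t\<rbrakk> \<Longrightarrow> \<exists>a\<in>arcs G. tail G a = v \<and> pos v < pos (head G a)"
begin

text \<open>An arc stands for the incidence of its edge with its tail, so an arc that descends is an
  edge incoming at that tail.\<close>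

definition inc :: "'b \<Rightarrow> bool" where
  "inc a \<longleftrightarrow> pos (head G a) < pos (tail G a)"

lemma pos_eqD: "\<lbrakk>u \<in> verts G; v \<in> verts G; pos u = pos v\<rbrakk> \<Longrightarrow> u = v"
  using inj_pos by (auto dest: inj_onD)

lemma pos_ends: "a \<in> arcs G \<Longrightarrow> pos (head G a) \<noteq> pos (tail G a)"
  using no_loops[of a] pos_eqD[of "head G a" "tail G a"] by auto

lemma not_inc: "a \<in> arcs G \<Longrightarrow> \<not> inc a \<longleftrightarrow> pos (tail G a) < pos (head G a)"
  using pos_ends[of a] by (auto simp: inc_def)

lemma inc_arev: "a \<in> arcs G \<Longrightarrow> inc (arev a) \<longleftrightarrow> \<not> inc a"
  using not_inc[of a] by (simp add: inc_def)

text \<open>The height is an arbitrary integer function so that \<open>pos\<close> and its negative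
  give the top and the bottom corner of a face alike.\<close>

lemma face_extremum:
  fixes h :: "'a \<Rightarrow> int"
  assumes a: "a \<in> arcs G" and h: "\<And>y. y \<in> arcs G \<Longrightarrow> h (head G y) \<noteq> h (tail G y)"
  shows "\<exists>x\<in>lf a. h (tail G x) < h (head G x) \<and> h (head G (nxt x)) < h (head G x) \<and>
    (\<forall>y\<in>lf a. h (head G y) \<le> h (head G x))"
proof -
  define P where "P = (\<lambda>y. h (head G y)) ` lf a"
  have P: "finite P" "P \<noteq> {}" using lf_self[of a] unfolding P_def by (simp, blast)
  obtain x where x: "x \<in> lf a" "h (head G x) = Max P"
    using Max_in[OF P] by (auto simp: P_def)
  have max: "h (head G y) \<le> h (head G x)" if "y \<in> lf a" for y
    using Max_ge[OF P(1)] that x by (auto simp: P_def)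
  obtain y where y: "nxt y = x" using nxt_surj by blast
  have arcs: "x \<in> arcs G" "y \<in> arcs G" using lf_arcs[OF a x(1)] y by auto
  have "h (tail G x) \<le> h (head G x)" using max[of y] x(1) arcs by (simp flip: y)
  then have "h (tail G x) < h (head G x)" using h[OF arcs(1)] by simp
  moreover have "h (head G (nxt x)) < h (head G x)"
    using max[of "nxt x"] x(1) arcs h[of "nxt x"] by simp
  ultimately show ?thesis using x max by blast
qed

lemma face_max:
  assumes "a \<in> arcs G"
  shows "\<exists>x\<in>lf a. \<not> inc x \<and> inc (nxt x) \<and> (\<forall>y\<in>lf a. pos (head G y) \<le> pos (head G x))"
proof -
  obtain x where x: "x \<in> lf a" "int (pos (tail G x)) < int (pos (head G x))"
      "int (pos (head G (nxt x))) < int (pos (head G x))"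
      "\<And>y. y \<in> lf a \<Longrightarrow> int (pos (head G y)) \<le> int (pos (head G x))"
    using face_extremum[OF assms, of "\<lambda>v. int (pos v)"] pos_ends by auto
  have "tail G (nxt x) = head G x" using lf_arcs[OF assms x(1)] by simp
  then show ?thesis using x by (intro bexI[of _ x]) (auto simp: inc_def)
qed

lemma face_min:
  assumes "a \<in> arcs G"
  shows "\<exists>x\<in>lf a. inc x \<and> \<not> inc (nxt x) \<and> (\<forall>y\<in>lf a. pos (head G x) \<le> pos (head G y))"
proof -
  obtain x where x: "x \<in> lf a" "- int (pos (tail G x)) < - int (pos (head G x))"
      "- int (pos (head G (nxt x))) < - int (pos (head G x))"
      "\<And>y. y \<in> lf a \<Longrightarrow> - int (pos (head G y)) \<le> - int (pos (head G x))"
    using face_extremum[OF assms, of "\<lambda>v. - int (pos v)"] pos_ends by auto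
  have "tail G (nxt x) = head G x" using lf_arcs[OF assms x(1)] by simp
  then show ?thesis using x by (intro bexI[of _ x]) (auto simp: inc_def)
qed

lemma in_to_out:
  assumes "v \<in> verts G" "v \<noteq> s" "v \<noteq> t"
  shows "\<exists>a\<in>arcs G. tail G a = v \<and> inc a \<and> \<not> inc (cw a)"
    and "\<exists>a\<in>arcs G. tail G a = v \<and> \<not> inc a \<and> inc (cw a)"
proof -
  obtain a b where a: "a \<in> arcs G" "tail G a = v" "inc a" and b: "b \<in> arcs G" "tail G b = v" "\<not> inc b"
    using lower[of v] higher[of v] assms by (fastforce simp: inc_def)
  have cyc: "cyclic_on cw (out_arcs G v)" using cyclic_out a by blast
  show "\<exists>a\<in>arcs G. tail G a = v \<and> inc a \<and> \<not> inc (cw a)"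
  proof -
    have "\<exists>e\<in>{a \<in> out_arcs G v. inc a}. cw e \<notin> {a \<in> out_arcs G v. inc a}"
      using a b by (intro cyclic_on_exit[OF cyc]) (auto simp: out_arcs_def)
    then show ?thesis by auto
  qed
  show "\<exists>a\<in>arcs G. tail G a = v \<and> \<not> inc a \<and> inc (cw a)"
  proof -
    have "\<exists>e\<in>{a \<in> out_arcs G v. \<not> inc a}. cw e \<notin> {a \<in> out_arcs G v. \<not> inc a}"
      using a b by (intro cyclic_on_exit[OF cyc]) (auto simp: out_arcs_def)
    then show ?thesis by auto
  qed
qed

text \<open>
  Every corner is of one of four kinds. Each vertex other than \<open>s\<close> and \<open>t\<close> has at least one corner of
  each mixed kind, each face has at least one corner of each unmixed kind, and by Euler's formula these
  are already all corners.
\<close>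

lemma corner_counts:
  shows "inj_on lf {x \<in> arcs G. \<not> inc x \<and> inc (nxt x)}"
    and "inj_on lf {x \<in> arcs G. inc x \<and> \<not> inc (nxt x)}"
    and "inj_on (tail G) {a \<in> arcs G. inc a \<and> \<not> inc (cw a)}"
proof -
  define II where "II = {a \<in> arcs G. inc a \<and> inc (cw a)}"
  define OOc where "OOc = {a \<in> arcs G. \<not> inc a \<and> \<not> inc (cw a)}"
  define IO where "IO = {a \<in> arcs G. inc a \<and> \<not> inc (cw a)}"
  define OI where "OI = {a \<in> arcs G. \<not> inc a \<and> inc (cw a)}"
  define Top where "Top = {x \<in> arcs G. \<not> inc x \<and> inc (nxt x)}"
  define Bot where "Bot = {x \<in> arcs G. inc x \<and> \<not> inc (nxt x)}"
  have fin: "finite II" "finite OOc" "finite IO" "finite OI" "finite Top" "finite Bot"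
    by (simp_all add: II_def OOc_def IO_def OI_def Top_def Bot_def)
  have "arcs G = (II \<union> OOc) \<union> (IO \<union> OI)" by (auto simp: II_def OOc_def IO_def OI_def)
  then have "card (arcs G) = card ((II \<union> OOc) \<union> (IO \<union> OI))" by simp
  also have "\<dots> = card (II \<union> OOc) + card (IO \<union> OI)"
    using fin by (intro card_Un_disjoint) (auto simp: II_def OOc_def IO_def OI_def)
  also have "card (II \<union> OOc) = card II + card OOc"
    using fin by (intro card_Un_disjoint) (auto simp: II_def OOc_def)
  also have "card (IO \<union> OI) = card IO + card OI"
    using fin by (intro card_Un_disjoint) (auto simp: IO_def OI_def)
  finally have total: "card (arcs G) = card II + card OOc + (card IO + card OI)" .
  \<comment> \<open>A corner is \<open>(a, cw a)\<close> seen from its vertex and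
    \<open>(x, nxt x)\<close> seen along its face, with \<open>x = arev a\<close>. Reversal flips
    \<open>inc\<close>, so two incoming arcs in a row at a vertex are a local maximum of the
    face.\<close>
  have "II = arev ` Top"
    unfolding II_def Top_def by (auto simp: inc_arev) (metis (no_types, lifting) arev_arev arev_in_arcs_iff image_eqI inc_arev mem_Collect_eq)
  then have II: "card II = card Top" using card_image[OF inj_on_arev, of Top] by simp
  have "OOc = arev ` Bot"
    unfolding OOc_def Bot_def by (auto simp: inc_arev) (metis (no_types, lifting) arev_arev arev_in_arcs_iff image_eqI inc_arev mem_Collect_eq)
  then have OOc: "card OOc = card Bot" using card_image[OF inj_on_arev, of Bot] by simp
  have "faces G arev cw \<subseteq> lf ` Top"
    using face_max lf_arcs lf_eqI unfolding faces_def Top_def by (fastforce simp: image_iff)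
  then have fT: "card (faces G arev cw) \<le> card (lf ` Top)" using fin by (intro card_mono) auto
  have "faces G arev cw \<subseteq> lf ` Bot"
    using face_min lf_arcs lf_eqI unfolding faces_def Bot_def by (fastforce simp: image_iff)
  then have fB: "card (faces G arev cw) \<le> card (lf ` Bot)" using fin by (intro card_mono) auto
  have cV: "card (verts G - {s, t}) = card (verts G) - 2" "2 \<le> card (verts G)"
    using st card_mono[of "verts G" "{s, t}"] by (auto simp: card_Diff_subset)
  have "verts G - {s, t} \<subseteq> tail G ` IO" using in_to_out(1) unfolding IO_def by fastforce
  then have vIO: "card (verts G) - 2 \<le> card (tail G ` IO)"
    unfolding cV(1)[symmetric] using fin by (intro card_mono) auto
  have "verts G - {s, t} \<subseteq> tail G ` OI" using in_to_out(2) unfolding OI_def by fastforce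
  then have vOI: "card (verts G) - 2 \<le> card (tail G ` OI)"
    unfolding cV(1)[symmetric] using fin by (intro card_mono) auto
  \<comment> \<open>Euler's formula is stated with \<open>div\<close>; parity turns it into an
    equation.\<close>
  have even: "even (card (arcs G))"
  proof -
    define I where "I = {a \<in> arcs G. inc a}"
    have "arcs G = I \<union> arev ` I"
      unfolding I_def by (auto simp: inc_arev) (metis (no_types, lifting) arev_arev arev_in_arcs_iff image_eqI inc_arev mem_Collect_eq)
    moreover have "I \<inter> arev ` I = {}" by (auto simp: I_def inc_arev)
    moreover have "finite I" by (simp add: I_def)
    ultimately have "card (arcs G) = card I + card (arev ` I)" using card_Un_disjoint[of I "arev ` I"] by simp
    then show ?thesis using card_image[OF inj_on_arev, of I] by simp
  qed
  note le = card_image_le[OF fin(5), of lf] card_image_le[OF fin(6), of lf]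
    card_image_le[OF fin(3), of "tail G"] card_image_le[OF fin(4), of "tail G"]
  \<comment> \<open>There are as many corners as arcs. By the bounds collected above they number at
    least 2 F + 2 (V - 2), for F faces and V vertices, and this is \<open>card (arcs G)\<close> by
    Euler's formula. So all these inequalities are equalities.\<close>
  have eq: "card (lf ` Top) = card Top" "card (lf ` Bot) = card Bot" "card (tail G ` IO) = card IO"
  proof -
    obtain k where "card (arcs G) = 2 * k" using even by (elim evenE)
    then show "card (lf ` Top) = card Top" "card (lf ` Bot) = card Bot" "card (tail G ` IO) = card IO"
      using total II OOc fT fB vIO vOI le euler cV(2) by simp_all
  qed
  show "inj_on lf {x \<in> arcs G. \<not> inc x \<and> inc (nxt x)}"
    using eq_card_imp_inj_on[OF fin(5) eq(1)] by (simp add: Top_def)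
  show "inj_on lf {x \<in> arcs G. inc x \<and> \<not> inc (nxt x)}"
    using eq_card_imp_inj_on[OF fin(6) eq(2)] by (simp add: Bot_def)
  show "inj_on (tail G) {a \<in> arcs G. inc a \<and> \<not> inc (cw a)}"
    using eq_card_imp_inj_on[OF fin(3) eq(3)] by (simp add: IO_def)
qed

lemma face_top_unique:
  "\<lbrakk>x \<in> arcs G; y \<in> arcs G; lf x = lf y; \<not> inc x; inc (nxt x); \<not> inc y; inc (nxt y)\<rbrakk> \<Longrightarrow> x = y"
  using corner_counts(1) by (auto dest: inj_onD)

lemma face_bot_unique:
  "\<lbrakk>x \<in> arcs G; y \<in> arcs G; lf x = lf y; inc x; \<not> inc (nxt x); inc y; \<not> inc (nxt y)\<rbrakk> \<Longrightarrow> x = y"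
  using corner_counts(2) by (auto dest: inj_onD)

lemma last_in_unique:
  "\<lbrakk>a \<in> arcs G; b \<in> arcs G; tail G a = tail G b; inc a; \<not> inc (cw a); inc b; \<not> inc (cw b)\<rbrakk> \<Longrightarrow> a = b"
  using corner_counts(3) by (auto dest: inj_onD)

lemma face_top_max:
  assumes "x \<in> arcs G" "\<not> inc x" "inc (nxt x)" "y \<in> lf x"
  shows "pos (head G y) \<le> pos (head G x)"
proof -
  obtain m where m: "m \<in> lf x" "\<not> inc m" "inc (nxt m)" "\<forall>y\<in>lf x. pos (head G y) \<le> pos (head G m)"
    using face_max[OF assms(1)] by blast
  moreover have "m = x" using m assms face_top_unique[of m x] lf_arcs[OF assms(1) m(1)] lf_eqI by blast
  ultimately show ?thesis using assms by blast
qed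

lemma face_bot_min:
  assumes "x \<in> arcs G" "inc x" "\<not> inc (nxt x)" "y \<in> lf x"
  shows "pos (head G x) \<le> pos (head G y)"
proof -
  obtain m where m: "m \<in> lf x" "inc m" "\<not> inc (nxt m)" "\<forall>y\<in>lf x. pos (head G m) \<le> pos (head G y)"
    using face_min[OF assms(1)] by blast
  moreover have "m = x" using m assms face_bot_unique[of m x] lf_arcs[OF assms(1) m(1)] lf_eqI by blast
  ultimately show ?thesis using assms by blast
qed

text \<open>If \<open>f\<close> took two values on the incoming arcs of \<open>v\<close>, each value
  class would have to be left somewhere in the rotation. By \<open>step\<close> that happens only
  from an incoming to an outgoing arc, which \<open>last_in_unique\<close> allows once.\<close>

lemma in_arcs_const:
  assumes v: "v \<in> verts G"
    and step: "\<And>a. \<lbrakk>a \<in> arcs G; tail G a = v; inc a; inc (cw a)\<rbrakk> \<Longrightarrow> f a = f (cw a)"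
    and ab: "a \<in> arcs G" "tail G a = v" "inc a" "b \<in> arcs G" "tail G b = v" "inc b"
  shows "f a = f b"
proof (rule ccontr)
  assume ne: "f a \<noteq> f b"
  have cyc: "cyclic_on cw (out_arcs G v)" using cyclic_out ab by blast
  have *: "\<exists>e\<in>arcs G. tail G e = v \<and> inc e \<and> \<not> inc (cw e) \<and> f e = c"
    if "x \<in> arcs G" "tail G x = v" "inc x" "f x = c" "y \<in> arcs G" "tail G y = v" "inc y" "f y \<noteq> c" for c x y
  proof -
    define J where "J = {e \<in> out_arcs G v. inc e \<and> f e = c}"
    have "\<exists>e\<in>J. cw e \<notin> J"
    proof (rule cyclic_on_exit[OF cyc])
      show "J \<subseteq> out_arcs G v" "J \<noteq> {}" using that by (auto simp: J_def)
      have "y \<in> out_arcs G v" "y \<notin> J" using that by (auto simp: J_def)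
      then show "J \<noteq> out_arcs G v" by blast
    qed
    then obtain e where "e \<in> J" "cw e \<notin> J" by blast
    then have "e \<in> arcs G" "tail G e = v" "inc e" "f e = c" "\<not> (inc (cw e) \<and> f (cw e) = c)"
      by (auto simp: J_def)
    then show ?thesis using step[of e] by auto
  qed
  obtain e where "e \<in> arcs G" "tail G e = v" "inc e" "\<not> inc (cw e)" "f e = f a"
    using *[of a "f a" b] ab ne by auto
  moreover obtain e' where "e' \<in> arcs G" "tail G e' = v" "inc e'" "\<not> inc (cw e')" "f e' = f b"
    using *[of b "f b" a] ab ne by auto
  ultimately show False using last_in_unique[of e e'] ne by auto
qed

text \<open>
  Discrete Poincare lemma: the potential extends along the numbering, since the face between two
  consecutive incoming arcs of \<open>z\<close> has \<open>z\<close> as its top, so that all its other vertices precede \<open>z\<close>.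
\<close>

lemma closed_imp_exact:
  fixes w :: "'b \<Rightarrow> int"
  assumes anti: "\<And>a. a \<in> arcs G \<Longrightarrow> w (arev a) = - w a"
    and closed: "\<And>a. a \<in> arcs G \<Longrightarrow> (\<Sum>b\<in>lf a. w b) = 0"
  obtains p where "\<And>a. a \<in> arcs G \<Longrightarrow> w a = p (head G a) - p (tail G a)"
proof -
  have "\<exists>p. \<forall>a\<in>arcs G. pos (tail G a) < n \<and> pos (head G a) < n \<longrightarrow> w a = p (head G a) - p (tail G a)" for n
  proof (induction n)
    case (Suc n)
    then obtain p where p: "\<And>a. \<lbrakk>a \<in> arcs G; pos (tail G a) < n; pos (head G a) < n\<rbrakk> \<Longrightarrow>
      w a = p (head G a) - p (tail G a)" by blast
    show ?case
    proof (cases "\<exists>a\<in>arcs G. pos (tail G a) = n \<and> inc a")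
      case False
      have "pos (tail G a) < n \<and> pos (head G a) < n"
        if a: "a \<in> arcs G" "pos (tail G a) < Suc n" "pos (head G a) < Suc n" for a
      proof -
        have "\<not> (pos (tail G a) = n \<and> inc a)" "\<not> (pos (tail G (arev a)) = n \<and> inc (arev a))"
          using False a(1) by auto
        then show ?thesis using a pos_ends[of a] by (auto simp: inc_def)
      qed
      then show ?thesis using p by blast
    next
      case True
      then obtain a0 where a0: "a0 \<in> arcs G" "pos (tail G a0) = n" "inc a0" by blast
      define z where "z = tail G a0"
      \<comment> \<open>The value that the potential needs at \<open>z\<close> for
        \<open>w c\<close> to be its difference along \<open>c\<close>. It must not depend on the
        choice of the incoming arc \<open>c\<close>.\<close>
      define val where "val c = p (head G c) - w c" for c
      have z: "z \<in> verts G" "pos z = n" using a0 by (auto simp: z_def)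
      have zI: "v = z" if "v \<in> verts G" "pos v = n" for v using that z pos_eqD by auto
      have step: "val c = val (cw c)" if c: "c \<in> arcs G" "tail G c = z" "inc c" "inc (cw c)" for c
      proof -
        define x where "x = arev c"
        have x: "x \<in> arcs G" "\<not> inc x" "inc (nxt x)" "head G x = z" "nxt x = cw c"
          using c by (auto simp: x_def inc_arev)
        have arcs: "y \<in> arcs G" if "y \<in> lf x" for y using that x lf_arcs by blast
        have mem: "x \<in> lf x" "cw c \<in> lf x" using x(5) nxt_in_lf[of x x] by auto
        have ne: "x \<noteq> cw c" using x by auto
        define R where "R = lf x - {x, cw c}"
        have split: "(\<Sum>y\<in>lf x. g y) = (\<Sum>y\<in>R. g y) + g x + g (cw c)" for g :: "'b \<Rightarrow> int"
          using sum.subset_diff[of "{x, cw c}" "lf x" g] mem ne by (simp add: R_def)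
        \<comment> \<open>Each visit of the face to its maximal vertex is a top corner, and there is
          only one; so \<open>z\<close> occurs just as the head of \<open>x\<close> and as the tail
          of \<open>cw c\<close>.\<close>
        have head_z: "y = x" if "y \<in> lf x" "head G y = z" for y
        proof -
          have "\<not> inc y"
          proof
            assume "inc y"
            obtain y' where y': "nxt y' = y" using nxt_surj by blast
            have "y' \<in> lf x" using that(1) by (simp flip: y')
            then have "pos (head G y') \<le> pos z" using face_top_max[OF x(1-3)] x(4) by simp
            moreover have "head G y' = tail G y" using arcs[OF \<open>y' \<in> lf x\<close>] by (auto simp flip: y')
            ultimately show False using \<open>inc y\<close> that by (auto simp: inc_def)
          qed
          moreover have "inc (nxt y)"
          proof -
            have "nxt y \<in> lf x" using that by simp
            then have "pos (head G (nxt y)) \<le> pos z" using face_top_max[OF x(1-3)] x(4) by metis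
            then show ?thesis using arcs[OF that(1)] that(2) pos_ends[of "nxt y"] by (simp add: inc_def)
          qed
          ultimately show ?thesis
            using face_top_unique[of y x] x arcs that lf_eqI by metis
        qed
        have tail_z: "y = cw c" if "y \<in> lf x" "tail G y = z" for y
        proof -
          obtain y' where y': "nxt y' = y" using nxt_surj by blast
          have "y' \<in> lf x" using that(1) by (simp flip: y')
          moreover have "head G y' = tail G y" using arcs[OF \<open>y' \<in> lf x\<close>] by (auto simp flip: y')
          ultimately have "y' = x" using head_z that by simp
          then show ?thesis using y' x by simp
        qed
        have less: "pos (head G y) < n" if "y \<in> lf x" "y \<noteq> x" for y
          using face_top_max[OF x(1-3) that(1)] x(4) z head_z[OF that(1)] that(2) zI[of "head G y"]
            arcs[OF that(1)] by (metis head_in_verts le_neq_implies_less)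
        have less': "pos (tail G y) < n" if "y \<in> lf x" "y \<noteq> cw c" for y
        proof -
          obtain y' where y': "nxt y' = y" using nxt_surj by blast
          have "y' \<in> lf x" using that(1) by (simp flip: y')
          moreover have "head G y' = tail G y" using arcs[OF \<open>y' \<in> lf x\<close>] by (auto simp flip: y')
          ultimately show ?thesis using less[of y'] that(2) y' x(5) by auto
        qed
        \<comment> \<open>A gradient sums to zero around the face whatever its value at
          \<open>z\<close>. With 0 there, comparison with the sum of \<open>w\<close> leaves exactly
          \<open>val c = val (cw c)\<close>.\<close>
        define q where "q = p(z := 0)"
        have "(\<Sum>y\<in>R. w y) = (\<Sum>y\<in>R. q (head G y) - q (tail G y))"
        proof (rule sum.cong[OF refl])
          fix y assume y: "y \<in> R"
          then have "head G y \<noteq> z" "tail G y \<noteq> z" using head_z tail_z by (auto simp: R_def)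
          then show "w y = q (head G y) - q (tail G y)"
            using p[of y] less[of y] less'[of y] arcs[of y] y by (simp add: R_def q_def)
        qed
        moreover have "(\<Sum>y\<in>R. w y) + w x + w (cw c) = 0"
          using closed[OF x(1)] split[of w] by simp
        moreover have "(\<Sum>y\<in>R. q (head G y) - q (tail G y)) + (q (head G x) - q (tail G x)) +
            (q (head G (cw c)) - q (tail G (cw c))) = 0"
          using sum_gradient[OF x(1), of q] split[of "\<lambda>y. q (head G y) - q (tail G y)"] by simp
        moreover have "w x = - w c" using anti c by (simp add: x_def)
        moreover have "tail G x = head G c" "tail G (cw c) = z" using c by (auto simp: x_def)
        moreover have "head G c \<noteq> z" "head G (cw c) \<noteq> z"
          using c no_loops[of c] no_loops[of "cw c"] by auto
        ultimately show ?thesis using x(4) by (simp add: val_def q_def)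
      qed
      have const: "val c = val a0" if "c \<in> arcs G" "tail G c = z" "inc c" for c
        by (rule in_arcs_const[where f = val and a = c and b = a0, OF z(1) step that a0(1) z_def[symmetric] a0(3)])
      define p' where "p' = p(z := val a0)"
      have "w a = p' (head G a) - p' (tail G a)"
        if a: "a \<in> arcs G" "pos (tail G a) < Suc n" "pos (head G a) < Suc n" for a
      proof -
        consider "tail G a = z" | "head G a = z" | "tail G a \<noteq> z" "head G a \<noteq> z" by blast
        then show ?thesis
        proof cases
          case 1
          then have "inc a" using a pos_ends[of a] z by (auto simp: inc_def)
          then show ?thesis using const[OF a(1) 1] 1 no_loops[OF a(1)] by (auto simp: p'_def val_def)
        next
          case 2
          then have "inc (arev a)" using a pos_ends[of a] z by (auto simp: inc_def)
          then show ?thesis using const[of "arev a"] 2 a no_loops[OF a(1)] anti[OF a(1)]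
            by (auto simp: p'_def val_def)
        next
          case 3
          then have "pos (tail G a) < n" "pos (head G a) < n"
            using a zI[of "tail G a"] zI[of "head G a"] by (auto simp: less_Suc_eq)
          then show ?thesis using p[OF a(1)] 3 by (auto simp: p'_def)
        qed
      qed
      then show ?thesis by blast
    qed
  qed simp
  from this[of "Suc (Max (pos ` verts G))"] obtain p where
    p: "\<And>a. \<lbrakk>a \<in> arcs G; pos (tail G a) < Suc (Max (pos ` verts G)); pos (head G a) < Suc (Max (pos ` verts G))\<rbrakk> \<Longrightarrow>
      w a = p (head G a) - p (tail G a)" by blast
  have "w a = p (head G a) - p (tail G a)" if "a \<in> arcs G" for a
    using that by (intro p) (auto simp: less_Suc_eq_le)
  then show thesis using that by blast
qed

end

section \<open>The dual of a plane graph\<close>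

lemma induced_cw_first_return:
  assumes "permutation f" "x \<in> A"
  obtains k where "0 < k" "induced_cw f A x = (f ^^ k) x" "(f ^^ k) x \<in> A"
    "\<And>i. \<lbrakk>0 < i; i < k\<rbrakk> \<Longrightarrow> (f ^^ i) x \<notin> A"
proof -
  let ?P = "\<lambda>n. 0 < n \<and> (f ^^ n) x \<in> A"
  have "\<exists>n. ?P n" using permutation_self[OF assms(1), of x] assms(2) by metis
  then have "?P (LEAST n. ?P n)" by (rule LeastI_ex)
  moreover have "(f ^^ i) x \<notin> A" if "0 < i" "i < (LEAST n. ?P n)" for i
    using not_less_Least[OF that(2)] that(1) by blast
  ultimately show thesis using that[of "LEAST n. ?P n"] by (auto simp: induced_cw_def)
qed

text \<open>If two elements of \<open>A\<close> had the same first return, cancelling the shorter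
  return time would place one of them on the way of the other, strictly before its return.\<close>

lemma inj_on_induced_cw:
  assumes f: "permutation f"
  shows "inj_on (induced_cw f A) A"
proof -
  have *: "x = y"
    if xy: "x \<in> A" "y \<in> A" and eq: "(f ^^ k) x = (f ^^ l) y" and kl: "k \<le> l"
      and l: "\<And>i. \<lbrakk>0 < i; i < l\<rbrakk> \<Longrightarrow> (f ^^ i) y \<notin> A" "0 < k" for x y k l
  proof -
    have "(f ^^ k) x = (f ^^ k) ((f ^^ (l - k)) y)"
      using kl eq by (simp add: funpow_add[symmetric, THEN fun_cong, unfolded o_def])
    moreover have "inj (f ^^ k)" using f by (intro inj_fn) (simp add: permutation_bijective bij_is_inj)
    ultimately have "x = (f ^^ (l - k)) y" by (auto dest: injD)
    moreover have "l - k = 0" using l(1)[of "l - k"] l(2) kl xy calculation by (cases "l - k = 0") auto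
    ultimately show ?thesis by simp
  qed
  show ?thesis
  proof (rule inj_onI)
    fix x y assume xy: "x \<in> A" "y \<in> A" "induced_cw f A x = induced_cw f A y"
    obtain k where k: "0 < k" "induced_cw f A x = (f ^^ k) x" "\<And>i. \<lbrakk>0 < i; i < k\<rbrakk> \<Longrightarrow> (f ^^ i) x \<notin> A"
      using induced_cw_first_return[OF f xy(1)] by metis
    obtain l where l: "0 < l" "induced_cw f A y = (f ^^ l) y" "\<And>i. \<lbrakk>0 < i; i < l\<rbrakk> \<Longrightarrow> (f ^^ i) y \<notin> A"
      using induced_cw_first_return[OF f xy(2)] by metis
    show "x = y"
    proof (cases "k \<le> l")
      case True then show ?thesis using *[of x y k l] xy k l by simp
    next
      case False then show ?thesis using *[of y x l k] xy k l by simp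
    qed
  qed
qed

context plane_graph
begin

text \<open>The inverse of the face permutation (\<open>cwd_eq_inv\<close>). The arcs of an inner
  face run counter-clockwise around it, so the dual arcs that leave the face through them are met
  clockwise in the reverse order.\<close>

definition cwd :: "'b \<Rightarrow> 'b" where "cwd = arev \<circ> inv cw"
abbreviation Dual :: "('b set, 'b) pre_digraph" where "Dual \<equiv> dual_graph G arev cw"

lemma dual_simps [simp]:
  "verts Dual = faces G arev cw" "arcs Dual = arcs G" "tail Dual = lf" "head Dual a = lf (arev a)"
  by (simp_all add: dual_graph_def right_face_def)

lemma lf_in_faces [simp]: "a \<in> arcs G \<Longrightarrow> lf a \<in> faces G arev cw"
  by (simp add: faces_def)

lemma faceE:
  assumes "F \<in> faces G arev cw"
  obtains a where "a \<in> arcs G" "F = lf a"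
  using assms by (auto simp: faces_def)

lemma wf_dual: "wf_digraph Dual"
  by unfold_locales auto

lemma bidirected_dual: "bidirected_digraph Dual arev"
  by (intro bidirected_digraph.intro bidirected_digraph_axioms.intro wf_dual) (auto simp: arev_dom)

lemma sym_dual: "symmetric Dual"
  unfolding symmetric_conv by (auto intro!: bexI[where x = "arev _"])

lemma nxt_cwd [simp]: "nxt (cwd a) = a"
  using permutes_inverses(1)[OF cw_permutes] by (simp add: cwd_def)

lemma cwd_nxt [simp]: "cwd (nxt a) = a"
  using permutes_inverses(2)[OF cw_permutes] by (simp add: cwd_def)

lemma cwd_eq_inv: "cwd = inv (cw \<circ> arev)"
  by (rule inv_equality[symmetric]) (use nxt_cwd cwd_nxt in auto)

lemma permutes_cwd: "cwd permutes arcs G"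
  unfolding cwd_eq_inv by (rule permutes_inv[OF permutes_nxt])

lemma permutation_cwd: "permutation cwd"
  unfolding cwd_eq_inv by (rule permutation_inverse[OF permutation_nxt])

lemma cwd_in_arcs [simp]: "cwd a \<in> arcs G \<longleftrightarrow> a \<in> arcs G"
  by (rule permutes_in_image[OF permutes_cwd])

lemma lf_cwd [simp]: "lf (cwd a) = lf a"
  using lf_nxt[of "cwd a"] by (simp only: nxt_cwd)

lemma head_cwd: "a \<in> arcs G \<Longrightarrow> head G (cwd a) = tail G a"
proof -
  assume a: "a \<in> arcs G"
  then have "cwd a \<in> arcs G" by (simp only: cwd_in_arcs)
  then have "tail G (nxt (cwd a)) = head G (cwd a)" by (simp del: nxt_cwd)
  then show ?thesis by (simp only: nxt_cwd)
qed

lemma out_arcs_dual: "a \<in> arcs G \<Longrightarrow> out_arcs Dual (lf a) = lf a"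
  using lf_arcs by (auto simp: out_arcs_def in_lf_iff)

lemma cyclic_dual: "cyclic_on cwd (lf a)"
proof -
  have "orbit (cw \<circ> arev) x = orbit cwd x" for x
    unfolding cwd_eq_inv by (rule orbit_inv_eq[OF permutation_nxt, symmetric])
  then show ?thesis using cyclic_lf unfolding cyclic_on_def by metis
qed

text \<open>The dual arc of \<open>a\<close> crosses \<open>a\<close> from left to right, hence has
  the head of \<open>a\<close> on its left. So the faces of the dual are the vertices of
  \<open>G\<close>, each represented by its incoming arcs.\<close>

lemma left_face_dual:
  assumes "a \<in> arcs G"
  shows "left_face arev cwd a = in_arcs G (head G a)"
proof -
  have perm: "permutation cw" using cw_permutes finite_arcs unfolding permutation_permutes by blast
  have "arev ` orbit (inv cw) (arev a) = orbit (cwd \<circ> arev) (arev (arev a))"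
    by (rule orbit_inverse) (auto simp: cwd_def intro: permutation_self_in_orbit permutation_inverse perm)
  then have "left_face arev cwd a = arev ` orbit cw (arev a)"
    by (simp add: left_face_def orbit_inv_eq[OF perm])
  also have "orbit cw (arev a) = out_arcs G (head G a)"
    using orbit_cyclic_eq3[OF cyclic_out[of "arev a"], of "arev a"] assms by (simp add: out_arcs_def)
  finally show ?thesis by (simp add: in_arcs_eq)
qed

text \<open>Vertices and faces trade places while the arcs stay, so Euler's formula remains the same
  equation. Dual faces are sets of arcs, so an isolated vertex would have no counterpart;
  \<open>deg\<close> excludes that.\<close>

lemma plane_embedding_dual:
  assumes "connected Dual" and deg: "\<And>v. v \<in> verts G \<Longrightarrow> out_arcs G v \<noteq> {}"
  shows "plane_embedding Dual arev cwd"
proof -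
  have "fin_digraph Dual"
    by (intro fin_digraph.intro fin_digraph_axioms.intro wf_dual) (auto simp: finite_faces)
  moreover have "cyclic_on cwd (out_arcs Dual F)" if "F \<in> faces G arev cw" for F
    using that cyclic_dual by (metis faceE out_arcs_dual)
  moreover have "faces Dual arev cwd = in_arcs G ` verts G"
  proof -
    have "\<exists>a\<in>arcs G. head G a = v" if "v \<in> verts G" for v
      using deg[OF that] by (auto simp: out_arcs_def intro!: bexI[where x = "arev _"])
    then have "verts G = head G ` arcs G" by fastforce
    then show ?thesis unfolding faces_def by (simp add: left_face_dual image_image)
  qed
  moreover have "inj_on (in_arcs G) (verts G)"
  proof (rule inj_onI)
    fix u v assume uv: "u \<in> verts G" "v \<in> verts G" "in_arcs G u = in_arcs G v"
    obtain a where "a \<in> out_arcs G u" using deg[OF uv(1)] by blast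
    then have a: "arev a \<in> in_arcs G u" by (auto simp: out_arcs_def in_arcs_def)
    then have "arev a \<in> in_arcs G v" by (simp only: uv(3))
    then show "u = v" using a by (simp add: in_arcs_def)
  qed
  then have "card (in_arcs G ` verts G) = card (verts G)" by (rule card_image)
  ultimately show ?thesis
    using assms(1) permutes_cwd bidirected_dual euler by (simp add: plane_embedding_def)
qed

text \<open>Otherwise the neighbours of \<open>v\<close> would separate it from the remaining
  vertices.\<close>

lemma degree_ge_3:
  assumes three_connected: "k_connected 3 G" and v: "v \<in> verts G" and X: "\<And>a. \<lbrakk>a \<in> arcs G; tail G a = v\<rbrakk> \<Longrightarrow> head G a \<in> X" "finite X"
  shows "3 \<le> card X"
proof (rule ccontr)
  assume "\<not> 3 \<le> card X"
  then have 3: "card X < 3" by simp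
  define Y where "Y = X \<inter> verts G - {v}"
  have "card Y \<le> card X" using X(2) by (intro card_mono) (auto simp: Y_def)
  then have Y: "card Y < 3" "finite Y" using 3 X(2) by (auto simp: Y_def)
  have "insert v Y \<noteq> verts G"
  proof
    assume "insert v Y = verts G"
    then have "card (verts G) \<le> 3" using card_insert_le_m1[of 3 Y v] Y by simp
    then show False using three_connected by (simp add: k_connected_def)
  qed
  then obtain x where "x \<in> arcs G" "tail G x = v" "head G x \<in> verts G - Y - {v}"
    using k_connected_cut[OF three_connected sym_arcs, of Y "{v}"] Y v by (auto simp: Y_def)
  then show False using X(1)[of x] by (auto simp: Y_def)
qed

end

section \<open>Consequences of 3-connectivity for faces\<close>

locale st_plane3 = st_plane G arev cw pos s t
  for G :: "('a, 'b) pre_digraph" and arev cw pos s t +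
  assumes three_connected: "k_connected 3 G"
begin

text \<open>\<open>A\<close> is a sublevel set of the potential of \<open>w\<close>: an arc that
  leaves it increases the potential.\<close>

lemma closed_cut:
  fixes w :: "'b \<Rightarrow> int"
  assumes anti: "\<And>a. a \<in> arcs G \<Longrightarrow> w (arev a) = - w a"
    and closed: "\<And>a. a \<in> arcs G \<Longrightarrow> (\<Sum>b\<in>lf a. w b) = 0"
    and a: "a \<in> arcs G" "0 < w a"
  obtains A where "A \<subseteq> verts G" "tail G a \<in> A" "head G a \<in> verts G - A"
    "\<And>x. \<lbrakk>x \<in> arcs G; tail G x \<in> A; head G x \<notin> A\<rbrakk> \<Longrightarrow> 0 < w x"
proof -
  obtain p where p: "\<And>a. a \<in> arcs G \<Longrightarrow> w a = p (head G a) - p (tail G a)"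
    using closed_imp_exact[OF anti closed] by blast
  show thesis
    by (rule that[of "{v \<in> verts G. p v \<le> p (tail G a)}"]) (use a p in auto)
qed

text \<open>Choosing one end of each of the two edges gives at most two vertices that meet every
  edge across the cut, and they separate \<open>G\<close> as long as both sides keep a vertex. Both
  tails or both heads work unless they exhaust their sides. Then \<open>G\<close> consists of four
  distinct ends, and the tail of \<open>a\<close> with the head of \<open>b\<close> works. The case
  \<open>a = b\<close> covers bridges.\<close>

lemma no_small_cut:
  assumes A: "A \<subseteq> verts G"
    and a: "a \<in> arcs G" "tail G a \<in> A" "head G a \<notin> A"
    and b: "b \<in> arcs G" "tail G b \<in> A" "head G b \<notin> A"
    and only: "\<And>x. \<lbrakk>x \<in> arcs G; tail G x \<in> A; head G x \<notin> A\<rbrakk> \<Longrightarrow> x = a \<or> x = b"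
  shows False
proof -
  note cut = k_connected_cut[OF three_connected sym_arcs]
  have sep: False if X: "X = {u, v}" "u \<in> verts G" "v \<in> verts G" "A - X \<noteq> {}" "verts G - A - X \<noteq> {}"
    and hit: "\<And>x. \<lbrakk>x \<in> arcs G; tail G x \<in> A; head G x \<notin> A\<rbrakk> \<Longrightarrow> tail G x \<in> X \<or> head G x \<in> X" for X u v
  proof -
    have "card X < 3" using X(1) card_insert_le_m1[of 2 "{v}" u] by auto
    then obtain x where "x \<in> arcs G" "tail G x \<in> A - X" "head G x \<in> verts G - X - (A - X)"
      using cut[of X "A - X"] X A by blast
    then show False using hit[of x] by auto
  qed
  have vs: "tail G a \<in> verts G" "head G a \<in> verts G" "tail G b \<in> verts G" "head G b \<in> verts G"
    using a b by auto
  show False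
  proof (cases "A \<subseteq> {tail G a, tail G b}")
    case False
    have "head G a \<in> verts G - A - {tail G a, tail G b}" using a b by auto
    then show False using sep[of "{tail G a, tail G b}" "tail G a" "tail G b"] False vs only by blast
  next
    case A1: True
    show False
    proof (cases "verts G - A \<subseteq> {head G a, head G b}")
      case False
      have "tail G a \<in> A - {head G a, head G b}" using a b by auto
      then show False using sep[of "{head G a, head G b}" "head G a" "head G b"] False vs only by blast
    next
      case True
      then have V: "verts G \<subseteq> {tail G a, head G a, tail G b, head G b}" using A1 by blast
      have "3 < card (verts G)" using three_connected by (simp add: k_connected_def)
      then have V3: "3 < card {tail G a, head G a, tail G b, head G b}"
        using card_mono[OF _ V] by simp
      then have "tail G a \<noteq> tail G b" "head G a \<noteq> head G b"
        using card_length[of "[head G a, tail G b, head G b]"] card_length[of "[tail G a, tail G b, head G b]"]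
        by (auto simp: insert_commute)
      then have "tail G b \<in> A - {tail G a, head G b}" "head G a \<in> verts G - A - {tail G a, head G b}"
        using a b vs by auto
      then show False using sep[of "{tail G a, head G b}" "tail G a" "head G b"] vs only by blast
    qed
  qed
qed

text \<open>An edge with the same face on both sides has a closed antisymmetric indicator, and the
  resulting cut makes it a bridge.\<close>

lemma lf_arev_neq:
  assumes a: "a \<in> arcs G"
  shows "lf a \<noteq> lf (arev a)"
proof
  assume eq: "lf a = lf (arev a)"
  define w :: "'b \<Rightarrow> int" where "w x = of_bool (x = a) - of_bool (x = arev a)" for x
  have anti: "w (arev x) = - w x" if "x \<in> arcs G" for x
    by (auto simp: w_def of_bool_def)
  have closed: "(\<Sum>x\<in>lf b. w x) = 0" if "b \<in> arcs G" for b
  proof -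
    have "(\<Sum>x\<in>lf b. w x) = of_bool (a \<in> lf b) - of_bool (arev a \<in> lf b)"
      by (simp add: w_def sum_subtractf of_bool_def sum.delta)
    then show ?thesis using eq by (simp add: in_lf_iff)
  qed
  have "0 < w a" using a arev_neq[of a] by (simp add: w_def)
  then obtain A where A: "A \<subseteq> verts G" "tail G a \<in> A" "head G a \<in> verts G - A"
    "\<And>x. \<lbrakk>x \<in> arcs G; tail G x \<in> A; head G x \<notin> A\<rbrakk> \<Longrightarrow> 0 < w x"
    using closed_cut[OF anti closed a] by blast
  have "x = a" if "0 < w x" for x using that by (auto simp: w_def of_bool_def split: if_splits)
  then show False using no_small_cut[OF A(1), of a a] A a by blast
qed

text \<open>If two edges separate the same two faces, crossing one and returning through the other
  is a closed walk in the dual. Its antisymmetric indicator is closed and yields a cut of at most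
  two edges.\<close>

lemma dual_simple:
  assumes a: "a \<in> arcs G" and b: "b \<in> arcs G" and eq: "lf a = lf b" "lf (arev a) = lf (arev b)"
  shows "a = b"
proof (rule ccontr)
  assume ne: "a \<noteq> b"
  define w :: "'b \<Rightarrow> int" where
    "w x = of_bool (x = a) + of_bool (x = arev b) - of_bool (x = arev a) - of_bool (x = b)" for x
  have anti: "w (arev x) = - w x" if "x \<in> arcs G" for x
    by (auto simp: w_def of_bool_def)
  have closed: "(\<Sum>x\<in>lf c. w x) = 0" if "c \<in> arcs G" for c
  proof -
    have "(\<Sum>x\<in>lf c. w x) =
      of_bool (a \<in> lf c) + of_bool (arev b \<in> lf c) - of_bool (arev a \<in> lf c) - of_bool (b \<in> lf c)"
      by (simp add: w_def sum_subtractf sum.distrib of_bool_def sum.delta)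
    then show ?thesis using eq by (simp add: in_lf_iff)
  qed
  have "a \<noteq> arev b" using lf_arev_neq[OF b] eq(1) by auto
  then have "0 < w a" using a arev_neq[of a] ne by (simp add: w_def)
  then obtain A where A: "A \<subseteq> verts G" "tail G a \<in> A" "head G a \<in> verts G - A"
    "\<And>x. \<lbrakk>x \<in> arcs G; tail G x \<in> A; head G x \<notin> A\<rbrakk> \<Longrightarrow> 0 < w x"
    using closed_cut[OF anti closed a] by blast
  have w: "x = a \<or> x = arev b" if "0 < w x" for x
    using that by (auto simp: w_def of_bool_def split: if_splits)
  show False
  proof (cases "tail G (arev b) \<in> A \<and> head G (arev b) \<notin> A")
    case True
    then show False using no_small_cut[OF A(1), of a "arev b"] A a b w by auto
  next
    case False
    then have "x = a" if "x \<in> arcs G" "tail G x \<in> A" "head G x \<notin> A" for x using A(4)[of x] w[of x] that by auto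
    then show False using no_small_cut[OF A(1), of a a] A a by blast
  qed
qed

text \<open>Suppose a face had the two corners \<open>a\<close> and \<open>b\<close> at
  \<open>v\<close>. Let \<open>I\<close> be the arcs at \<open>v\<close> from \<open>a\<close> up to
  but excluding \<open>b\<close>. The antisymmetric indicator of \<open>I\<close> is closed, because
  the two corners where \<open>I\<close> begins and ends lie on the same face. All edges across the
  resulting cut are at \<open>v\<close>, which would make \<open>v\<close> a cut vertex.\<close>

lemma corner_unique:
  assumes a: "a \<in> arcs G" and b: "b \<in> arcs G" and eq: "tail G a = tail G b" "lf a = lf b"
  shows "a = b"
proof (rule ccontr)
  assume ne: "a \<noteq> b"
  define v where "v = tail G a"
  have "b \<in> orbit cw a"
    using orbit_cyclic_eq3[OF cyclic_out[OF a], of a] a b eq by (simp add: out_arcs_def)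
  then have ex: "\<exists>n. (cw ^^ n) a = b" by (auto simp: orbit_altdef)
  define n where "n = (LEAST n. (cw ^^ n) a = b)"
  have n: "(cw ^^ n) a = b" unfolding n_def using ex by (rule LeastI_ex)
  have least: "(cw ^^ i) a \<noteq> b" if "i < n" for i using that not_less_Least n_def by blast
  define I where "I = {(cw ^^ i) a | i. i < n}"
  have n0: "0 < n" using n ne by (cases n) auto
  have aI: "a \<in> I" unfolding I_def using n0 by (auto intro!: exI[of _ 0])
  have bI: "b \<notin> I" using least by (auto simp: I_def)
  have step: "cw x \<in> I \<longleftrightarrow> x \<in> I \<and> cw x \<noteq> b \<or> cw x = a" for x
  proof
    assume "cw x \<in> I"
    then obtain i where i: "i < n" "cw x = (cw ^^ i) a" by (auto simp: I_def)
    show "x \<in> I \<and> cw x \<noteq> b \<or> cw x = a"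
    proof (cases i)
      case (Suc k)
      then have "x = (cw ^^ k) a" using i by simp
      then show ?thesis using i Suc bI by (auto simp: I_def least)
    qed (use i in simp)
  next
    assume "x \<in> I \<and> cw x \<noteq> b \<or> cw x = a"
    then show "cw x \<in> I"
    proof
      assume x: "x \<in> I \<and> cw x \<noteq> b"
      then obtain i where i: "i < n" "x = (cw ^^ i) a" by (auto simp: I_def)
      then have "cw x = (cw ^^ Suc i) a" by simp
      moreover have "Suc i \<noteq> n" using x n calculation by metis
      ultimately show ?thesis using i unfolding I_def by (metis (mono_tags, lifting) CollectI Suc_lessI)
    qed (use aI in simp)
  qed
  have pre_b: "x \<in> I" if "cw x = b" for x
  proof -
    obtain k where "n = Suc k" using n0 by (cases n) auto
    then have "cw x = cw ((cw ^^ k) a)" using that n by simp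
    then have "x = (cw ^^ k) a" by simp
    then show ?thesis using \<open>n = Suc k\<close> by (auto simp: I_def)
  qed
  have pre_a: "x \<notin> I" if "cw x = a" for x
  proof
    assume "x \<in> I"
    then obtain i where i: "i < n" "x = (cw ^^ i) a" by (auto simp: I_def)
    then have per: "(cw ^^ Suc i) a = a" using that by simp
    have "(cw ^^ (n - Suc i)) ((cw ^^ Suc i) a) = b"
      using i n by (simp only: funpow_add[symmetric, THEN fun_cong, unfolded o_def]) simp
    then show False using least[of "n - Suc i"] per i by simp
  qed
  have I_out: "x \<in> arcs G \<and> tail G x = v" if "x \<in> I" for x
    using cyclic_on_funpow_in[OF cyclic_out[OF a], of a] that a by (auto simp: I_def out_arcs_def v_def)
  define w :: "'b \<Rightarrow> int" where "w x = of_bool (x \<in> I) - of_bool (arev x \<in> I)" for x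
  have anti: "w (arev x) = - w x" if "x \<in> arcs G" for x by (simp add: w_def)
  have closed: "(\<Sum>x\<in>lf c. w x) = 0" if "c \<in> arcs G" for c
  proof -
    \<comment> \<open>Shifting one of the two indicators by one arc along the face compares
      membership in \<open>I\<close> on the two sides of a corner. It changes only where
      \<open>I\<close> begins, at \<open>a\<close>, and where it has ended, at
      \<open>b\<close>.\<close>
    have "(\<Sum>x\<in>lf c. w x) = (\<Sum>x\<in>lf c. of_bool (nxt x \<in> I) - of_bool (arev x \<in> I))"
      using sum_nxt[of "\<lambda>x. of_bool (x \<in> I) :: int" c] by (simp add: w_def sum_subtractf)
    also have "\<dots> = (\<Sum>x\<in>lf c. of_bool (nxt x = a) - of_bool (nxt x = b))"
    proof (rule sum.cong[OF refl])
      fix x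
      show "of_bool (nxt x \<in> I) - of_bool (arev x \<in> I) = (of_bool (nxt x = a) - of_bool (nxt x = b) :: int)"
        using step[of "arev x"] pre_a[of "arev x"] pre_b[of "arev x"] ne by (auto simp: of_bool_def)
    qed
    also have "\<dots> = (\<Sum>x\<in>lf c. of_bool (x = a) - of_bool (x = b))"
      using sum_nxt[of "\<lambda>x. of_bool (x = a) - of_bool (x = b) :: int" c] by simp
    also have "\<dots> = of_bool (a \<in> lf c) - of_bool (b \<in> lf c)"
      by (simp add: sum_subtractf of_bool_def sum.delta)
    also have "\<dots> = 0" using eq by (simp add: in_lf_iff)
    finally show ?thesis .
  qed
  have "arev a \<notin> I" using I_out[of "arev a"] no_loops[OF a] a by (auto simp: v_def)
  then have "0 < w a" using aI by (simp add: w_def)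
  then obtain A where A: "A \<subseteq> verts G" "tail G a \<in> A" "head G a \<in> verts G - A"
    "\<And>x. \<lbrakk>x \<in> arcs G; tail G x \<in> A; head G x \<notin> A\<rbrakk> \<Longrightarrow> 0 < w x"
    using closed_cut[OF anti closed a] by blast
  have cross: "x \<in> I" if "x \<in> arcs G" "tail G x \<in> A" "head G x \<notin> A" for x
    using A(4)[OF that] by (auto simp: w_def of_bool_def split: if_splits)
  show False
  \<comment> \<open>If \<open>A = {v}\<close>, every arc at \<open>v\<close> crosses the cut and
    lies in \<open>I\<close>, but \<open>b\<close> does not. Otherwise deleting \<open>v\<close>
    leaves both sides nonempty and, by 3-connectivity, joined by an arc that avoids
    \<open>v\<close>.\<close>
  proof (cases "A = {v}")
    case True
    then show False using cross[of b] b eq(1) bI no_loops[OF b] by (auto simp: v_def)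
  next
    case False
    have "A - {v} \<noteq> {}" using False A(2) by (auto simp: v_def)
    moreover have "A - {v} \<subseteq> verts G - {v}" "A - {v} \<noteq> verts G - {v}" "{v} \<subseteq> verts G"
      using A a by (auto simp: v_def)
    ultimately obtain x where "x \<in> arcs G" "tail G x \<in> A - {v}" "head G x \<in> verts G - {v} - (A - {v})"
      using k_connected_cut[OF three_connected sym_arcs, of "{v}" "A - {v}"] by auto
    then show False using cross[of x] I_out[of x] by auto
  qed
qed

end

section \<open>The dual cycle around an initial segment\<close>

context st_plane
begin

text \<open>Descending arcs lead from any vertex below \<open>n\<close> to \<open>s\<close> without
  leaving that part; ascending arcs do the same for the part above and \<open>t\<close>. So both
  sides of the cut are connected.\<close>

lemma below_const:
  assumes "\<And>a. \<lbrakk>a \<in> arcs G; pos (tail G a) < n; pos (head G a) < n\<rbrakk> \<Longrightarrow> p (head G a) = p (tail G a)"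
    and "v \<in> verts G" "pos v < n"
  shows "p v = p s"
  using assms(2,3)
proof (induction "pos v" arbitrary: v rule: less_induct)
  case less
  show ?case
  proof (cases "v = s")
    case False
    then obtain a where a: "a \<in> arcs G" "tail G a = v" "pos (head G a) < pos v"
      using lower less.prems by blast
    then show ?thesis using less.hyps[of "head G a"] assms(1)[of a] less.prems by auto
  qed simp
qed

lemma above_const:
  assumes "\<And>a. \<lbrakk>a \<in> arcs G; n \<le> pos (tail G a); n \<le> pos (head G a)\<rbrakk> \<Longrightarrow> p (head G a) = p (tail G a)"
    and "v \<in> verts G" "n \<le> pos v"
  shows "p v = p t"
proof -
  define M where "M = Max (pos ` verts G)"
  have M: "pos v \<le> M" if "v \<in> verts G" for v using that by (simp add: M_def)
  show ?thesis using assms(2,3)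
  proof (induction "M - pos v" arbitrary: v rule: less_induct)
    case less
    show ?case
    proof (cases "v = t")
      case False
      then obtain a where a: "a \<in> arcs G" "tail G a = v" "pos v < pos (head G a)"
        using higher less.prems by blast
      have "M - pos (head G a) < M - pos v" using M[of "head G a"] a by simp
      then show ?thesis using less.hyps[of "head G a"] assms(1)[of a] less.prems a by auto
    qed simp
  qed
qed

text \<open>
  The arcs entering an initial segment of the numbering form a single face of the dual with that segment
  contracted: the indicator of an orbit \<open>B1\<close> on them, made antisymmetric, is closed, and its potential
  is constant on both sides of the cut.
\<close>

lemma cut_orbit:
  fixes n
  defines "B \<equiv> {a \<in> arcs G. pos (head G a) < n \<and> n \<le> pos (tail G a)}"
    and "A \<equiv> {a \<in> arcs G. n \<le> pos (tail G a) \<or> n \<le> pos (head G a)}"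
  assumes r: "r \<in> B"
  shows "left_face arev (induced_cw cwd A) r = B"
proof -
  define f where "f = induced_cw cwd A \<circ> arev"
  have f: "f a \<in> B \<and> f a \<in> lf (arev a)" if a: "a \<in> B" for a
  proof -
    define e where "e = arev a"
    have e: "e \<in> A" "e \<in> arcs G" "pos (tail G e) < n" using a by (auto simp: e_def A_def B_def)
    obtain k where k: "0 < k" "induced_cw cwd A e = (cwd ^^ k) e" "(cwd ^^ k) e \<in> A"
      "\<And>i. \<lbrakk>0 < i; i < k\<rbrakk> \<Longrightarrow> (cwd ^^ i) e \<notin> A"
      using induced_cw_first_return[OF permutation_cwd e(1)] by blast
    have mem: "(cwd ^^ i) e \<in> arcs G" for i
      by (induction i) (use e in simp_all)
    \<comment> \<open>\<open>cwd\<close> walks backwards along the face of \<open>e\<close>. The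
      arcs skipped lie outside \<open>A\<close>, so both their ends are below \<open>n\<close>, and
      the first arc found in \<open>A\<close> has its head below and its tail above the cut.\<close>
    have head: "pos (head G ((cwd ^^ i) e)) < n" if "0 < i" "i \<le> k" for i
      using that
    proof (induction i)
      case (Suc i)
      have "head G ((cwd ^^ Suc i) e) = tail G ((cwd ^^ i) e)"
        using head_cwd[OF mem[of i]] by simp
      moreover have "pos (tail G ((cwd ^^ i) e)) < n"
      proof (cases "i = 0")
        case False
        then have "(cwd ^^ i) e \<notin> A" using k(4) Suc by simp
        then show ?thesis using mem[of i] by (auto simp: A_def)
      qed (use e in simp)
      ultimately show ?case by simp
    qed simp
    have "(cwd ^^ k) e \<in> B" using head[of k] k by (auto simp: A_def B_def)
    moreover have "(cwd ^^ k) e \<in> lf e"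
      using cyclic_on_funpow_in[OF cyclic_dual] by simp
    ultimately show ?thesis using k(2) unfolding f_def e_def by simp
  qed
  have inj: "inj_on f B"
  proof (rule inj_onI)
    fix x y assume "x \<in> B" "y \<in> B" "f x = f y"
    then have "arev x = arev y"
      using inj_onD[OF inj_on_induced_cw[OF permutation_cwd, of A], of "arev x" "arev y"]
      by (auto simp: f_def A_def B_def simp del: arev_eq_iff')
    then show "x = y" by simp
  qed
  define B1 where "B1 = orbit f r"
  have B1: "B1 \<subseteq> B"
  proof
    fix x assume "x \<in> B1"
    then show "x \<in> B" unfolding B1_def by induct (use f r in auto)
  qed
  have B1f: "f x \<in> B1" if "x \<in> B1" for x using that by (auto simp: B1_def intro: orbit.step)
  have finB: "finite B" by (simp add: B_def)
  have "f ` B1 = B1"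
    using B1 B1f inj finB by (intro endo_inj_surj) (auto intro: finite_subset inj_on_subset)
  have rB1: "r \<in> B1"
  proof -
    have "f r \<in> f ` B1" using \<open>f ` B1 = B1\<close> by (simp add: B1_def orbit.base)
    then obtain x where "x \<in> B1" "f x = f r" by force
    then have "x = r" using B1 r inj by (auto dest: inj_onD)
    then show ?thesis using \<open>x \<in> B1\<close> by simp
  qed
  define w :: "'b \<Rightarrow> int" where "w x = of_bool (x \<in> B1) - of_bool (arev x \<in> B1)" for x
  have anti: "w (arev x) = - w x" if "x \<in> arcs G" for x by (simp add: w_def)
  have nonneg: "0 \<le> (\<Sum>x\<in>F. w x)" if "F \<in> faces G arev cw" for F
  proof -
    obtain a where F: "F = lf a" "a \<in> arcs G" using \<open>F \<in> _\<close> by (rule faceE)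
    have fin: "finite F" by (simp add: F)
    \<comment> \<open>On each face, \<open>f\<close> sends every edge whose reversal lies in
      \<open>B1\<close> to an arc of \<open>B1\<close> on the same face, injectively. So the face
      sum of \<open>w\<close> cannot be negative, and since all face sums add up to zero, each of
      them vanishes.\<close>
    have "card {x \<in> F. arev x \<in> B1} \<le> card {x \<in> F. x \<in> B1}"
    proof (rule card_inj_on_le[where f = "f \<circ> arev"])
      show "inj_on (f \<circ> arev) {x \<in> F. arev x \<in> B1}"
      proof (rule inj_onI)
        fix x y assume "x \<in> {x \<in> F. arev x \<in> B1}" "y \<in> {x \<in> F. arev x \<in> B1}" "(f \<circ> arev) x = (f \<circ> arev) y"
        then have "arev x = arev y" using inj_onD[OF inj, of "arev x" "arev y"] B1 by auto
        then show "x = y" by simp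
      qed
      show "(f \<circ> arev) ` {x \<in> F. arev x \<in> B1} \<subseteq> {x \<in> F. x \<in> B1}"
      proof clarify
        fix x assume x: "x \<in> F" "arev x \<in> B1"
        then have "f (arev x) \<in> lf x" using f[of "arev x"] B1 by auto
        then show "(f \<circ> arev) x \<in> F \<and> (f \<circ> arev) x \<in> B1"
          using x B1f F by (auto simp: in_lf_iff)
      qed
      show "finite {x \<in> F. x \<in> B1}" using fin by simp
    qed
    moreover have "(\<Sum>x\<in>F. w x) = int (card {x \<in> F. x \<in> B1}) - int (card {x \<in> F. arev x \<in> B1})"
      using fin by (simp add: w_def sum_subtractf of_bool_def sum.If_cases Int_def)
    ultimately show ?thesis by simp
  qed
  have closed: "(\<Sum>x\<in>lf a. w x) = 0" if "a \<in> arcs G" for a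
  proof -
    have "(\<Sum>F\<in>faces G arev cw. \<Sum>x\<in>F. w x) = 0" using sum_faces[of w] sum_antisym[of w] anti by simp
    then have "\<forall>F\<in>faces G arev cw. (\<Sum>x\<in>F. w x) = 0"
      using sum_nonneg_eq_0_iff[OF finite_faces, of "\<lambda>F. \<Sum>x\<in>F. w x"] nonneg by blast
    then show ?thesis using that by simp
  qed
  obtain p where p: "\<And>a. a \<in> arcs G \<Longrightarrow> w a = p (head G a) - p (tail G a)"
    using closed_imp_exact[OF anti closed] by blast
  have zero: "w a = 0" if "a \<in> arcs G" "pos (tail G a) < n \<longleftrightarrow> pos (head G a) < n" for a
  proof -
    have "a \<notin> B" "arev a \<notin> B" using that by (auto simp: B_def)
    then show ?thesis using B1 by (auto simp: w_def)
  qed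
  \<comment> \<open>\<open>w\<close> vanishes on arcs that stay on one side, so the potential is
    constant on each side and \<open>w\<close> takes the same value on all of \<open>B\<close>,
    namely its value 1 at \<open>r\<close>.\<close>
  have w_B: "w a = p s - p t" if "a \<in> B" for a
  proof -
    have a: "a \<in> arcs G" "pos (head G a) < n" "n \<le> pos (tail G a)" using that by (auto simp: B_def)
    have "p (head G a) = p s"
      by (rule below_const[where n = n]) (use a zero p in fastforce)+
    moreover have "p (tail G a) = p t"
      by (rule above_const[where n = n]) (use a zero p in fastforce)+
    ultimately show ?thesis using p[OF a(1)] by simp
  qed
  have disj: "arev a \<notin> B" if "a \<in> B" for a using that by (auto simp: B_def)
  have "w r = 1" using rB1 r B1 disj[of r] by (auto simp: w_def)
  then have "w a = 1" if "a \<in> B" for a using w_B[OF that] w_B[OF r] by simp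
  then have "a \<in> B1" if "a \<in> B" for a
    using that by (metis (full_types) w_def diff_0 of_bool_eq(1) of_bool_eq(2) diff_self zero_neq_one neg_equal_iff_equal one_neq_neg_one)
  then have "B \<subseteq> B1" by blast
  then show ?thesis using B1 unfolding B1_def left_face_def f_def by blast
qed

end

section \<open>Canonical orderings as st-numberings\<close>

text \<open>An element that does not occur gets the length of the list, which makes the rule for
  appended lists unconditional.\<close>

definition list_pos :: "'a list \<Rightarrow> 'a \<Rightarrow> nat" where
  "list_pos xs v = length (takeWhile (\<lambda>x. x \<noteq> v) xs)"

lemma list_pos_less: "v \<in> set xs \<Longrightarrow> list_pos xs v < length xs"
  unfolding list_pos_def by (induction xs) auto

lemma nth_list_pos: "v \<in> set xs \<Longrightarrow> xs ! list_pos xs v = v"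
  unfolding list_pos_def by (induction xs) auto

lemma list_pos_nth: "\<lbrakk>distinct xs; i < length xs\<rbrakk> \<Longrightarrow> list_pos xs (xs ! i) = i"
  by (metis list_pos_less nth_eq_iff_index_eq nth_list_pos nth_mem)

lemma list_pos_append:
  "list_pos (xs @ ys) v = (if v \<in> set xs then list_pos xs v else length xs + list_pos ys v)"
  unfolding list_pos_def by (induction xs) auto

lemma inj_on_list_pos: "inj_on (list_pos xs) (set xs)"
  by (metis inj_onI nth_list_pos)

lemma concat_split:
  assumes "k < length Vs"
  shows "concat Vs = concat (take k Vs) @ Vs ! k @ concat (drop (Suc k) Vs)"
  by (metis assms append.assoc append_take_drop_id concat.simps(2) concat_append id_take_nth_drop)

definition group_index :: "'a list list \<Rightarrow> 'a \<Rightarrow> nat" where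
  "group_index Vs v = (THE k. k < length Vs \<and> v \<in> set (Vs ! k))"

lemma in_set_concat_nth: "v \<in> set (concat Vs) \<longleftrightarrow> (\<exists>k<length Vs. v \<in> set (Vs ! k))"
  unfolding set_concat by (metis UN_iff in_set_conv_nth)

lemma nth_in_concat_take: "\<lbrakk>i < k; k \<le> length Vs; v \<in> set (Vs ! i)\<rbrakk> \<Longrightarrow> v \<in> set (concat (take k Vs))"
  unfolding in_set_concat_nth by (intro exI[of _ i]) auto

lemma group_unique:
  assumes "distinct (concat Vs)" "i < length Vs" "j < length Vs" "v \<in> set (Vs ! i)" "v \<in> set (Vs ! j)"
  shows "i = j"
proof -
  have False if "i < j" "i < length Vs" "j < length Vs" "v \<in> set (Vs ! i)" "v \<in> set (Vs ! j)" for i j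
  proof -
    have "v \<in> set (concat (take j Vs))" using that by (intro nth_in_concat_take[of i j]) auto
    moreover have "distinct (concat (take j Vs) @ Vs ! j @ concat (drop (Suc j) Vs))"
      using assms(1) concat_split[OF that(3)] by simp
    ultimately show False using that by auto
  qed
  then show ?thesis using assms by (metis linorder_neqE_nat)
qed

lemma group_indexI:
  "\<lbrakk>distinct (concat Vs); k < length Vs; v \<in> set (Vs ! k)\<rbrakk> \<Longrightarrow> group_index Vs v = k"
  unfolding group_index_def by (rule the_equality) (auto intro: group_unique)

lemma group_index_in:
  assumes "distinct (concat Vs)" "v \<in> set (concat Vs)"
  shows "group_index Vs v < length Vs \<and> v \<in> set (Vs ! group_index Vs v)"
proof -
  obtain k where "k < length Vs" "v \<in> set (Vs ! k)" using assms(2) by (auto simp only: in_set_concat_nth)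
  then show ?thesis using group_indexI[OF assms(1)] by auto
qed

lemma list_pos_concat:
  assumes "distinct (concat Vs)" "k < length Vs" "i < length (Vs ! k)"
  shows "list_pos (concat Vs) (Vs ! k ! i) = length (concat (take k Vs)) + i"
proof -
  have d: "distinct (concat (take k Vs) @ Vs ! k @ concat (drop (Suc k) Vs))"
    using assms concat_split by metis
  then have "Vs ! k ! i \<notin> set (concat (take k Vs))" "Vs ! k ! i \<in> set (Vs ! k)" using assms(3) by auto
  then show ?thesis
    using list_pos_nth[of "Vs ! k" i] d assms(3) by (subst concat_split[OF assms(2)]) (simp add: list_pos_append)
qed

lemma length_concat_take_mono: "k \<le> l \<Longrightarrow> length (concat (take k Vs)) \<le> length (concat (take l Vs))"
proof -
  assume "k \<le> l"
  then have "take l Vs = take k Vs @ take (l - k) (drop k Vs)" by (metis le_add_diff_inverse take_add)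
  then show ?thesis by simp
qed

lemma list_pos_concat_bounds:
  assumes "distinct (concat Vs)" "k < length Vs" "v \<in> set (Vs ! k)"
  shows "length (concat (take k Vs)) \<le> list_pos (concat Vs) v"
    and "list_pos (concat Vs) v < length (concat (take (Suc k) Vs))"
proof -
  obtain i where "i < length (Vs ! k)" "v = Vs ! k ! i" using assms(3) by (auto simp: in_set_conv_nth)
  then show "length (concat (take k Vs)) \<le> list_pos (concat Vs) v"
    "list_pos (concat Vs) v < length (concat (take (Suc k) Vs))"
    using list_pos_concat[OF assms(1,2)] assms(2) by (auto simp: take_Suc_conv_app_nth)
qed

lemma list_pos_concat_less:
  assumes "distinct (concat Vs)" "i < j" "j < length Vs" "u \<in> set (Vs ! i)" "v \<in> set (Vs ! j)"
  shows "list_pos (concat Vs) u < list_pos (concat Vs) v"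
proof -
  have "list_pos (concat Vs) u < length (concat (take (Suc i) Vs))"
    using assms by (intro list_pos_concat_bounds) auto
  also have "\<dots> \<le> length (concat (take j Vs))" using assms by (intro length_concat_take_mono) auto
  also have "\<dots> \<le> list_pos (concat Vs) v" using assms by (intro list_pos_concat_bounds) auto
  finally show ?thesis .
qed

lemma earlier_conv:
  assumes "distinct (concat Vs)" "k \<le> length Vs"
  shows "earlier Vs k = {v \<in> set (concat Vs). group_index Vs v < k}"
proof (intro set_eqI iffI)
  fix v assume "v \<in> earlier Vs k"
  then obtain i where i: "i < k" "v \<in> set (Vs ! i)" using assms(2)
    unfolding earlier_def in_set_concat_nth by auto
  then have "v \<in> set (concat Vs)" unfolding in_set_concat_nth using assms(2) by (intro exI[of _ i]) auto
  then show "v \<in> {v \<in> set (concat Vs). group_index Vs v < k}"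
    using group_indexI[OF assms(1), of i v] assms(2) i by auto
next
  fix v assume "v \<in> {v \<in> set (concat Vs). group_index Vs v < k}"
  then show "v \<in> earlier Vs k"
    using group_index_in[OF assms(1), of v] nth_in_concat_take[OF _ assms(2)] by (auto simp: earlier_def simp del: set_concat)
qed

lemma later_conv:
  assumes "distinct (concat Vs)" "k < length Vs"
  shows "later Vs k = {v \<in> set (concat Vs). k < group_index Vs v}"
proof -
  have "set (concat Vs) = earlier Vs (Suc k) \<union> later Vs k" "earlier Vs (Suc k) \<inter> later Vs k = {}"
    using assms(1) append_take_drop_id[of "Suc k" Vs, symmetric]
    unfolding earlier_def later_def
    by (metis concat_append set_append, metis concat_append distinct_append)
  then have "later Vs k = set (concat Vs) - earlier Vs (Suc k)" by blast
  then show ?thesis using earlier_conv[OF assms(1), of "Suc k"] assms(2) by (auto simp del: set_concat)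
qed

text \<open>Whatever \<open>attach_index\<close> decides, a group is appended forwards or backwards.
  This suffices for comparing vertices of different groups.\<close>

lemma extend_enum_decomp:
  "\<exists>Ws. extend_enum G vs Zs = vs @ concat Ws \<and> list_all2 (\<lambda>w z. w = z \<or> w = rev z) Ws Zs"
proof (induction Zs arbitrary: vs)
  case (Cons zs Zs)
  define ys where "ys = (if attach_index G vs (hd zs) < attach_index G vs (last zs) then zs else rev zs)"
  obtain Ws where "extend_enum G (vs @ ys) Zs = (vs @ ys) @ concat Ws" "list_all2 (\<lambda>w z. w = z \<or> w = rev z) Ws Zs"
    using Cons.IH by blast
  then show ?case by (intro exI[of _ "ys # Ws"]) (auto simp: ys_def)
qed simp

lemma rev_groups:
  assumes "list_all2 (\<lambda>w z. w = z \<or> w = rev z) Ws Vs"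
  shows "set (concat Ws) = set (concat Vs) \<and> (distinct (concat Vs) \<longrightarrow> distinct (concat Ws))"
  using assms by (induction rule: list_all2_induct) auto

text \<open>Reversals stay within their groups and leave the order between groups alone. Hence the
  directions of inter-edges can be read off the group indices.\<close>

lemma vertex_index_less:
  assumes d: "distinct (concat Vs)" and ij: "i < j" "j < length Vs" and uv: "u \<in> set (Vs ! i)" "v \<in> set (Vs ! j)"
  shows "vertex_index G Vs u < vertex_index G Vs v"
proof -
  obtain Ws where Ws: "extend_enum G (hd Vs) (tl Vs) = hd Vs @ concat Ws"
    "list_all2 (\<lambda>w z. w = z \<or> w = rev z) Ws (tl Vs)"
    using extend_enum_decomp by blast
  define Us where "Us = hd Vs # Ws"
  have enum: "vertex_enum G Vs = concat Us" using Ws by (simp add: vertex_enum_def Us_def)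
  have "Vs \<noteq> []" using ij by auto
  then have rel: "list_all2 (\<lambda>w z. w = z \<or> w = rev z) Us Vs"
    using Ws(2) by (cases Vs) (auto simp: Us_def)
  have dist: "distinct (concat Us)" "set (concat Us) = set (concat Vs)" using rev_groups[OF rel] d by auto
  have index: "vertex_index G Vs w = list_pos (concat Us) w" if "w \<in> set (concat Us)" for w
    unfolding vertex_index_def enum
    by (rule the_equality) (use that dist list_pos_less nth_list_pos list_pos_nth in metis)+
  have len: "length Us = length Vs" using rel by (rule list_all2_lengthD)
  have sets: "set (Us ! k) = set (Vs ! k)" if "k < length Vs" for k
    using list_all2_nthD2[OF rel that] by auto
  have "u \<in> set (concat Us)" "v \<in> set (concat Us)"
    unfolding in_set_concat_nth using uv ij sets len by (metis order.strict_trans)+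
  then show ?thesis
    using index list_pos_concat_less[OF dist(1) ij(1), of u v] ij len uv sets[of i] sets[of j] by auto
qed

lemma directed_arcs_iff:
  assumes d: "distinct (concat Vs)" and a: "a \<in> arcs G" "tail G a \<in> set (concat Vs)" "head G a \<in> set (concat Vs)"
    and ne: "group_index Vs (tail G a) \<noteq> group_index Vs (head G a)"
  shows "a \<in> directed_arcs G Vs \<longleftrightarrow>
    tail G a = hd (last Vs) \<and> head G a = hd (hd Vs) \<or>
    group_index Vs (tail G a) < group_index Vs (head G a) \<and>
    \<not> (tail G a = hd (hd Vs) \<and> head G a = hd (last Vs))"
proof -
  have "vertex_index G Vs (tail G a) < vertex_index G Vs (head G a) \<longleftrightarrow>
    group_index Vs (tail G a) < group_index Vs (head G a)"
    using vertex_index_less[OF d, of "group_index Vs (tail G a)" "group_index Vs (head G a)" "tail G a" "head G a" G]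
      vertex_index_less[OF d, of "group_index Vs (head G a)" "group_index Vs (tail G a)" "head G a" "tail G a" G]
      group_index_in[OF d a(2)] group_index_in[OF d a(3)] ne by (metis linorder_neqE_nat order_less_asym)
  then show ?thesis using a by (auto simp: directed_arcs_def Let_def)
qed

lemma intra_edge_iff:
  assumes d: "distinct (concat Vs)" and a: "tail G a \<in> set (concat Vs)" "head G a \<in> set (concat Vs)"
  shows "intra_edge G Vs a \<longleftrightarrow> group_index Vs (tail G a) = group_index Vs (head G a)"
proof
  assume "intra_edge G Vs a"
  then obtain k where "k < length Vs" "tail G a \<in> set (Vs ! k)" "head G a \<in> set (Vs ! k)"
    by (auto simp: intra_edge_def) (metis in_set_conv_nth)
  then show "group_index Vs (tail G a) = group_index Vs (head G a)" using group_indexI[OF d] by metis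
next
  assume "group_index Vs (tail G a) = group_index Vs (head G a)"
  then show "intra_edge G Vs a"
    using group_index_in[OF d a(1)] group_index_in[OF d a(2)] by (auto simp: intra_edge_def intro!: bexI[of _ "Vs ! group_index Vs (tail G a)"])
qed

lemma singleton_listI: "\<lbrakk>length xs = 1; x \<in> set xs\<rbrakk> \<Longrightarrow> xs = [x]"
  by (cases xs) auto

lemma induce_induce: "T \<subseteq> S \<Longrightarrow> (G \<restriction> S) \<restriction> T = G \<restriction> T"
  by (auto simp: induce_subgraph_def)

section \<open>Groups and numbering of a canonical ordering\<close>

locale canonical_plane = plane_graph G arev cw
  for G :: "('a, 'b) pre_digraph" and arev cw +
  fixes fo :: "'b set" and Vs :: "'a list list" and v1 v2 vn :: 'a and r b :: 'b
  assumes three_connected: "k_connected 3 G"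
    and fo: "fo \<in> faces G arev cw"
    and Vs_props: "2 \<le> length Vs" "[] \<notin> set Vs" "distinct (concat Vs)" "set (concat Vs) = verts G"
    and r: "r \<in> fo" "tail G r = v2" "head G r = v1"
    and b: "b \<in> fo" "tail G b = v1" "head G b = vn"
    and hd_Vs: "hd Vs = [v1, v2]" and last_Vs: "last Vs = [vn]"
    and two_connected: "\<lbrakk>1 \<le> k; k < length Vs\<rbrakk> \<Longrightarrow> k_connected 2 (G \<restriction> earlier Vs (Suc k))"
    and r_in: "\<lbrakk>1 \<le> k; k < length Vs\<rbrakk> \<Longrightarrow> r \<in> arcs (G \<restriction> earlier Vs (Suc k))"
    and groups: "\<lbrakk>1 \<le> k; k < length Vs - 1\<rbrakk> \<Longrightarrow> singleton_group G Vs k \<or>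
      chain_group G (left_face arev (induced_cw cw (arcs (G \<restriction> earlier Vs (Suc k)))) r) Vs k"
begin

abbreviation grp :: "'a \<Rightarrow> nat" where "grp \<equiv> group_index Vs"
abbreviation K :: nat where "K \<equiv> length Vs"
abbreviation pos :: "'a \<Rightarrow> nat" where "pos \<equiv> list_pos (concat Vs)"

lemmas dist = Vs_props(3)

lemma first_group: "Vs ! 0 = [v1, v2]"
  using hd_Vs Vs_props(1) by (metis hd_conv_nth list.size(3) not_numeral_le_zero)

lemma last_group: "Vs ! (K - 1) = [vn]"
  using last_Vs Vs_props(1) by (metis last_conv_nth list.size(3) not_numeral_le_zero)

lemma grp_less: "v \<in> verts G \<Longrightarrow> grp v < K"
  using group_index_in[OF dist, of v] Vs_props(4) by (simp del: set_concat)

lemma grp_mem: "v \<in> verts G \<Longrightarrow> v \<in> set (Vs ! grp v)"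
  using group_index_in[OF dist, of v] Vs_props(4) by (simp del: set_concat)

lemma in_group: "\<lbrakk>k < K; v \<in> set (Vs ! k)\<rbrakk> \<Longrightarrow> v \<in> verts G \<and> grp v = k"
  using group_indexI[OF dist] Vs_props(4) in_set_concat_nth[of v Vs] by auto

lemma grp_v: "grp v1 = 0" "grp v2 = 0" "grp vn = K - 1" "v1 \<in> verts G" "v2 \<in> verts G" "vn \<in> verts G" "v1 \<noteq> v2"
proof -
  have K: "0 < K" "K - 1 < K" using Vs_props(1) by auto
  show "grp v1 = 0" "grp v2 = 0" "grp vn = K - 1" "v1 \<in> verts G" "v2 \<in> verts G" "vn \<in> verts G"
    using in_group[OF K(1)] in_group[OF K(2)] first_group last_group by simp_all
  show "v1 \<noteq> v2" using concat_split[OF K(1)] dist first_group by simp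
qed

lemma grp_0: "\<lbrakk>v \<in> verts G; grp v = 0\<rbrakk> \<Longrightarrow> v = v1 \<or> v = v2"
  using grp_mem[of v] first_group by auto

lemma grp_last: "\<lbrakk>v \<in> verts G; grp v = K - 1\<rbrakk> \<Longrightarrow> v = vn"
  using grp_mem[of v] last_group by auto

lemma earlier_Vs: "k \<le> K \<Longrightarrow> earlier Vs k = {v \<in> verts G. grp v < k}"
  using earlier_conv[OF dist, of k] Vs_props(4) by (simp del: set_concat)

lemma later_Vs: "k < K \<Longrightarrow> later Vs k = {v \<in> verts G. k < grp v}"
  using later_conv[OF dist, of k] Vs_props(4) by (simp del: set_concat)

lemma pos_less: "\<lbrakk>u \<in> verts G; v \<in> verts G; grp u < grp v\<rbrakk> \<Longrightarrow> pos u < pos v"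
  using list_pos_concat_less[OF dist] grp_less grp_mem by metis

lemma grp_mono: "\<lbrakk>u \<in> verts G; v \<in> verts G; pos u \<le> pos v\<rbrakk> \<Longrightarrow> grp u \<le> grp v"
  using pos_less by (meson leD le_less_linear)

lemma pos_group: "\<lbrakk>k < K; i < length (Vs ! k)\<rbrakk> \<Longrightarrow> pos (Vs ! k ! i) = length (concat (take k Vs)) + i"
  by (rule list_pos_concat[OF dist])

lemma pos_v1: "pos v1 = 0" and pos_v2: "pos v2 = 1"
proof -
  have "0 < K" using Vs_props(1) by linarith
  then show "pos v1 = 0" "pos v2 = 1" using pos_group[of 0 0] pos_group[of 0 1] first_group by simp_all
qed

lemma arcs_rb: "r \<in> arcs G" "b \<in> arcs G" "lf r = fo" "lf b = fo"
proof -
  obtain a where a: "a \<in> arcs G" "fo = lf a" using fo by (rule faceE)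
  then show "r \<in> arcs G" "b \<in> arcs G" using r b lf_arcs by auto
  show "lf r = fo" "lf b = fo" using a r b by (auto simp: in_lf_iff)
qed

lemma K3: "3 \<le> K"
proof (rule ccontr)
  assume "\<not> 3 \<le> K"
  then have "K = 2" using Vs_props(1) by simp
  then have "concat Vs = [v1, v2, vn]"
    using first_group last_group by (cases Vs; cases "tl Vs") (auto simp: length_Suc_conv numeral_2_eq_2)
  then have "verts G = set [v1, v2, vn]" using Vs_props(4) by simp
  then have "card (verts G) \<le> 3" using card_length[of "[v1, v2, vn]"] by simp
  then show False using three_connected by (simp add: k_connected_def)
qed

lemma nbrs_in_iff: "v \<in> nbrs_in G z A \<longleftrightarrow> v \<in> A \<and> (\<exists>a\<in>arcs G. tail G a = z \<and> head G a = v)"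
  by (auto simp: nbrs_in_def arcs_ends_conv)

lemma singleton_props:
  assumes "1 \<le> k" "k < K - 1" "Vs ! k = [z]"
  shows "2 \<le> card (nbrs_in G z (earlier Vs k))" "nbrs_in G z (later Vs k) \<noteq> {}"
proof -
  have "\<not> chain_group G (left_face arev (induced_cw cw (arcs (G \<restriction> earlier Vs (Suc k)))) r) Vs k"
    using assms(3) by (simp add: chain_group_def Let_def)
  then have "singleton_group G Vs k" using groups assms by blast
  then show "2 \<le> card (nbrs_in G z (earlier Vs k))" "nbrs_in G z (later Vs k) \<noteq> {}"
    using assms(3) by (auto simp: singleton_group_def)
qed

lemma chain_props:
  assumes k: "1 \<le> k" "k < K - 1" "length (Vs ! k) \<noteq> 1"
  shows "2 \<le> length (Vs ! k)"
    and "\<lbrakk>i < length (Vs ! k); j < length (Vs ! k)\<rbrakk> \<Longrightarrow> Vs ! k ! i \<rightarrow>\<^bsub>G\<^esub> Vs ! k ! j \<longleftrightarrow> j = Suc i \<or> i = Suc j"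
    and "Suc i < length (Vs ! k) \<Longrightarrow>
      \<exists>a\<in>left_face arev (induced_cw cw (arcs (G \<restriction> earlier Vs (Suc k)))) r.
        tail G a = Vs ! k ! i \<and> head G a = Vs ! k ! Suc i"
    and "card (nbrs_in G (hd (Vs ! k)) (earlier Vs k)) = 1"
    and "card (nbrs_in G (last (Vs ! k)) (earlier Vs k)) = 1"
    and "\<lbrakk>0 < i; Suc i < length (Vs ! k)\<rbrakk> \<Longrightarrow> nbrs_in G (Vs ! k ! i) (earlier Vs k) = {}"
    and "z \<in> set (Vs ! k) \<Longrightarrow> nbrs_in G z (later Vs k) \<noteq> {}"
proof -
  have "\<not> singleton_group G Vs k" using k(3) by (auto simp: singleton_group_def)
  then have "chain_group G (left_face arev (induced_cw cw (arcs (G \<restriction> earlier Vs (Suc k)))) r) Vs k"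
    using groups k by blast
  note ch = this[unfolded chain_group_def Let_def]
  show "2 \<le> length (Vs ! k)"
    "\<lbrakk>i < length (Vs ! k); j < length (Vs ! k)\<rbrakk> \<Longrightarrow> Vs ! k ! i \<rightarrow>\<^bsub>G\<^esub> Vs ! k ! j \<longleftrightarrow> j = Suc i \<or> i = Suc j"
    "Suc i < length (Vs ! k) \<Longrightarrow>
      \<exists>a\<in>left_face arev (induced_cw cw (arcs (G \<restriction> earlier Vs (Suc k)))) r.
        tail G a = Vs ! k ! i \<and> head G a = Vs ! k ! Suc i"
    "card (nbrs_in G (hd (Vs ! k)) (earlier Vs k)) = 1"
    "card (nbrs_in G (last (Vs ! k)) (earlier Vs k)) = 1"
    "\<lbrakk>0 < i; Suc i < length (Vs ! k)\<rbrakk> \<Longrightarrow> nbrs_in G (Vs ! k ! i) (earlier Vs k) = {}"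
    "z \<in> set (Vs ! k) \<Longrightarrow> nbrs_in G z (later Vs k) \<noteq> {}"
    using ch by blast+
qed

text \<open>Inside a chain each vertex but the first has its predecessor below it, and the first has
  its neighbour in an earlier group. \<open>v2\<close> and \<open>vn\<close> are adjacent to
  \<open>v1\<close>.\<close>

lemma lower_pos:
  assumes v: "v \<in> verts G" "v \<noteq> v1"
  shows "\<exists>a\<in>arcs G. tail G a = v \<and> pos (head G a) < pos v"
proof -
  have by_nbr: ?thesis if ne: "nbrs_in G v (earlier Vs (grp v)) \<noteq> {}"
  proof -
    obtain u where "u \<in> nbrs_in G v (earlier Vs (grp v))" using ne by blast
    then obtain a where "a \<in> arcs G" "tail G a = v" "head G a \<in> earlier Vs (grp v)"
      by (auto simp: nbrs_in_iff)
    then show ?thesis using earlier_Vs[of "grp v"] grp_less[OF v(1)] pos_less v(1) by auto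
  qed
  consider "grp v = 0" | "grp v = K - 1" | "1 \<le> grp v" "grp v < K - 1" using grp_less[OF v(1)] by linarith
  then show ?thesis
  proof cases
    case 1
    then have "v = v2" using grp_0 v by blast
    then show ?thesis using r pos_v1 pos_v2 arcs_rb by (intro bexI[of _ r]) auto
  next
    case 2
    then have "v = vn" using grp_last v by blast
    moreover have "pos v1 < pos vn" using pos_less[of v1 vn] grp_v K3 by simp
    ultimately show ?thesis using b arcs_rb by (intro bexI[of _ "arev b"]) auto
  next
    case 3
    show ?thesis
    proof (cases "length (Vs ! grp v) = 1")
      case True
      then have "Vs ! grp v = [v]" using grp_mem[OF v(1)] by (rule singleton_listI)
      then show ?thesis using singleton_props(1)[OF 3] by (intro by_nbr) auto
    next
      case False
      note ch = chain_props[OF 3 False]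
      obtain i where i: "i < length (Vs ! grp v)" "Vs ! grp v ! i = v"
        using grp_mem[OF v(1)] by (auto simp: in_set_conv_nth)
      show ?thesis
      proof (cases i)
        case 0
        then have "hd (Vs ! grp v) = v" using i by (metis hd_conv_nth length_0_conv less_nat_zero_code)
        then show ?thesis using ch(4) by (intro by_nbr) auto
      next
        case (Suc k)
        then have "v \<rightarrow>\<^bsub>G\<^esub> Vs ! grp v ! k" using ch(2)[of i k] i by simp
        then obtain a where "a \<in> arcs G" "tail G a = v" "head G a = Vs ! grp v ! k" by auto
        moreover have "pos (Vs ! grp v ! k) < pos v"
          using pos_group[of "grp v" k] pos_group[of "grp v" i] i Suc grp_less[OF v(1)] by simp
        ultimately show ?thesis by auto
      qed
    qed
  qed
qed

text \<open>The groups between the first and the last have later neighbours by definition, and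
  \<open>v1\<close> has \<open>vn\<close>. For \<open>v2\<close> the reason is its degree: otherwise
  \<open>v1\<close> would be its only neighbour.\<close>

lemma higher_pos:
  assumes v: "v \<in> verts G" "v \<noteq> vn"
  shows "\<exists>a\<in>arcs G. tail G a = v \<and> pos v < pos (head G a)"
proof -
  have grp_ne: "grp v < K - 1" using grp_last[OF v(1)] grp_less[OF v(1)] v(2) by fastforce
  have by_grp: ?thesis if "a \<in> arcs G" "tail G a = v" "grp v < grp (head G a)" for a
    using that pos_less v by (intro bexI[of _ a]) auto
  have by_nbr: ?thesis if ne: "nbrs_in G v (later Vs (grp v)) \<noteq> {}"
  proof -
    obtain u where "u \<in> nbrs_in G v (later Vs (grp v))" using ne by blast
    then obtain a where "a \<in> arcs G" "tail G a = v" "head G a \<in> later Vs (grp v)"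
      by (auto simp: nbrs_in_iff)
    then show ?thesis using later_Vs[OF grp_less[OF v(1)]] by_grp by auto
  qed
  consider "v = v1" | "v = v2" | "1 \<le> grp v" using grp_0 v by fastforce
  then show ?thesis
  proof cases
    case 1
    then show ?thesis using b arcs_rb grp_v K3 by (intro by_grp[of b]) auto
  next
    case 2
    show ?thesis
    proof (rule ccontr)
      assume no: "\<not> ?thesis"
      have "head G a \<in> {v1, v2}" if "a \<in> arcs G" "tail G a = v2" for a
        using by_grp[of a] no that 2 grp_v grp_0[of "head G a"] by auto
      then have "3 \<le> card {v1, v2}" using degree_ge_3[OF three_connected, of v2 "{v1, v2}"] grp_v by auto
      then show False by (simp add: card_insert_if split: if_splits)
    qed
  next
    case 3
    show ?thesis
    proof (cases "length (Vs ! grp v) = 1")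
      case True
      then have "Vs ! grp v = [v]" using grp_mem[OF v(1)] by (rule singleton_listI)
      then show ?thesis using singleton_props(2)[OF 3 grp_ne] by (intro by_nbr) auto
    next
      case False
      then show ?thesis using chain_props(7)[OF 3 grp_ne False] grp_mem[OF v(1)] by (intro by_nbr) auto
    qed
  qed
qed

sublocale st_plane3 G arev cw pos v1 vn
proof unfold_locales
  show "inj_on pos (verts G)" using inj_on_list_pos[of "concat Vs"] Vs_props(4) by simp
  show "v1 \<noteq> vn" using grp_v K3 by auto
qed (use grp_v lower_pos higher_pos three_connected in auto)

end

section \<open>The arcs that leave a group downwards\<close>

context plane_graph
begin

lemma permutation_cw: "permutation cw"
  using cw_permutes finite_arcs unfolding permutation_permutes by blast

lemma left_face_induced_subset:
  assumes "x \<in> A" "\<And>y. y \<in> A \<Longrightarrow> arev y \<in> A"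
  shows "left_face arev (induced_cw cw A) x \<subseteq> A"
proof
  fix y assume "y \<in> left_face arev (induced_cw cw A) x"
  then show "y \<in> A"
    unfolding left_face_def
    by induct (use assms induced_cw_first_return[OF permutation_cw] in \<open>metis comp_apply\<close>)+
qed

text \<open>Where all arcs of a face survive, the first-return map coincides with
  \<open>nxt\<close>, so the face of \<open>G\<close> is also a face of the subgraph. By
  injectivity, an orbit that enters it (\<open>pull\<close>) was inside all along.\<close>

lemma face_within_subgraph:
  assumes x: "x \<in> A" and A: "\<And>y. y \<in> A \<Longrightarrow> arev y \<in> A"
    and F: "lf a \<subseteq> A" and a: "a \<in> left_face arev (induced_cw cw A) x"
  shows "x \<in> lf a"
proof -
  define f where "f = induced_cw cw A \<circ> arev"
  have in_A: "f y \<in> A" if "y \<in> A" for y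
    using induced_cw_first_return[OF permutation_cw A[OF that]] by (metis comp_apply f_def)
  have f_nxt: "f y = nxt y" if "y \<in> lf a" for y
  proof -
    have "nxt y \<in> lf a" using that by simp
    then have "nxt y \<in> A" using F by blast
    then have "(LEAST n. 0 < n \<and> (cw ^^ n) (arev y) \<in> A) = 1" by (intro Least_equality) auto
    then show ?thesis by (simp add: f_def induced_cw_def)
  qed
  have pull: "y \<in> lf a" if "y \<in> A" "f y \<in> lf a" for y
  proof -
    obtain y' where y': "nxt y' = f y" using nxt_surj by blast
    then have "y' \<in> lf a" using that(2) nxt_in_lf by metis
    then have "f y' = f y" "y' \<in> A" using f_nxt y' F by auto
    then have "arev y' = arev y"
      using inj_onD[OF inj_on_induced_cw[OF permutation_cw, of A], of "arev y'" "arev y"] A that(1)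
      by (simp add: f_def)
    then show ?thesis using \<open>y' \<in> lf a\<close> by simp
  qed
  have "y \<in> A \<and> (y \<in> lf a \<longrightarrow> x \<in> lf a)" if "y \<in> orbit f x" for y
    using that by induct (use x in_A pull in blast)+
  moreover have "a \<in> orbit f x" using a by (simp add: left_face_def f_def)
  ultimately show ?thesis using lf_self[of a] by blast
qed

end

lemma in_set_tl_conv_nth: "x \<in> set (tl xs) \<longleftrightarrow> (\<exists>i. Suc i < length xs \<and> x = xs ! Suc i)"
  by (cases xs) (auto simp: in_set_conv_nth)

context canonical_plane
begin

text \<open>
  \<open>f2\<close> is the inner face at the edge from \<open>v\<^sub>1\<close> to \<open>v\<^sub>n\<close>, and \<open>sg F\<close> is the group of the top
  vertex of \<open>F\<close>.
\<close>

definition f2 :: "'b set" where "f2 = lf (arev b)"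
definition sg :: "'b set \<Rightarrow> nat" where "sg F = Max ((\<lambda>a. grp (head G a)) ` F)"

lemma inc_iff_grp:
  assumes "a \<in> arcs G" "grp (head G a) \<noteq> grp (tail G a)"
  shows "inc a \<longleftrightarrow> grp (head G a) < grp (tail G a)"
  using pos_less[of "head G a" "tail G a"] pos_less[of "tail G a" "head G a"] assms
  unfolding inc_def by (metis head_in_verts linorder_neqE_nat order_less_asym tail_in_verts)

lemma inc_grp: "\<lbrakk>a \<in> arcs G; inc a\<rbrakk> \<Longrightarrow> grp (head G a) \<le> grp (tail G a)"
  using inc_iff_grp[of a] by linarith

lemma sg_head: "y \<in> lf a \<Longrightarrow> grp (head G y) \<le> sg (lf a)"
  unfolding sg_def by (intro Max_ge) auto

lemma sg_tail: "\<lbrakk>y \<in> lf a; a \<in> arcs G\<rbrakk> \<Longrightarrow> grp (tail G y) \<le> sg (lf a)"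
proof -
  assume y: "y \<in> lf a" "a \<in> arcs G"
  obtain x where x: "nxt x = y" using nxt_surj by blast
  then have "x \<in> lf a" using y nxt_in_lf by metis
  moreover have "head G x = tail G y" using lf_arcs[OF y(2) \<open>x \<in> lf a\<close>] by (auto simp flip: x)
  ultimately show ?thesis using sg_head by metis
qed

lemma sg_top:
  assumes "x \<in> arcs G" "\<not> inc x" "inc (nxt x)"
  shows "sg (lf x) = grp (head G x)"
  unfolding sg_def
proof (rule Max_eqI)
  fix y assume "y \<in> (\<lambda>a. grp (head G a)) ` lf x"
  then show "y \<le> grp (head G x)"
    using face_top_max[OF assms] grp_mono lf_arcs[OF assms(1)] assms(1) by (auto simp: image_iff)
qed auto

lemma top_arc:
  assumes "a \<in> arcs G"
  obtains x where "x \<in> arcs G" "lf x = lf a" "\<not> inc x" "inc (nxt x)" "sg (lf a) = grp (head G x)"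
proof -
  obtain x where x: "x \<in> lf a" "\<not> inc x" "inc (nxt x)" using face_max[OF assms] by blast
  then have "x \<in> arcs G" "lf x = lf a" using lf_arcs[OF assms] lf_eqI by auto
  then show thesis using that sg_top[of x] x by metis
qed

text \<open>Within the first group the only descending arc runs from \<open>v2\<close> to
  \<open>v1\<close>. A top corner there would consist of this arc twice, so its face would lie on
  both sides of one edge.\<close>

lemma sg_pos: "a \<in> arcs G \<Longrightarrow> 1 \<le> sg (lf a)"
proof (rule ccontr)
  assume a: "a \<in> arcs G" and 0: "\<not> 1 \<le> sg (lf a)"
  obtain x where x: "x \<in> arcs G" "lf x = lf a" "\<not> inc x" "inc (nxt x)" "sg (lf a) = grp (head G x)"
    using top_arc[OF a] by blast
  then have grp0: "grp (head G x) = 0" using 0 by simp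
  have at_v2: "head G y = v1 \<and> tail G y = v2" if "y \<in> arcs G" "inc y" "grp (tail G y) = 0" for y
  proof -
    have "grp (head G y) = 0" using inc_grp[OF that(1,2)] that(3) by simp
    then show ?thesis
      using that grp_0[of "head G y"] grp_0[of "tail G y"] no_loops[OF that(1)] pos_v1 pos_v2 by (auto simp: inc_def)
  qed
  have "nxt x = arev x"
    using at_v2[of "arev x"] at_v2[of "nxt x"] x grp0 by (intro same_ends) (auto simp: inc_arev)
  then have "lf (arev x) = lf x" using lf_nxt[of x] by simp
  then show False using lf_arev_neq[OF x(1)] by simp
qed

lemma sg_less: "a \<in> arcs G \<Longrightarrow> sg (lf a) < K"
  using top_arc[of a] grp_less by (metis head_in_verts)

lemma inc_at_vn: "\<lbrakk>a \<in> arcs G; tail G a = vn\<rbrakk> \<Longrightarrow> inc a"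
proof -
  assume a: "a \<in> arcs G" "tail G a = vn"
  then have "head G a \<noteq> vn" using no_loops by metis
  then have "grp (head G a) \<noteq> K - 1" "grp (head G a) < K" using grp_last grp_less a by auto
  then show ?thesis using inc_iff_grp[OF a(1)] a grp_v by simp
qed

lemma b_top: "\<not> inc b" "inc (nxt b)"
  using inc_at_vn[of "arev b"] inc_at_vn[of "nxt b"] arcs_rb b by (auto simp: inc_arev)

lemma sg_fo: "sg fo = K - 1" and sg_f2: "sg f2 = K - 1"
proof -
  show "sg fo = K - 1" using sg_top[of b] b_top arcs_rb b grp_v by simp
  have "K - 1 \<le> sg f2" using sg_tail[of "arev b" "arev b"] arcs_rb b grp_v by (simp add: f2_def)
  then show "sg f2 = K - 1" using sg_less[of "arev b"] arcs_rb by (simp add: f2_def)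
qed

text \<open>2-connectivity of the prefix in cut form. If \<open>u\<close> lies outside the prefix,
  nothing is deleted.\<close>

lemma earlier_two_connected:
  assumes k: "1 \<le> k" "k < K" and u: "u \<in> verts G" and A: "A \<noteq> {}" "A \<subseteq> {v \<in> verts G. grp v \<le> k} - {u}"
    "A \<noteq> {v \<in> verts G. grp v \<le> k} - {u}"
  obtains a where "a \<in> arcs G" "tail G a \<in> A" "head G a \<in> {v \<in> verts G. grp v \<le> k} - {u} - A"
proof -
  define S where "S = {v \<in> verts G. grp v \<le> k}"
  have S: "earlier Vs (Suc k) = S" using earlier_Vs[of "Suc k"] k by (auto simp: S_def less_Suc_eq_le)
  define X where "X = S \<inter> {u}"
  have "connected ((G \<restriction> S) \<restriction> (S - X))"
    using two_connected[OF k] unfolding S k_connected_def X_def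
    by (auto dest!: spec[of _ "S \<inter> {u}"]) (metis Int_insert_right card.empty card_1_singleton_iff inf_bot_right less_2_cases_iff)
  then have "cut_connected G (S - X)"
    using connected_induce_iff[OF sym_arcs] induce_induce[of "S - X" S G] by simp
  moreover have "S - X = S - {u}" by (auto simp: X_def)
  ultimately have "cut_connected G (S - {u})" by simp
  then have "\<exists>x\<in>A. \<exists>y\<in>S - {u} - A. x \<rightarrow>\<^bsub>G\<^esub> y"
    using A unfolding cut_connected_def S_def[symmetric] by metis
  then obtain x y where "x \<in> A" "y \<in> S - {u} - A" "x \<rightarrow>\<^bsub>G\<^esub> y" by blast
  then show thesis using that unfolding S_def by blast
qed

text \<open>
  The arcs from the group \<open>k\<close> to earlier groups, except the one from \<open>v\<^sub>n\<close> to \<open>v\<^sub>1\<close>, in clockwise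
  order, so that the first is the SE-edge and the last is the SW-edge of the group. The faces between
  consecutive ones are those with top vertex in the group.
\<close>

definition chords_of :: "nat \<Rightarrow> 'b list \<Rightarrow> bool" where
  "chords_of k es \<longleftrightarrow>
     2 \<le> length es \<and> distinct es \<and>
     set es = {a \<in> arcs G. grp (tail G a) = k \<and> grp (head G a) < k \<and> a \<noteq> arev b} \<and>
     (\<forall>i. Suc i < length es \<longrightarrow> lf (arev (es ! i)) = lf (es ! Suc i)) \<and>
     distinct (map lf (tl es)) \<and>
     lf ` set (tl es) = {F \<in> faces G arev cw. sg F = k} - {fo, f2} \<and>
     lf (hd es) \<notin> lf ` set (tl es) \<and> lf (arev (last es)) \<notin> lf ` set (tl es) \<and>
     lf (hd es) \<noteq> lf (arev (last es)) \<and>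
     (length (Vs ! k) \<noteq> 1 \<longrightarrow>
       length es = 2 \<and> tail G (hd es) = last (Vs ! k) \<and> tail G (last es) = hd (Vs ! k) \<and>
       head G (hd es) \<noteq> head G (last es) \<and>
       (\<forall>a\<in>arcs G. \<forall>i. Suc i < length (Vs ! k) \<and> tail G a = Vs ! k ! Suc i \<and> head G a = Vs ! k ! i \<longrightarrow>
         lf a = lf (last es)))"

text \<open>The incoming arcs at \<open>z\<close> have a single exit by
  \<open>last_in_unique\<close>, hence form an interval. At \<open>vn\<close> every arc is incoming,
  and there omitting \<open>arev b\<close> cuts the circle open.\<close>

lemma singleton_chords:
  assumes k: "1 \<le> k" "k < K" and z: "Vs ! k = [z]"
  obtains es where "chords_of k es"
proof -
  have z_iff: "grp v = k \<longleftrightarrow> v = z" if "v \<in> verts G" for v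
    using that grp_mem[of v] in_group[OF k(2), of z] z by auto
  have zV: "z \<in> verts G" "grp z = k" using in_group[OF k(2), of z] z by auto
  define I where "I = {a \<in> arcs G. tail G a = z \<and> inc a \<and> a \<noteq> arev b}"
  have I_iff: "I = {a \<in> arcs G. grp (tail G a) = k \<and> grp (head G a) < k \<and> a \<noteq> arev b}"
  proof -
    have "inc a \<longleftrightarrow> grp (head G a) < k" if "a \<in> arcs G" "tail G a = z" for a
      using inc_iff_grp[OF that(1)] z_iff[of "head G a"] no_loops[OF that(1)] that zV by auto
    moreover have "grp (tail G a) = k \<longleftrightarrow> tail G a = z" if "a \<in> arcs G" for a using z_iff that by simp
    ultimately show ?thesis unfolding I_def by blast
  qed
  have tails: "tail G a = z" "a \<in> arcs G" if "a \<in> I" for a using that by (auto simp: I_def)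
  have zn: "z = vn \<longleftrightarrow> k = K - 1" using z_iff[of vn] grp_v by auto
  \<comment> \<open>At \<open>vn\<close> the degree is at least 3 and \<open>arev b\<close> accounts
    for one neighbour; at other singleton-groups the bound is part of the definition.\<close>
  have "2 \<le> card (head G ` I)"
  proof (cases "k = K - 1")
    case True
    have "head G a \<in> insert v1 (head G ` I)" if "a \<in> arcs G" "tail G a = vn" for a
      using that inc_at_vn[OF that] zn True b arcs_rb by (cases "a = arev b") (auto simp: I_def)
    then have "3 \<le> card (insert v1 (head G ` I))"
      using degree_ge_3[OF three_connected, of vn "insert v1 (head G ` I)"] grp_v by (simp add: I_def)
    also have "\<dots> \<le> Suc (card (head G ` I))" by (simp add: card_insert_if I_def)
    finally show ?thesis by simp
  next
    case False
    then have "k < K - 1" using k by simp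
    have "nbrs_in G z (earlier Vs k) \<subseteq> head G ` I"
    proof
      fix v assume "v \<in> nbrs_in G z (earlier Vs k)"
      then obtain a where "a \<in> arcs G" "tail G a = z" "head G a = v" "grp v < k"
        using nbrs_in_iff earlier_Vs[of k] k by auto
      moreover have "a \<noteq> arev b" using calculation zn False b arcs_rb by auto
      ultimately show "v \<in> head G ` I" unfolding I_iff using zV by auto
    qed
    then have "card (nbrs_in G z (earlier Vs k)) \<le> card (head G ` I)"
      by (intro card_mono) (auto simp: I_def)
    then show ?thesis using singleton_props(1)[OF k(1) \<open>k < K - 1\<close> z] by simp
  qed
  moreover have "card (head G ` I) \<le> card I" by (rule card_image_le) (simp add: I_def)
  ultimately have card_I: "2 \<le> card I" by simp
  have "I \<noteq> {}" using card_I by auto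
  then obtain a0 where "a0 \<in> I" by blast
  have sub: "I \<subseteq> out_arcs G z" unfolding I_def out_arcs_def by blast
  obtain b' where b': "b' \<in> out_arcs G z" "b' \<notin> I"
  proof (cases "k = K - 1")
    case True
    then show thesis using that[of "arev b"] zn b arcs_rb by (auto simp: I_def)
  next
    case False
    then obtain a where "a \<in> arcs G" "tail G a = z" "pos z < pos (head G a)" using higher[of z] zn zV by auto
    then show thesis using that[of a] by (auto simp: I_def inc_def)
  qed
  have uniq: "e = e'" if e: "e \<in> I" "cw e \<notin> I" "e' \<in> I" "cw e' \<notin> I" for e e'
  proof (cases "k = K - 1")
    case True
    have "cw e = arev b" "cw e' = arev b"
      using e tails[OF e(1)] tails[OF e(3)] inc_at_vn[of "cw e"] inc_at_vn[of "cw e'"] zn True by (auto simp: I_def)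
    then show ?thesis by (metis cw_eq_iff)
  next
    case False
    then have "a \<noteq> arev b" if "tail G a = z" for a using that zn b arcs_rb by auto
    then show ?thesis using last_in_unique[of e e'] e tails[OF e(1)] tails[OF e(3)] by (auto simp: I_def)
  qed
  have cyc: "cyclic_on cw (out_arcs G z)" using cyclic_out tails[OF \<open>a0 \<in> I\<close>] by metis
  have proper: "I \<noteq> {}" "I \<noteq> out_arcs G z" using \<open>a0 \<in> I\<close> b' by auto
  obtain es where es: "es \<noteq> []" "distinct es" "set es = I"
    "\<And>i. Suc i < length es \<Longrightarrow> cw (es ! i) = es ! Suc i" "cw (last es) \<notin> I"
  proof (rule cyclic_on_interval[OF cyc inj_cw sub proper])
    show "e = e'" if "e \<in> I" "cw e \<notin> I" "e' \<in> I" "cw e' \<notin> I" for e e' using uniq that by blast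
  qed (rule that)
  have len: "2 \<le> length es" using card_I es distinct_card by metis
  have nthI: "es ! i \<in> I" if "i < length es" for i using that es(3) by auto
  have step: "lf (arev (es ! i)) = lf (es ! Suc i)" if "Suc i < length es" for i
    using lf_cw es(4)[OF that] by metis
  have tl_iff: "e \<in> set (tl es) \<longleftrightarrow> (\<exists>i. Suc i < length es \<and> e = es ! Suc i)" for e
    by (rule in_set_tl_conv_nth)
  have inj: "x = y" if "x \<in> I" "y \<in> arcs G" "tail G y = z" "lf x = lf y" for x y
    using corner_unique[of x y] that tails[of x] by simp
  have tlI: "set (tl es) \<subseteq> I" using es(3) list.set_sel(2)[OF es(1)] by blast
  have d: "distinct (map lf (tl es))"
    using es(2) inj tlI tails by (auto simp: distinct_map distinct_tl inj_on_def subset_iff)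
  have top: "\<not> inc (arev (es ! i))" "inc (nxt (arev (es ! i)))" "sg (lf (es ! Suc i)) = k" if "Suc i < length es" for i
  proof -
    have "es ! i \<in> I" "es ! Suc i \<in> I" using nthI that by auto
    then show *: "\<not> inc (arev (es ! i))" "inc (nxt (arev (es ! i)))"
      using es(4)[OF that] by (auto simp: I_def inc_arev)
    then show "sg (lf (es ! Suc i)) = k"
      using sg_top[of "arev (es ! i)"] step[OF that] tails[OF \<open>es ! i \<in> I\<close>] zV by simp
  qed
  \<comment> \<open>A face with top \<open>z\<close> lies between two consecutive incoming arcs. The
    faces \<open>fo\<close> and \<open>f2\<close> are those whose top corner at \<open>vn\<close>
    involves \<open>arev b\<close>, which \<open>I\<close> omits.\<close>
  have faces: "lf ` set (tl es) = {F \<in> faces G arev cw. sg F = k} - {fo, f2}"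
  proof (intro set_eqI iffI)
    fix F assume "F \<in> lf ` set (tl es)"
    then obtain i where i: "Suc i < length es" "F = lf (es ! Suc i)" by (auto simp: tl_iff)
    have m: "es ! i \<in> I" "es ! Suc i \<in> I" using nthI i by auto
    have "F \<noteq> fo"
    proof
      assume "F = fo"
      then have "arev (es ! i) = b"
        using face_top_unique[of "arev (es ! i)" b] top[OF i(1)] b_top arcs_rb step[OF i(1)] i(2) tails[OF m(1)] by simp
      then show False using m(1) unfolding I_def by auto
    qed
    moreover have "F \<noteq> f2"
    proof
      assume "F = f2"
      then have "k = K - 1" using sg_f2 top(3)[OF i(1)] i(2) by simp
      then have "es ! Suc i = arev b"
        using inj[of "es ! Suc i" "arev b"] m i(2) \<open>F = f2\<close> zn b arcs_rb by (simp add: f2_def)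
      then show False using m(2) by (simp add: I_def)
    qed
    ultimately show "F \<in> {F \<in> faces G arev cw. sg F = k} - {fo, f2}"
      using top(3)[OF i(1)] i(2) tails[OF m(2)] by simp
  next
    fix F assume F: "F \<in> {F \<in> faces G arev cw. sg F = k} - {fo, f2}"
    then obtain a where a: "a \<in> arcs G" "F = lf a" by (auto elim: faceE)
    obtain x where x: "x \<in> arcs G" "lf x = lf a" "\<not> inc x" "inc (nxt x)" "sg (lf a) = grp (head G x)"
      using top_arc[OF a(1)] by blast
    then have hz: "head G x = z" using F a z_iff[of "head G x"] by simp
    have "x \<noteq> b" using F a x(2) arcs_rb by auto
    moreover have "nxt x \<noteq> arev b"
    proof
      assume "nxt x = arev b"
      then have "lf x = f2" using lf_nxt[of x] by (simp add: f2_def)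
      then show False using F a x(2) by simp
    qed
    ultimately have mem: "arev x \<in> I" "nxt x \<in> I"
      using x(1,3,4) hz by (simp_all add: I_def inc_arev)
    then obtain i where i: "i < length es" "es ! i = arev x" using es(3) by (auto simp: in_set_conv_nth)
    have "Suc i < length es"
    proof (rule ccontr)
      assume "\<not> Suc i < length es"
      then have "i = length es - 1" using i(1) by simp
      then have "last es = arev x" using i es(1) by (simp add: last_conv_nth)
      then show False using es(5) mem by simp
    qed
    then have "nxt x = es ! Suc i" using es(4)[of i] i by simp
    then have "nxt x \<in> set (tl es)" using \<open>Suc i < length es\<close> tl_iff by blast
    moreover have "F = lf (nxt x)" using a x(2) by simp
    ultimately show "F \<in> lf ` set (tl es)" by (rule rev_image_eqI)
  qed
  have hd: "hd es \<in> I" "hd es \<notin> set (tl es)" using es(1-3) by (cases es; auto)+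
  have cwl: "cw (last es) \<in> arcs G" "tail G (cw (last es)) = z" "lf (arev (last es)) = lf (cw (last es))"
    using es(1,3) tails[of "last es"] last_in_set[OF es(1)] by (auto simp: lf_cw)
  have "lf (hd es) \<notin> lf ` set (tl es)"
    using inj[OF hd(1)] hd(2) tlI tails by (auto simp: subset_iff)
  moreover have "lf (arev (last es)) \<notin> lf ` set (tl es)"
    using inj[OF _ cwl(1,2)] cwl(3) tlI es(5) by (auto simp: subset_iff)
  moreover have "lf (hd es) \<noteq> lf (arev (last es))"
    using inj[OF hd(1) cwl(1,2)] cwl(3) hd(1) es(5) by auto
  ultimately show thesis
    using that[of es] len es(2,3) I_iff step d faces z unfolding chords_of_def by simp
qed

text \<open>The face bounded by the chain and its two edges \<open>c\<close> and \<open>c'\<close>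
  to earlier groups is found by walking: from \<open>c'\<close> its boundary turns into the chain at
  the last vertex, descends along the chain to the first one and leaves through
  \<open>c\<close>.\<close>

lemma chain_chords:
  assumes k: "1 \<le> k" "k < K - 1" and nz: "length (Vs ! k) \<noteq> 1"
  obtains es where "chords_of k es"
proof -
  note ch = chain_props[OF k nz]
  define zs where "zs = Vs ! k"
  define l where "l = length zs"
  have l2: "2 \<le> l" using ch(1) by (simp add: l_def zs_def)
  have kK: "k < K" using k by simp
  have zs0: "hd zs = zs ! 0" "last zs = zs ! (l - 1)" "zs \<noteq> []"
  proof -
    show "zs \<noteq> []" using l2 by (auto simp: l_def)
    then show "hd zs = zs ! 0" "last zs = zs ! (l - 1)" by (simp_all add: hd_conv_nth last_conv_nth l_def)
  qed
  have zV: "zs ! i \<in> verts G" "grp (zs ! i) = k" if "i < l" for i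
    using in_group[OF kK, of "zs ! i"] that by (auto simp: zs_def l_def)
  have in_zs: "\<exists>i<l. v = zs ! i" if "v \<in> verts G" "grp v = k" for v
    using grp_mem[OF that(1)] that(2) by (auto simp: zs_def l_def in_set_conv_nth)
  have posz: "pos (zs ! i) = length (concat (take k Vs)) + i" if "i < l" for i
    using pos_group[OF kK, of i] that by (simp add: zs_def l_def)
  have adj: "j = Suc i \<or> i = Suc j" if "a \<in> arcs G" "tail G a = zs ! i" "head G a = zs ! j" "i < l" "j < l" for a i j
  proof -
    have "zs ! i \<rightarrow>\<^bsub>G\<^esub> zs ! j" using that(1-3) in_arcs_imp_in_arcs_ends[OF that(1)] by simp
    then show ?thesis using ch(2)[of i j] that(4,5) by (simp add: zs_def l_def)
  qed
  have nb: "nbrs_in G v (earlier Vs k) = head G ` {a \<in> arcs G. tail G a = v \<and> grp (head G a) < k}" for v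
    using earlier_Vs[of k] k by (auto simp: nbrs_in_iff)
  have leave: "\<exists>c. {a \<in> arcs G. tail G a = v \<and> grp (head G a) < k} = {c}"
    if "card (nbrs_in G v (earlier Vs k)) = 1" for v
  proof -
    have "inj_on (head G) {a \<in> arcs G. tail G a = v \<and> grp (head G a) < k}"
      by (rule inj_onI) (auto intro: same_ends)
    then have "card {a \<in> arcs G. tail G a = v \<and> grp (head G a) < k} = 1"
      using that unfolding nb by (simp add: card_image)
    then show ?thesis by (auto simp: card_1_singleton_iff)
  qed
  obtain c where c_iff: "{a \<in> arcs G. tail G a = zs ! 0 \<and> grp (head G a) < k} = {c}"
    using leave[of "zs ! 0"] ch(4) zs0(1) unfolding zs_def by auto
  obtain c' where c'_iff: "{a \<in> arcs G. tail G a = zs ! (l - 1) \<and> grp (head G a) < k} = {c'}"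
    using leave[of "zs ! (l - 1)"] ch(5) zs0(2) unfolding zs_def by auto
  have c: "c \<in> arcs G" "tail G c = zs ! 0" "grp (head G c) < k" using c_iff by auto
  have c': "c' \<in> arcs G" "tail G c' = zs ! (l - 1)" "grp (head G c') < k" using c'_iff by auto
  have only: "i = 0 \<and> a = c \<or> i = l - 1 \<and> a = c'"
    if a: "a \<in> arcs G" "tail G a = zs ! i" "i < l" "grp (head G a) < k" for a i
  proof -
    consider "i = 0" | "i = l - 1" | "0 < i" "Suc i < l" using a(3) by linarith
    then show ?thesis
    proof cases
      case 1 then show ?thesis using c_iff a by auto
    next
      case 2 then show ?thesis using c'_iff a by auto
    next
      case 3
      then have "nbrs_in G (zs ! i) (earlier Vs k) = {}" using ch(6)[of i] by (simp add: zs_def l_def)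
      then show ?thesis using a by (auto simp: nb)
    qed
  qed
  have inc_zs: "i = 0 \<and> a = c \<or> i = l - 1 \<and> a = c' \<or> (0 < i \<and> head G a = zs ! (i - 1))"
    if a: "a \<in> arcs G" "tail G a = zs ! i" "i < l" "inc a" for a i
  proof (cases "grp (head G a) = k")
    case True
    then obtain j where j: "j < l" "head G a = zs ! j" using in_zs[OF head_in_verts[OF a(1)] True] by blast
    then have "j < i" using a posz[OF a(3)] posz[OF j(1)] by (simp add: inc_def)
    then show ?thesis using adj[OF a(1,2) j(2) a(3) j(1)] j by auto
  next
    case False
    then show ?thesis using inc_grp[OF a(1,4)] a zV[OF a(3)] only[OF a(1-3)] by auto
  qed
  \<comment> \<open>A common neighbour below would separate the chain from the rest of the prefix,
    which is 2-connected.\<close>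
  have ne: "head G c \<noteq> head G c'"
  proof
    assume eq: "head G c = head G c'"
    define u where "u = head G c"
    define S where "S = {v \<in> verts G. grp v \<le> k}"
    have uS: "u \<in> verts G" "grp u < k" using c by (auto simp: u_def)
    have sub: "set zs \<subseteq> S - {u}" using in_group[OF kK] uS by (auto simp: zs_def S_def)
    have "\<exists>w\<in>{v1, v2}. w \<noteq> u" using grp_v by auto
    then obtain w where w: "w \<in> verts G" "grp w = 0" "w \<noteq> u" using grp_v by blast
    then have "w \<in> S - {u}" by (simp add: S_def)
    moreover have "w \<notin> set zs" using in_group[OF kK, of w] k w(2) unfolding zs_def by linarith
    ultimately have "set zs \<noteq> S - {u}" by blast
    then obtain a where a: "a \<in> arcs G" "tail G a \<in> set zs" "head G a \<in> S - {u} - set zs"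
      using earlier_two_connected[OF k(1) kK uS(1), of "set zs"] sub zs0(3) unfolding S_def by auto
    then obtain i where i: "i < l" "tail G a = zs ! i" by (auto simp: in_set_conv_nth l_def)
    have "grp (head G a) \<noteq> k" using a(1,3) grp_mem[of "head G a"] by (auto simp: zs_def)
    then have "grp (head G a) < k" using a(3) by (simp add: S_def)
    then have "a = c \<or> a = c'" using only[OF a(1) i(2,1)] by blast
    then show False using a(3) eq by (auto simp: u_def)
  qed
  define m where "m = l - 2"
  have m: "Suc m = l - 1" "m < l" "Suc m < l" "l - Suc (Suc 0) = m" using l2 by (auto simp: m_def)
  have "zs ! Suc m \<rightarrow>\<^bsub>G\<^esub> zs ! m" using ch(2)[of "Suc m" m] m by (simp add: zs_def l_def)
  then obtain d where d: "d \<in> arcs G" "tail G d = zs ! Suc m" "head G d = zs ! m" by auto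
  have "inc d" using posz m d by (simp add: inc_def)
  have "inc c'" using c' zV[of "l - 1"] m inc_iff_grp[OF c'(1)] by auto
  have dc: "d \<noteq> c'" using d c' zV[of m] m by auto
  have inc_last: "a = c' \<or> a = d" if "a \<in> arcs G" "tail G a = zs ! (l - 1)" "inc a" for a
  proof -
    have "a = c' \<or> head G a = zs ! m" using inc_zs[OF that(1,2) _ that(3)] m by auto
    then show ?thesis using same_ends[OF that(1) d(1)] that d m by auto
  qed
  define z where "z = zs ! (l - 1)"
  have zz: "z \<in> verts G" "grp z = k" "z \<noteq> vn" using zV[of "l - 1"] m k grp_v by (auto simp: z_def)
  obtain h where h: "h \<in> arcs G" "tail G h = z" "\<not> inc h"
    using higher[OF zz(1,3)] by (auto simp: inc_def)
  have cyc: "cyclic_on cw (out_arcs G z)" using cyclic_out[OF h(1)] h by simp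
  \<comment> \<open>Here the clockwise listing of the chain is used. With the other order of
    \<open>c'\<close> and \<open>d\<close>, the face with its top corner between them would lie
    within the prefix and hence survive in the subgraph. It contains the chain arc into
    \<open>z\<close>, which is on the outer face, so it would be \<open>fo\<close>, whose top is in
    the last group.\<close>
  have "cw c' = d"
  proof (rule ccontr)
    assume no: "cw c' \<noteq> d"
    have out: "cw a \<in> arcs G" "tail G (cw a) = z" if "a \<in> {c', d}" for a
      using that c' d m by (auto simp: z_def)
    have nfix: "cw a \<noteq> a" if "a \<in> {c', d}" for a
    proof
      assume "cw a = a"
      then have "orbit cw a = {a}" by (simp add: orbit_eq_singleton_iff)
      moreover have "orbit cw a = out_arcs G z"
        using orbit_cyclic_eq3[OF cyc, of a] that c' d m by (auto simp: z_def)
      ultimately have "out_arcs G z = {a}" by simp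
      moreover have "h \<in> out_arcs G z" using h(1,2) by (simp add: out_arcs_def)
      ultimately have "h = a" by blast
      moreover have "inc a" using that \<open>inc d\<close> \<open>inc c'\<close> by blast
      ultimately show False using h(3) by blast
    qed
    have "\<not> inc (cw c')" using inc_last[of "cw c'"] out[of c'] no nfix[of c'] unfolding z_def by blast
    then have "inc (cw d)"
      using last_in_unique[of c' d] c' d m \<open>inc d\<close> \<open>inc c'\<close> dc by auto
    then have cwd': "cw d = c'" using inc_last[of "cw d"] out[of d] nfix[of d] unfolding z_def by blast
    define A where "A = arcs (G \<restriction> earlier Vs (Suc k))"
    define x where "x = arev d"
    have x: "x \<in> arcs G" "\<not> inc x" "nxt x = c'" "head G x = zs ! (l - 1)" "tail G x = zs ! m"
      using d \<open>inc d\<close> cwd' m by (auto simp: x_def inc_arev)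
    have sgx: "sg (lf x) = k" using sg_top[of x] x \<open>inc c'\<close> zV[of "l - 1"] m by simp
    have ea: "earlier Vs (Suc k) = {v \<in> verts G. grp v \<le> k}"
      using earlier_Vs[of "Suc k"] kK by (simp add: less_Suc_eq_le)
    have A_iff: "a \<in> A \<longleftrightarrow> a \<in> arcs G \<and> grp (tail G a) \<le> k \<and> grp (head G a) \<le> k" for a
      unfolding A_def induce_subgraph_arcs ea by (simp cong: conj_cong)
    have "lf x \<subseteq> A"
      using lf_arcs[OF x(1)] sg_head[of _ x] sg_tail[OF _ x(1)] sgx by (auto simp: A_iff)
    moreover obtain a where a: "a \<in> left_face arev (induced_cw cw A) r" "tail G a = zs ! m" "head G a = zs ! Suc m"
      using ch(3)[of m] m by (auto simp: A_def zs_def l_def)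
    have "a = x"
    proof -
      have "r \<in> A" using r_in[OF k(1) kK] by (simp add: A_def)
      then have "a \<in> A" using left_face_induced_subset[of r A] a(1) by (auto simp: A_iff)
      then have "a \<in> arcs G" by (simp add: A_iff)
      then show ?thesis using same_ends[of a x] a x m by simp
    qed
    moreover have "r \<in> A" using r_in[OF k(1) kK] by (simp add: A_def)
    ultimately have "r \<in> lf x" using face_within_subgraph[of r A x] a(1) by (auto simp: A_iff)
    then have "lf x = fo" using lf_eqI arcs_rb by blast
    then have "k = K - 1" using sgx sg_fo by (simp only:)
    then show False using k(2) by linarith
  qed
  \<comment> \<open>Otherwise \<open>c'\<close> and \<open>d\<close> would be the whole rotation at
    \<open>z\<close>, with no room for the outgoing \<open>h\<close>.\<close>
  have ndc: "cw d \<noteq> c'"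
  proof
    assume "cw d = c'"
    have "h \<in> out_arcs G z" "h \<notin> {c', d}" using h \<open>inc d\<close> \<open>inc c'\<close> by (auto simp: out_arcs_def)
    then have "{c', d} \<noteq> out_arcs G z" by blast
    moreover have "{c', d} \<subseteq> out_arcs G z" using c' d m by (simp add: out_arcs_def z_def)
    ultimately show False using cyclic_on_exit[OF cyc, of "{c', d}"] \<open>cw d = c'\<close> \<open>cw c' = d\<close> by blast
  qed
  define x where "x = arev c'"
  have x: "x \<in> arcs G" "\<not> inc x" "inc (nxt x)" "nxt x = d" "head G x = z"
    using c' \<open>inc c'\<close> \<open>inc d\<close> \<open>cw c' = d\<close> by (auto simp: x_def inc_arev z_def)
  have lfx: "lf x = lf d" using lf_nxt[of x] x(4) by simp
  have sgx: "sg (lf d) = k" using sg_top[OF x(1-3)] x(5) zz lfx by simp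
  \<comment> \<open>The face reaches the head of \<open>c'\<close>, in an earlier group. Its only
    local minimum therefore lies below the chain, and a descent within the group has to
    continue.\<close>
  have down: "inc (nxt y)" if y: "y \<in> lf d" "inc y" "grp (head G y) = k" for y
  proof (rule ccontr)
    assume "\<not> inc (nxt y)"
    have yG: "y \<in> arcs G" using lf_arcs[OF d(1) y(1)] .
    obtain p where p: "nxt p = x" using nxt_surj by blast
    have "p \<in> lf d" using lfx lf_nxt[of p] p lf_self[of p] by simp
    moreover have "lf y = lf d" using lf_eqI y(1) by simp
    ultimately have "pos (head G y) \<le> pos (head G p)"
      using face_bot_min[OF yG y(2) \<open>\<not> inc (nxt y)\<close>, of p] by simp
    moreover have "head G p = head G c'"
    proof -
      have "p \<in> arcs G" using lf_arcs[OF d(1) \<open>p \<in> lf d\<close>] .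
      then have "head G p = tail G x" by (auto simp flip: p)
      then show ?thesis using c' by (simp add: x_def)
    qed
    moreover have "pos (head G c') < pos (head G y)" using pos_less[of "head G c'" "head G y"] c' yG y(3) by simp
    ultimately show False by simp
  qed
  \<comment> \<open>Descending induction from \<open>d\<close>: at an inner chain vertex the only
    way down is to its predecessor.\<close>
  have walk: "\<exists>a\<in>lf d. tail G a = zs ! Suc i \<and> head G a = zs ! i" if "i \<le> m" for i
    using that
  proof (induction i rule: inc_induct)
    case base
    then show ?case using d lf_self by blast
  next
    case (step i)
    then obtain a where a: "a \<in> lf d" "tail G a = zs ! Suc (Suc i)" "head G a = zs ! Suc i" by blast
    have i: "Suc i < l - 1" using step m by simp
    have aG: "a \<in> arcs G" using lf_arcs[OF d(1) a(1)] .
    have "inc a" using a posz[of "Suc i"] posz[of "Suc (Suc i)"] i by (simp add: inc_def)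
    then have "inc (nxt a)" using down[OF a(1)] a zV[of "Suc i"] i by simp
    moreover have "nxt a \<in> arcs G" "tail G (nxt a) = zs ! Suc i" using aG a by auto
    ultimately have "head G (nxt a) = zs ! i" using inc_zs[of "nxt a" "Suc i"] i by auto
    then show ?case using a(1) \<open>tail G (nxt a) = zs ! Suc i\<close> by (intro bexI[of _ "nxt a"]) auto
  qed
  have lfc: "lf c = lf d"
  proof -
    obtain a where a: "a \<in> lf d" "tail G a = zs ! Suc 0" "head G a = zs ! 0" using walk[of 0] by auto
    have aG: "a \<in> arcs G" using lf_arcs[OF d(1) a(1)] .
    have "inc a" using a posz[of 0] posz[of "Suc 0"] l2 by (simp add: inc_def)
    then have "inc (nxt a)" using down[OF a(1)] a zV[of 0] l2 by simp
    moreover have "nxt a \<in> arcs G" "tail G (nxt a) = zs ! 0" using aG a by auto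
    ultimately have "nxt a = c" using inc_zs[of "nxt a" 0] l2 by auto
    moreover have "nxt a \<in> lf d" using a(1) by simp
    ultimately show ?thesis using lf_eqI by metis
  qed
  have lfi: "lf a = lf c" if a: "a \<in> arcs G" "Suc i < l" "tail G a = zs ! Suc i" "head G a = zs ! i" for a i
  proof -
    obtain a' where a': "a' \<in> lf d" "tail G a' = zs ! Suc i" "head G a' = zs ! i" using walk[of i] a(2) m(1) by fastforce
    then have "a = a'" using same_ends[OF a(1) lf_arcs[OF d(1) a'(1)]] a by simp
    then show ?thesis using a'(1) lf_eqI lfc by simp
  qed
  have faces: "{lf c} = {F \<in> faces G arev cw. sg F = k} - {fo, f2}"
  proof (intro set_eqI iffI)
    fix F assume "F \<in> {lf c}"
    then show "F \<in> {F \<in> faces G arev cw. sg F = k} - {fo, f2}"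
      using lf_in_faces[OF d(1)] sgx lfc sg_fo sg_f2 k by auto
  next
    fix F assume F: "F \<in> {F \<in> faces G arev cw. sg F = k} - {fo, f2}"
    then obtain a where a: "a \<in> arcs G" "F = lf a" by (auto elim: faceE)
    obtain y where y: "y \<in> arcs G" "lf y = lf a" "\<not> inc y" "inc (nxt y)" "sg (lf a) = grp (head G y)"
      by (rule top_arc[OF a(1)])
    have "grp (head G y) = k" using F a(2) y(5) by simp
    then obtain i where i: "i < l" "head G y = zs ! i" using in_zs[OF head_in_verts[OF y(1)]] by blast
    have two: "arev y \<noteq> nxt y" using lf_arev_neq[OF y(1)] lf_nxt[of y] by metis
    \<comment> \<open>A top corner needs two distinct incoming arcs, and the last vertex of the
      chain is the only one in the group that has two.\<close>
    have i_last: "i = l - 1"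
    proof (rule ccontr)
      assume "i \<noteq> l - 1"
      then have *: "i = 0 \<and> e = c \<or> 0 < i \<and> head G e = zs ! (i - 1)"
        if "e \<in> {arev y, nxt y}" for e
        using inc_zs[of e i] that y i by (auto simp: inc_arev)
      have "arev y = nxt y"
        using *[of "arev y"] *[of "nxt y"] same_ends[of "arev y" "nxt y"] y by auto
      then show False using two by simp
    qed
    have "arev y = c' \<or> arev y = d" "nxt y = c' \<or> nxt y = d"
      using inc_last[of "arev y"] inc_last[of "nxt y"] i i_last y by (auto simp: inc_arev)
    moreover have "\<not> (arev y = d \<and> nxt y = c')" using ndc by metis
    moreover have "lf a = lf c" if "nxt y = d" using that lf_nxt[of y] y lfc by simp
    moreover have "lf a = lf c" if "arev y = c'"
    proof -
      have "y = x" using that by (auto simp: x_def)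
      then show ?thesis using lfx lfc y by simp
    qed
    ultimately show "F \<in> {lf c}" using a two by auto
  qed
  have lf_c': "lf (arev c') = lf c" using lfx lfc by (simp add: x_def)
  have cc': "c' \<noteq> c" using ne by auto
  have sets: "set [c', c] = {a \<in> arcs G. grp (tail G a) = k \<and> grp (head G a) < k \<and> a \<noteq> arev b}"
  proof (intro set_eqI iffI)
    fix a assume "a \<in> set [c', c]"
    moreover have "grp (tail G c) = k" "grp (tail G c') = k"
      using c(2) c'(2) zV(2)[of 0] zV(2)[of "l - 1"] l2 by simp_all
    moreover have "grp (tail G (arev b)) \<noteq> k" using b arcs_rb grp_v k by simp
    ultimately show "a \<in> {a \<in> arcs G. grp (tail G a) = k \<and> grp (head G a) < k \<and> a \<noteq> arev b}"
      using c(1,3) c'(1,3) by auto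
  next
    fix a assume a: "a \<in> {a \<in> arcs G. grp (tail G a) = k \<and> grp (head G a) < k \<and> a \<noteq> arev b}"
    then obtain i where "i < l" "tail G a = zs ! i" using in_zs[of "tail G a"] by (auto simp only: mem_Collect_eq tail_in_verts)
    then show "a \<in> set [c', c]" using only[of a i] a by auto
  qed
  have ne1: "lf c' \<noteq> lf c" "lf (arev c) \<noteq> lf c"
    using lf_arev_neq[OF c'(1)] lf_arev_neq[OF c(1)] lf_c' by auto
  have ne2: "lf c' \<noteq> lf (arev c)"
  proof
    assume "lf c' = lf (arev c)"
    then have "c' = arev c" using dual_simple[of c' "arev c"] c c' lf_c' by simp
    then have "tail G c' = head G c" using c by simp
    then show False using c c' zV[of "l - 1"] l2 by auto
  qed
  show thesis
  proof (rule that[of "[c', c]"], unfold chords_of_def, intro conjI ballI allI impI)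
    show "set [c', c] = {a \<in> arcs G. grp (tail G a) = k \<and> grp (head G a) < k \<and> a \<noteq> arev b}"
      by (rule sets)
    show "lf ` set (tl [c', c]) = {F \<in> faces G arev cw. sg F = k} - {fo, f2}" using faces by simp
    show "tail G (hd [c', c]) = last (Vs ! k)" "tail G (last [c', c]) = hd (Vs ! k)"
      using c(2) c'(2) zs0 by (simp_all add: zs_def)
    show "lf a = lf (last [c', c])"
      if "a \<in> arcs G" "Suc i < length (Vs ! k) \<and> tail G a = Vs ! k ! Suc i \<and> head G a = Vs ! k ! i" for a i
      using lfi[of a i] that unfolding zs_def l_def by simp
    show "lf (arev ([c', c] ! i)) = lf ([c', c] ! Suc i)" if "Suc i < length [c', c]" for i
      using that lf_c' by simp
  qed (use cc' ne ne1 ne2 in simp_all)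
qed

end

section \<open>The groups of the dual\<close>

text \<open>Adding an ear with distinct attachments preserves connectivity after the deletion of any
  vertex: each remaining ear vertex can still walk to one of the attachments \<open>u\<close> and
  \<open>u'\<close>.\<close>

lemma cut_connected_ear:
  assumes sym: "symmetric G" and S: "\<And>x. cut_connected G (S - {x})"
    and zs: "zs \<noteq> []" "distinct zs" "set zs \<inter> S = {}" "\<And>i. Suc i < length zs \<Longrightarrow> zs ! i \<rightarrow>\<^bsub>G\<^esub> zs ! Suc i"
    and u: "u \<in> S" "u \<rightarrow>\<^bsub>G\<^esub> hd zs" and u': "u' \<in> S" "last zs \<rightarrow>\<^bsub>G\<^esub> u'" and ne: "u \<noteq> u'"
  shows "cut_connected G ((S \<union> set zs) - {x})"
proof -
  define T where "T = (S \<union> set zs) - {x}"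
  have symD: "w \<rightarrow>\<^bsub>G\<^esub> v" if "v \<rightarrow>\<^bsub>G\<^esub> w" for v w using sym that by (auto simp: symmetric_def sym_def)
  have len: "0 < length zs" using zs(1) by simp
  have hd_last: "hd zs = zs ! 0" "last zs = zs ! (length zs - 1)"
    using zs(1) by (simp_all add: hd_conv_nth last_conv_nth)
  \<comment> \<open>A part of the ear that no edge leaves cannot exist: going left or right along
    the ear reaches \<open>u\<close> or \<open>u'\<close>, and \<open>x\<close> blocks at most one
    of the two directions.\<close>
  have no_part: False
    if B: "B \<subseteq> set zs" "B \<subseteq> T" "B \<noteq> {}" and closed: "\<And>v w. \<lbrakk>v \<in> B; w \<in> T; v \<rightarrow>\<^bsub>G\<^esub> w\<rbrakk> \<Longrightarrow> w \<in> B" for B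
  proof -
    obtain i where i: "i < length zs" "zs ! i \<in> B" using B by (auto simp: in_set_conv_nth subset_iff)
    have left: False if l: "\<forall>j\<le>i. zs ! j \<noteq> x" "u \<noteq> x"
    proof -
      have "zs ! j \<in> B" if "j \<le> i" for j
        using that
      proof (induction j rule: inc_induct)
        case (step j)
        have "zs ! Suc j \<rightarrow>\<^bsub>G\<^esub> zs ! j" by (rule symD[OF zs(4)]) (use step i in simp)
        moreover have "zs ! j \<in> T" using l step i by (auto simp: T_def)
        ultimately show ?case using closed step by blast
      qed (use i in simp)
      then have "hd zs \<in> B" by (simp add: hd_last)
      then have "u \<in> B" using closed[OF _ _ symD[OF u(2)]] u l by (auto simp: T_def)
      then show False using B zs(3) u by blast
    qed
    have right: False if l: "\<forall>j<length zs. i \<le> j \<longrightarrow> zs ! j \<noteq> x" "u' \<noteq> x"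
    proof -
      have "j < length zs \<longrightarrow> zs ! j \<in> B" if "i \<le> j" for j
        using that
      proof (induction j rule: dec_induct)
        case (step j)
        show ?case
        proof
          assume j: "Suc j < length zs"
          then have "zs ! Suc j \<in> T" using l step by (auto simp: T_def)
          then show "zs ! Suc j \<in> B" using closed zs(4)[OF j] step j by simp
        qed
      qed (use i in simp)
      then have "last zs \<in> B" using len i by (simp add: hd_last)
      then have "u' \<in> B" using closed[OF _ _ u'(2)] u' l by (auto simp: T_def)
      then show False using B zs(3) u' by blast
    qed
    show False
    proof (cases "x \<in> set zs")
      case True
      then obtain p where p: "p < length zs" "zs ! p = x" by (auto simp: in_set_conv_nth)
      have xS: "u \<noteq> x" "u' \<noteq> x" using True zs(3) u u' by auto
      have eq: "zs ! j = x \<longleftrightarrow> j = p" if "j < length zs" for j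
        using nth_eq_iff_index_eq[OF zs(2) that p(1)] p(2) by simp
      have "p \<noteq> i" using i B p by (auto simp: T_def)
      then consider "i < p" | "p < i" by linarith
      then show False
      proof cases
        case 1
        have "\<forall>j\<le>i. zs ! j \<noteq> x" using eq 1 i by auto
        then show False using left xS by blast
      next
        case 2
        have "\<forall>j<length zs. i \<le> j \<longrightarrow> zs ! j \<noteq> x" using eq 2 by auto
        then show False using right xS by blast
      qed
    next
      case False
      then have "zs ! j \<noteq> x" if "j < length zs" for j using that by auto
      then have "\<forall>j\<le>i. zs ! j \<noteq> x" "\<forall>j<length zs. i \<le> j \<longrightarrow> zs ! j \<noteq> x" using i by auto
      then show False using left right ne by blast
    qed
  qed
  have TS: "S - {x} \<subseteq> T" "S - {x} \<noteq> {}" using S[of x] by (auto simp: T_def cut_connected_def)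
  show ?thesis
    unfolding cut_connected_def T_def[symmetric]
  proof (intro conjI allI impI)
    show "T \<noteq> {}" using TS by blast
    fix A assume A: "A \<subseteq> T" "A \<noteq> {} \<and> A \<noteq> T"
    show "\<exists>v\<in>A. \<exists>w\<in>T - A. v \<rightarrow>\<^bsub>G\<^esub> w"
    proof (rule ccontr)
      assume no: "\<not> ?thesis"
      consider "A \<inter> (S - {x}) = {}" | "S - {x} \<subseteq> A" | "A \<inter> (S - {x}) \<noteq> {}" "\<not> S - {x} \<subseteq> A" by blast
      then show False
      proof cases
        case 1
        then have "A \<subseteq> set zs" using A by (auto simp: T_def)
        then show False using no_part[of A] A no by blast
      next
        case 2
        then have "T - A \<subseteq> set zs" by (auto simp: T_def)
        moreover have "T - A \<noteq> {}" using A by blast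
        moreover have "w \<in> T - A" if "v \<in> T - A" "w \<in> T" "v \<rightarrow>\<^bsub>G\<^esub> w" for v w
          using no symD[OF that(3)] that by blast
        ultimately show False using no_part[of "T - A"] by blast
      next
        case 3
        then have "A \<inter> (S - {x}) \<noteq> S - {x}" by blast
        then have "\<exists>v\<in>A \<inter> (S - {x}). \<exists>w\<in>S - {x} - (A \<inter> (S - {x})). v \<rightarrow>\<^bsub>G\<^esub> w"
          using S[of x] 3 unfolding cut_connected_def by (meson inf_le2)
        then show False using no TS by blast
      qed
    qed
  qed
qed

lemma cut_connected_pair:
  assumes sym: "symmetric G" and uv: "u \<rightarrow>\<^bsub>G\<^esub> v" "u \<noteq> v"
  shows "cut_connected G ({u, v} - {x})"
  unfolding cut_connected_def
proof (intro conjI allI impI)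
  show "{u, v} - {x} \<noteq> {}" using uv(2) by blast
  have vu: "v \<rightarrow>\<^bsub>G\<^esub> u" using sym uv(1) by (auto simp: symmetric_def sym_def)
  fix A assume A: "A \<subseteq> {u, v} - {x}" "A \<noteq> {} \<and> A \<noteq> {u, v} - {x}"
  then obtain a c where ac: "a \<in> A" "c \<in> {u, v} - {x} - A" by blast
  then have "a = u \<and> c = v \<or> a = v \<and> c = u" using A(1) by blast
  then have "a \<rightarrow>\<^bsub>G\<^esub> c" using uv(1) vu by blast
  then show "\<exists>a\<in>A. \<exists>c\<in>{u, v} - {x} - A. a \<rightarrow>\<^bsub>G\<^esub> c" using ac by blast
qed

context canonical_plane
begin

definition chords :: "nat \<Rightarrow> 'b list" where
  "chords k = (SOME es. chords_of k es)"

text \<open>The face between two consecutive chords is on the left of the later one. The first chord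
  is dropped because the face on its left is outside the group.\<close>

definition DG :: "nat \<Rightarrow> 'b set list" where
  "DG k = map lf (tl (chords k))"

lemma chain_not_last: "\<lbrakk>k < K; length (Vs ! k) \<noteq> 1\<rbrakk> \<Longrightarrow> k < K - 1"
  using last_group by (cases "k = K - 1") auto

lemma chords:
  assumes k: "1 \<le> k" "k < K"
  shows "chords_of k (chords k)"
proof -
  have "\<exists>es. chords_of k es"
  proof (cases "length (Vs ! k) = 1")
    case True
    then obtain z where "Vs ! k = [z]" by (auto simp: length_Suc_conv)
    then show ?thesis using singleton_chords[OF k] by blast
  next
    case False
    then show ?thesis using chain_chords[OF k(1) chain_not_last[OF k(2) False] False] by metis
  qed
  then show ?thesis unfolding chords_def by (rule someI_ex)
qed

lemma chordsD:
  assumes k: "1 \<le> k" "k < K"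
  shows "2 \<le> length (chords k)" "distinct (chords k)"
    and "a \<in> set (chords k) \<longleftrightarrow> a \<in> arcs G \<and> grp (tail G a) = k \<and> grp (head G a) < k \<and> a \<noteq> arev b"
    and "Suc i < length (chords k) \<Longrightarrow> lf (arev (chords k ! i)) = lf (chords k ! Suc i)"
    and "distinct (DG k)"
    and "set (DG k) = {F \<in> faces G arev cw. sg F = k} - {fo, f2}"
    and "lf (hd (chords k)) \<notin> set (DG k)" "lf (arev (last (chords k))) \<notin> set (DG k)"
    and "lf (hd (chords k)) \<noteq> lf (arev (last (chords k)))"
    and "length (Vs ! k) \<noteq> 1 \<Longrightarrow> length (chords k) = 2"
    and "length (Vs ! k) \<noteq> 1 \<Longrightarrow> tail G (hd (chords k)) = last (Vs ! k)"
    and "length (Vs ! k) \<noteq> 1 \<Longrightarrow> tail G (last (chords k)) = hd (Vs ! k)"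
    and "length (Vs ! k) \<noteq> 1 \<Longrightarrow> head G (hd (chords k)) \<noteq> head G (last (chords k))"
    and "\<lbrakk>length (Vs ! k) \<noteq> 1; a \<in> arcs G; Suc i < length (Vs ! k); tail G a = Vs ! k ! Suc i;
      head G a = Vs ! k ! i\<rbrakk> \<Longrightarrow> lf a = lf (last (chords k))"
proof -
  note c1 = chords[OF k, unfolded chords_of_def]
  note c2 = c1[THEN conjunct2] note c3 = c2[THEN conjunct2] note c4 = c3[THEN conjunct2]
  note c5 = c4[THEN conjunct2] note c6 = c5[THEN conjunct2] note c7 = c6[THEN conjunct2]
  note c8 = c7[THEN conjunct2] note c9 = c8[THEN conjunct2] note c10 = c9[THEN conjunct2]
  have DG: "lf ` set (tl (chords k)) = set (DG k)" by (simp add: DG_def)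
  show "2 \<le> length (chords k)" by (rule c1[THEN conjunct1])
  show "distinct (chords k)" by (rule c2[THEN conjunct1])
  show "a \<in> set (chords k) \<longleftrightarrow> a \<in> arcs G \<and> grp (tail G a) = k \<and> grp (head G a) < k \<and> a \<noteq> arev b"
    unfolding c3[THEN conjunct1] by (rule mem_Collect_eq)
  show "lf (arev (chords k ! i)) = lf (chords k ! Suc i)" if "Suc i < length (chords k)"
    using c4[THEN conjunct1] that by blast
  show "distinct (DG k)" unfolding DG_def by (rule c5[THEN conjunct1])
  show "set (DG k) = {F \<in> faces G arev cw. sg F = k} - {fo, f2}" by (rule c6[THEN conjunct1, unfolded DG])
  show "lf (hd (chords k)) \<notin> set (DG k)" by (rule c7[THEN conjunct1, unfolded DG])
  show "lf (arev (last (chords k))) \<notin> set (DG k)" by (rule c8[THEN conjunct1, unfolded DG])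
  show "lf (hd (chords k)) \<noteq> lf (arev (last (chords k)))" by (rule c9[THEN conjunct1])
  show "length (Vs ! k) \<noteq> 1 \<Longrightarrow> length (chords k) = 2"
    "length (Vs ! k) \<noteq> 1 \<Longrightarrow> tail G (hd (chords k)) = last (Vs ! k)"
    "length (Vs ! k) \<noteq> 1 \<Longrightarrow> tail G (last (chords k)) = hd (Vs ! k)"
    "length (Vs ! k) \<noteq> 1 \<Longrightarrow> head G (hd (chords k)) \<noteq> head G (last (chords k))" using c10 by simp_all
  show "\<lbrakk>length (Vs ! k) \<noteq> 1; a \<in> arcs G; Suc i < length (Vs ! k); tail G a = Vs ! k ! Suc i;
      head G a = Vs ! k ! i\<rbrakk> \<Longrightarrow> lf a = lf (last (chords k))" using c10 by blast
qed

lemma chords_ends: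
  assumes k: "1 \<le> k" "k < K"
  shows "hd (chords k) = chords k ! 0" "last (chords k) = chords k ! (length (chords k) - 1)"
    "hd (chords k) \<in> set (chords k)" "last (chords k) \<in> set (chords k)" "chords k \<noteq> []"
proof -
  show "chords k \<noteq> []" using chordsD(1)[OF k] by auto
  then show "hd (chords k) = chords k ! 0" "last (chords k) = chords k ! (length (chords k) - 1)"
    "hd (chords k) \<in> set (chords k)" "last (chords k) \<in> set (chords k)"
    by (simp_all add: hd_conv_nth last_conv_nth)
qed

lemma DG_nth: "Suc i < length (chords k) \<Longrightarrow> DG k ! i = lf (chords k ! Suc i)"
  by (simp add: DG_def nth_tl)

lemma length_DG: "length (DG k) = length (chords k) - 1"
  by (simp add: DG_def)

lemma group_eq_singleton: "\<lbrakk>k < K; length (Vs ! k) = 1; u \<in> verts G; v \<in> verts G; grp u = k; grp v = k\<rbrakk> \<Longrightarrow> u = v"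
  using grp_mem[of u] grp_mem[of v] by (auto simp: length_Suc_conv)

section \<open>The faces on the two sides of an edge\<close>

lemma leave_unique:
  assumes k: "1 \<le> k" "k < K" and a: "a \<in> arcs G" "grp (tail G a) = k" "grp (head G a) < k"
    and a': "a' \<in> arcs G" "grp (tail G a') = k" and eq: "head G a = head G a'"
  shows "a = a'"
proof (cases "length (Vs ! k) = 1")
  case True
  then have "tail G a = tail G a'"
    using group_eq_singleton[OF k(2) True tail_in_verts[OF a(1)] tail_in_verts[OF a'(1)] a(2) a'(2)] by blast
  then show ?thesis using same_ends a a' eq by blast
next
  case False
  have "grp (tail G (arev b)) \<noteq> k" using chain_not_last[OF k(2) False] b arcs_rb grp_v by simp
  then have "a \<in> set (chords k)" "a' \<in> set (chords k)" using chordsD(3)[OF k] a a' eq by auto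
  moreover obtain x y where "chords k = [x, y]"
    using chordsD(10)[OF k False] by (auto simp: length_Suc_conv numeral_2_eq_2)
  ultimately show ?thesis using chordsD(13)[OF k False] eq by auto
qed

text \<open>Returning to the top group at once would need a second edge from that group to the
  vertex just reached. By \<open>leave_unique\<close> it would be the same edge, with the face on
  both its sides. \<open>entry_arc\<close> is the mirror image.\<close>

lemma exit_arc:
  assumes x: "x \<in> arcs G" "grp (tail G x) = sg (lf x)" "grp (head G x) < sg (lf x)"
  shows "grp (head G (nxt x)) < sg (lf x)"
proof (rule ccontr)
  assume "\<not> ?thesis"
  then have "grp (head G (nxt x)) = sg (lf x)" using sg_head[of "nxt x" x] by simp
  then have "x = arev (nxt x)"
    using leave_unique[OF sg_pos[OF x(1)] sg_less[OF x(1)] x, of "arev (nxt x)"] x by simp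
  then have "nxt x = arev x" by (metis arev_arev)
  then show False using lf_arev_neq[OF x(1)] lf_nxt[of x] by metis
qed

lemma entry_arc:
  assumes x: "x \<in> arcs G" "grp (head G x) = sg (lf x)" "grp (tail G x) < sg (lf x)"
  shows "grp (tail G (cwd x)) < sg (lf x)"
proof (rule ccontr)
  assume "\<not> ?thesis"
  then have "grp (tail G (cwd x)) = sg (lf x)" using sg_tail[of "cwd x" x] x(1) in_lf_iff[of "cwd x" x] by simp
  then have "arev x = cwd x"
    using leave_unique[OF sg_pos[OF x(1)] sg_less[OF x(1)], of "arev x" "cwd x"] x head_cwd[OF x(1)] by simp
  then show False using lf_arev_neq[OF x(1)] lf_cwd[of x] by metis
qed

lemma leaving_inner:
  assumes k: "1 \<le> k" "k < K" and a: "a \<in> set (chords k)"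
  shows "lf a \<in> set (DG k) \<or> lf (arev a) \<in> set (DG k)"
proof -
  obtain i where i: "i < length (chords k)" "a = chords k ! i" using a by (auto simp: in_set_conv_nth)
  show ?thesis
  proof (cases i)
    case 0
    then have "lf (arev a) = DG k ! 0" using chordsD(4)[OF k, of 0] chordsD(1)[OF k] i DG_nth[of 0 k] by simp
    then show ?thesis using chordsD(1)[OF k] length_DG[of k] by simp
  next
    case (Suc j)
    then have "lf a = DG k ! j" using i DG_nth[of j k] by simp
    then show ?thesis using i Suc length_DG[of k] by simp
  qed
qed

lemma DG_sg: "\<lbrakk>1 \<le> k; k < K; F \<in> set (DG k)\<rbrakk> \<Longrightarrow> sg F = k \<and> F \<in> faces G arev cw \<and> F \<noteq> fo \<and> F \<noteq> f2"
  using chordsD(6) by auto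

text \<open>Of the two arcs of a chain edge, the one against the clockwise listing has the face of
  the group on its left.\<close>

lemma intra_arc:
  assumes k: "1 \<le> k" "k < K" and q: "q \<in> arcs G" "grp (tail G q) = k" "grp (head G q) = k"
  obtains a where "a = q \<or> a = arev q" "length (Vs ! k) \<noteq> 1" "a \<in> arcs G" "DG k = [lf a]"
    "grp (tail G a) = k" "grp (head G a) = k"
proof -
  have nz: "length (Vs ! k) \<noteq> 1"
    using group_eq_singleton[OF k(2) _ tail_in_verts[OF q(1)] head_in_verts[OF q(1)] q(2,3)] no_loops[OF q(1)] by blast
  obtain i where i: "i < length (Vs ! k)" "Vs ! k ! i = tail G q"
    using grp_mem[OF tail_in_verts[OF q(1)]] q(2) by (auto simp: in_set_conv_nth)
  obtain j where j: "j < length (Vs ! k)" "Vs ! k ! j = head G q"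
    using grp_mem[OF head_in_verts[OF q(1)]] q(3) by (auto simp: in_set_conv_nth)
  have "Vs ! k ! i \<rightarrow>\<^bsub>G\<^esub> Vs ! k ! j" using in_arcs_imp_in_arcs_ends[OF q(1)] i j by simp
  then have ij: "j = Suc i \<or> i = Suc j"
    using chain_props(2)[OF k(1) chain_not_last[OF k(2) nz] nz i(1) j(1)] by simp
  obtain x y where "chords k = [x, y]"
    using chordsD(10)[OF k nz] by (auto simp: length_Suc_conv numeral_2_eq_2)
  then have D: "DG k = [lf (last (chords k))]" by (simp add: DG_def)
  show thesis
  proof (cases "i = Suc j")
    case True
    then show thesis using that[of q] chordsD(14)[OF k nz q(1), of j] i j D nz q by simp
  next
    case False
    then show thesis using that[of "arev q"] chordsD(14)[OF k nz, of "arev q" i] ij i j D nz q by simp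
  qed
qed

text \<open>The edge is either a chord, with a face of \<open>DG k\<close> on one side, or a chain
  edge, which borders the single face of its group. \<open>k < K - 1\<close> keeps out
  \<open>arev b\<close>, which is no chord.\<close>

lemma inner_side:
  assumes k: "1 \<le> k" "k < K - 1" and q: "q \<in> arcs G" "grp (tail G q) \<le> k" "grp (head G q) \<le> k"
    "grp (tail G q) = k \<or> grp (head G q) = k"
  shows "sg (lf q) = k \<or> sg (lf (arev q)) = k"
proof -
  have k': "k < K" using k by simp
  have nb: "grp (tail G (arev b)) \<noteq> k" using b arcs_rb grp_v k by simp
  have *: "sg (lf a) = k \<or> sg (lf (arev a)) = k" if "a \<in> arcs G" "grp (tail G a) = k" "grp (head G a) < k" for a
  proof -
    have "a \<in> set (chords k)" using chordsD(3)[OF k(1) k'] that nb by auto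
    then show ?thesis using leaving_inner[OF k(1) k'] DG_sg[OF k(1) k'] by blast
  qed
  consider "grp (tail G q) = k" "grp (head G q) = k" | "grp (tail G q) = k" "grp (head G q) < k"
    | "grp (head G q) = k" "grp (tail G q) < k" using q by linarith
  then show ?thesis
  proof cases
    case 1
    then obtain a where "a = q \<or> a = arev q" "DG k = [lf a]" using intra_arc[OF k(1) k' q(1)] by metis
    then show ?thesis using DG_sg[OF k(1) k', of "lf a"] by auto
  next
    case 2
    then show ?thesis using * q by blast
  next
    case 3
    then show ?thesis using *[of "arev q"] q by auto
  qed
qed

text \<open>
  \<open>dg F\<close> is the position of the group of \<open>F\<close> in the dual ordering, and \<open>vs\<close>, the inner face at the
  edge from \<open>v\<^sub>1\<close> to \<open>v\<^sub>2\<close>, is its last vertex.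
\<close>

definition dg :: "'b set \<Rightarrow> nat" where
  "dg F = (if F = fo \<or> F = f2 then 0 else K - sg F)"

definition vs :: "'b set" where "vs = lf (arev r)"

lemma sg_face: "F \<in> faces G arev cw \<Longrightarrow> 1 \<le> sg F \<and> sg F < K"
  using sg_pos sg_less by (auto elim: faceE)

lemma group_0_arc: "\<lbrakk>a \<in> arcs G; grp (tail G a) = 0; grp (head G a) = 0\<rbrakk> \<Longrightarrow> a = r \<or> a = arev r"
proof -
  assume a: "a \<in> arcs G" "grp (tail G a) = 0" "grp (head G a) = 0"
  then consider "tail G a = v1" "head G a = v2" | "tail G a = v2" "head G a = v1"
    using grp_0[OF tail_in_verts[OF a(1)]] grp_0[OF head_in_verts[OF a(1)]] no_loops[OF a(1)] by auto
  then show ?thesis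
  proof cases
    case 1
    then have "a = arev r" by (intro same_ends) (simp_all add: a r arcs_rb)
    then show ?thesis ..
  next
    case 2
    then have "a = r" by (intro same_ends) (simp_all add: a r arcs_rb)
    then show ?thesis ..
  qed
qed

text \<open>Below its top group, a face of this group can only run between \<open>v1\<close> and
  \<open>v2\<close>. That arc is not \<open>r\<close>, which bounds \<open>fo\<close>, so it is
  \<open>arev r\<close>, and distinctness leaves one face.\<close>

lemma DG_1: "DG 1 = [vs]"
proof -
  have k: "1 \<le> (1::nat)" "1 < K" using K3 by auto
  have D: "F = vs" if F: "F \<in> set (DG 1)" for F
  proof -
    obtain x where x: "x \<in> set (tl (chords 1))" "F = lf x" using F by (auto simp: DG_def)
    then have "x \<in> set (chords 1)" using chords_ends(5)[OF k] list.set_sel(2) by metis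
    then have x1: "x \<in> arcs G" "grp (tail G x) = 1" "grp (head G x) < 1" using chordsD(3)[OF k] by auto
    have sgF: "sg (lf x) = 1" "lf x \<noteq> fo" using DG_sg[OF k F] x by auto
    have "grp (head G (nxt x)) = 0" using exit_arc[of x] x1 sgF by simp
    then have "nxt x = r \<or> nxt x = arev r" using group_0_arc[of "nxt x"] x1 by simp
    moreover have "nxt x \<noteq> r"
    proof
      assume "nxt x = r"
      then have "lf x = fo" using lf_nxt[of x] arcs_rb(3) by (simp only:)
      then show False using sgF(2) by contradiction
    qed
    ultimately have "nxt x = arev r" by blast
    then show ?thesis using lf_nxt[of x] x(2) by (simp only: vs_def)
  qed
  have "length (DG 1) = card (set (DG 1))" using chordsD(5)[OF k] by (simp add: distinct_card)
  also have "\<dots> \<le> card {vs}" using D by (intro card_mono) auto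
  finally have "length (DG 1) = 1" using length_DG[of 1] chordsD(1)[OF k] by simp
  then show ?thesis using D[of "hd (DG 1)"] by (cases "DG 1") auto
qed

lemma sg_vs: "sg vs = 1" and dg_vs: "dg vs = K - 1"
proof -
  have k: "1 \<le> (1::nat)" "1 < K" using K3 by auto
  show "sg vs = 1" "dg vs = K - 1"
    using DG_sg[OF k, of vs] DG_1 by (auto simp: dg_def)
qed

lemma dg_fo: "dg fo = 0" "dg f2 = 0" by (simp_all add: dg_def)

lemma dg_le: "F \<in> faces G arev cw \<Longrightarrow> dg F \<le> K - sg F"
  by (simp add: dg_def)

lemma dg_DG: "\<lbrakk>1 \<le> k; k < K; F \<in> set (DG k)\<rbrakk> \<Longrightarrow> dg F = K - k"
  using DG_sg[of k F] by (auto simp: dg_def)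

text \<open>By \<open>inner_side\<close>, an edge below the top group of a face has on its other
  side a face with a lower top, hence in a later dual group. The exception \<open>arev r\<close>
  leads to \<open>fo\<close>, at position 0.\<close>

lemma noncap:
  assumes x: "x \<in> arcs G" "grp (tail G x) < sg (lf x)" "grp (head G x) < sg (lf x)" and nf: "lf x \<noteq> fo"
  shows "dg (lf x) < dg (lf (arev x)) \<or> x = arev r"
proof -
  define m where "m = max (grp (tail G x)) (grp (head G x))"
  have ms: "m < sg (lf x)" using x by (simp add: m_def)
  show ?thesis
  proof (cases "m = 0")
    case True
    then have "x = r \<or> x = arev r" using group_0_arc[OF x(1)] by (simp add: m_def)
    then show ?thesis using nf arcs_rb by auto
  next
    case False
    have mK: "m < K - 1" using ms sg_less[OF x(1)] by simp
    have "sg (lf x) = m \<or> sg (lf (arev x)) = m"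
      by (rule inner_side[OF _ mK x(1)]) (use False in \<open>auto simp: m_def\<close>)
    then have g: "sg (lf (arev x)) = m" using ms by simp
    then have "lf (arev x) \<noteq> fo" "lf (arev x) \<noteq> f2" using sg_fo sg_f2 mK by auto
    then have "dg (lf (arev x)) = K - m" using g by (simp add: dg_def)
    moreover have "dg (lf x) \<le> K - sg (lf x)" using dg_le x(1) by simp
    ultimately show ?thesis using ms sg_less[OF x(1)] by linarith
  qed
qed

lemma outer_dg:
  assumes k: "1 \<le> k" "k < K" and a: "a \<in> arcs G" "grp (tail G a) = k" "lf a \<notin> set (DG k)"
  shows "dg (lf a) < K - k"
proof -
  have "k \<le> sg (lf a)" using sg_tail[OF lf_self a(1)] a(2) by simp
  moreover have "sg (lf a) \<noteq> k \<or> lf a = fo \<or> lf a = f2" using a(1,3) chordsD(6)[OF k] by auto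
  ultimately show ?thesis using k(2) sg_less[OF a(1)] by (auto simp: dg_def)
qed

text \<open>These are the two faces at which the ear \<open>DG k\<close> is attached to the earlier
  dual groups.\<close>

lemma chords_outer:
  assumes k: "1 \<le> k" "k < K"
  shows "dg (lf (hd (chords k))) < K - k" "dg (lf (arev (last (chords k)))) < K - k"
proof -
  have h: "hd (chords k) \<in> arcs G" "grp (tail G (hd (chords k))) = k"
    using chords_ends(3)[OF k] chordsD(3)[OF k] by auto
  show "dg (lf (hd (chords k))) < K - k" by (rule outer_dg[OF k h chordsD(7)[OF k]])
  have l: "last (chords k) \<in> arcs G" "grp (tail G (last (chords k))) = k"
    using chords_ends(4)[OF k] chordsD(3)[OF k] by auto
  have "dg (lf (cw (last (chords k)))) < K - k"
    by (rule outer_dg[OF k]) (use l chordsD(8)[OF k] in \<open>auto simp: lf_cw\<close>)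
  then show "dg (lf (arev (last (chords k)))) < K - k" by (simp add: lf_cw)
qed

definition Vd :: "'b set list list" where
  "Vd = [fo, f2] # map DG (rev [1..<K])"

lemma length_Vd: "length Vd = K" using K3 by (simp add: Vd_def)

lemma Vd_0: "Vd ! 0 = [fo, f2]" by (simp add: Vd_def)

lemma Vd_nth: "\<lbrakk>1 \<le> k; k < K\<rbrakk> \<Longrightarrow> Vd ! k = DG (K - k)"
proof -
  assume k: "1 \<le> k" "k < K"
  then have "Vd ! k = DG (rev [1..<K] ! (k - 1))" by (simp add: Vd_def nth_Cons')
  also have "rev [1..<K] ! (k - 1) = K - k" using k by (simp add: rev_nth)
  finally show ?thesis .
qed

lemma fo_neq_f2: "fo \<noteq> f2"
  using lf_arev_neq[of b] arcs_rb by (simp add: f2_def)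

lemma f2_face: "f2 \<in> faces G arev cw" using arcs_rb by (simp add: f2_def)

lemma Vd_mem:
  assumes "k < K"
  shows "F \<in> set (Vd ! k) \<longleftrightarrow> F \<in> faces G arev cw \<and> dg F = k"
proof (cases "k = 0")
  case True
  then show ?thesis using Vd_0 fo f2_face sg_face[of F] by (auto simp: dg_def)
next
  case False
  then have kk: "1 \<le> K - k" "K - k < K" "1 \<le> k" using assms by auto
  then have "set (Vd ! k) = {F \<in> faces G arev cw. sg F = K - k} - {fo, f2}"
    using Vd_nth[OF kk(3) assms] chordsD(6)[OF kk(1,2)] by simp
  moreover have "sg F = K - k \<and> F \<noteq> fo \<and> F \<noteq> f2 \<longleftrightarrow> dg F = k" if "F \<in> faces G arev cw"
  proof (cases "F = fo \<or> F = f2")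
    case True
    then show ?thesis using kk(3) unfolding dg_def by auto
  next
    case False
    then show ?thesis using sg_face[OF that] assms unfolding dg_def by auto
  qed
  ultimately show ?thesis by blast
qed

lemma dg_less: "F \<in> faces G arev cw \<Longrightarrow> dg F < K"
  using sg_face[of F] by (auto simp: dg_def)

lemma distinct_Vd: "distinct (concat Vd)"
proof (rule distinct_concat)
  have ne: "Vd ! k \<noteq> []" if "k < K" for k
  proof (cases "k = 0")
    case False
    then have "1 \<le> K - k" "K - k < K" "1 \<le> k" using that by auto
    then show ?thesis using Vd_nth[of k] length_DG[of "K - k"] chordsD(1)[of "K - k"] that by auto
  qed (simp add: Vd_0)
  show "distinct Vd"
    unfolding distinct_conv_nth length_Vd
  proof (intro allI impI notI)
    fix i j assume ij: "i < K" "j < K" "i \<noteq> j" "Vd ! i = Vd ! j"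
    obtain F where "F \<in> set (Vd ! i)" using ne[OF ij(1)] by (meson last_in_set)
    then show False using Vd_mem[OF ij(1)] Vd_mem[OF ij(2)] ij by metis
  qed
  fix ys assume "ys \<in> set Vd"
  then obtain k where k: "k < K" "ys = Vd ! k" by (auto simp: in_set_conv_nth length_Vd)
  show "distinct ys"
  proof (cases "k = 0")
    case True
    then show ?thesis using k Vd_0 fo_neq_f2 by simp
  next
    case False
    then have "1 \<le> K - k" "K - k < K" "1 \<le> k" using k by auto
    then show ?thesis using k Vd_nth[of k] chordsD(5)[of "K - k"] by simp
  qed
  fix zs assume "zs \<in> set Vd" "ys \<noteq> zs"
  then obtain l where l: "l < K" "zs = Vd ! l" by (auto simp: in_set_conv_nth length_Vd)
  then have "k \<noteq> l" using k(2) \<open>ys \<noteq> zs\<close> by auto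
  then show "set ys \<inter> set zs = {}"
    unfolding disjoint_iff k(2) l(2) Vd_mem[OF k(1)] Vd_mem[OF l(1)] by blast
qed

lemma set_Vd: "set (concat Vd) = faces G arev cw"
  unfolding set_eq_iff in_set_concat_nth length_Vd using Vd_mem dg_less by blast

lemma group_Vd: "F \<in> faces G arev cw \<Longrightarrow> group_index Vd F = dg F"
  using Vd_mem[OF dg_less, of F F] dg_less[of F] by (intro group_indexI[OF distinct_Vd]) (auto simp: length_Vd)

lemma earlier_Vd:
  assumes "k \<le> K"
  shows "earlier Vd k = {F \<in> faces G arev cw. dg F < k}"
proof -
  have "earlier Vd k = {F \<in> set (concat Vd). group_index Vd F < k}"
    using assms by (intro earlier_conv[OF distinct_Vd]) (simp add: length_Vd)
  then show ?thesis by (simp only: set_Vd group_Vd cong: conj_cong)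
qed

lemma later_Vd:
  assumes "k < K"
  shows "later Vd k = {F \<in> faces G arev cw. k < dg F}"
proof -
  have "later Vd k = {F \<in> set (concat Vd). k < group_index Vd F}"
    using assms by (intro later_conv[OF distinct_Vd]) (simp add: length_Vd)
  then show ?thesis by (simp only: set_Vd group_Vd cong: conj_cong)
qed

lemma dual_dominates: "u \<rightarrow>\<^bsub>Dual\<^esub> v \<longleftrightarrow> (\<exists>a\<in>arcs G. lf a = u \<and> lf (arev a) = v)"
  by (auto simp: arcs_ends_conv)

lemma DG_path:
  assumes k: "1 \<le> k" "k < K"
  shows "Suc i < length (DG k) \<Longrightarrow> DG k ! i \<rightarrow>\<^bsub>Dual\<^esub> DG k ! Suc i"
    and "lf (hd (chords k)) \<rightarrow>\<^bsub>Dual\<^esub> hd (DG k)"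
    and "last (DG k) \<rightarrow>\<^bsub>Dual\<^esub> lf (arev (last (chords k)))"
    and "DG k \<noteq> []"
proof -
  have arcs: "e \<in> arcs G" if "e \<in> set (chords k)" for e using that chordsD(3)[OF k] by blast
  have len: "2 \<le> length (chords k)" by (rule chordsD(1)[OF k])
  show ne: "DG k \<noteq> []" using length_DG[of k] len by auto
  show "DG k ! i \<rightarrow>\<^bsub>Dual\<^esub> DG k ! Suc i" if "Suc i < length (DG k)"
    unfolding dual_dominates
    using that length_DG[of k] chordsD(4)[OF k, of "Suc i"] DG_nth[of i k] DG_nth[of "Suc i" k] arcs
    by (intro bexI[of _ "chords k ! Suc i"]) auto
  have "hd (DG k) = lf (chords k ! 1)" using DG_nth[of 0 k] len ne by (simp add: hd_conv_nth)
  then show "lf (hd (chords k)) \<rightarrow>\<^bsub>Dual\<^esub> hd (DG k)"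
    unfolding dual_dominates using chordsD(4)[OF k, of 0] chords_ends[OF k] len arcs
    by (intro bexI[of _ "hd (chords k)"]) auto
  have "last (DG k) = lf (last (chords k))"
    using ne by (simp add: DG_def last_map last_tl)
  then show "last (DG k) \<rightarrow>\<^bsub>Dual\<^esub> lf (arev (last (chords k)))"
    unfolding dual_dominates using chords_ends(4)[OF k] arcs by blast
qed

text \<open>Starting from the edge between \<open>fo\<close> and \<open>f2\<close>, each group is an
  ear whose attachments are distinct and lie in earlier groups. As \<open>x\<close> need not be a
  face, plain connectivity is included.\<close>

lemma dual_cut_connected: "k < K \<Longrightarrow> cut_connected Dual ({F \<in> faces G arev cw. dg F \<le> k} - {x})"
proof (induction k arbitrary: x)
  case 0
  have "{F \<in> faces G arev cw. dg F \<le> 0} = set (Vd ! 0)"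
    by (rule set_eqI) (simp only: mem_Collect_eq le_zero_eq Vd_mem[OF 0])
  then have "{F \<in> faces G arev cw. dg F \<le> 0} = {fo, f2}" by (simp add: Vd_0)
  moreover have "fo \<rightarrow>\<^bsub>Dual\<^esub> f2"
    unfolding dual_dominates by (rule bexI[of _ b]) (simp_all add: arcs_rb f2_def)
  ultimately show ?case using cut_connected_pair[OF sym_dual _ fo_neq_f2] by simp
next
  case (Suc k)
  define S where "S = {F \<in> faces G arev cw. dg F \<le> k}"
  define j where "j = K - Suc k"
  have j: "1 \<le> j" "j < K" "K - j = Suc k" using Suc.prems by (auto simp: j_def)
  have D: "set (DG j) = {F \<in> faces G arev cw. dg F = Suc k}"
    using Vd_mem[OF Suc.prems] Vd_nth[of "Suc k"] Suc.prems by (auto simp: j_def)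
  have "{F \<in> faces G arev cw. dg F \<le> Suc k} = S \<union> set (DG j)" unfolding D by (auto simp: S_def)
  moreover have "cut_connected Dual ((S \<union> set (DG j)) - {x})"
  proof (rule cut_connected_ear[OF sym_dual])
    show "cut_connected Dual (S - {x})" for x using Suc by (simp add: S_def)
    show "set (DG j) \<inter> S = {}" unfolding D by (auto simp: S_def)
    show "lf (hd (chords j)) \<in> S" "lf (arev (last (chords j))) \<in> S"
      using chords_outer[OF j(1,2)] j(3) chords_ends(3,4)[OF j(1,2)] chordsD(3)[OF j(1,2)] by (auto simp: S_def)
  qed (use DG_path[OF j(1,2)] chordsD(5,9)[OF j(1,2)] in auto)
  ultimately show ?case by simp
qed

end

section \<open>The canonical ordering of the dual\<close>

context canonical_plane
begin

lemma earlier_Vd_Suc: "k < K \<Longrightarrow> earlier Vd (Suc k) = {F \<in> faces G arev cw. dg F \<le> k}"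
  using earlier_Vd[of "Suc k"] by (simp add: less_Suc_eq_le)

lemma dg_inner:
  assumes "sg F < K - 1"
  shows "dg F = K - sg F"
proof -
  have "F \<noteq> fo" "F \<noteq> f2" using assms sg_fo sg_f2 by auto
  then show ?thesis by (simp add: dg_def)
qed

lemma empty_not_face: "{} \<notin> faces G arev cw"
  unfolding faces_def using lf_self by (metis empty_iff imageE)

lemma dual_two_connected:
  assumes k: "1 \<le> k" "k < K"
  shows "k_connected 2 (Dual \<restriction> earlier Vd (Suc k))"
proof -
  define S where "S = {F \<in> faces G arev cw. dg F \<le> k}"
  have "DG (K - 1) \<noteq> []" using DG_path(4)[of "K - 1"] K3 by simp
  then obtain F where F: "F \<in> set (Vd ! 1)" using Vd_nth[of 1] K3 by (metis One_nat_def Suc_lessD last_in_set le_refl less_le_trans numeral_3_eq_3 lessI)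
  have F1: "F \<in> faces G arev cw" "dg F = 1" using F Vd_mem[of 1 F] K3 by auto
  have finS: "finite S" unfolding S_def using finite_faces by simp
  have sub: "{fo, f2, F} \<subseteq> S" using F1 k fo f2_face dg_fo by (simp add: S_def)
  have "F \<noteq> fo" "F \<noteq> f2" using F1 dg_fo by auto
  then have "card {fo, f2, F} = 3" using fo_neq_f2 by simp
  then have "3 \<le> card S" using card_mono[OF finS sub] by simp
  moreover have "connected ((Dual \<restriction> S) \<restriction> (S - X))" if X: "X \<subseteq> S" "card X < 2" for X
  proof -
    have "finite X" using X finS finite_subset by blast
    moreover have "card X = 0 \<or> card X = 1" using X(2) by linarith
    ultimately have X': "X = {} \<or> (\<exists>x. X = {x})" by (metis card_0_eq card_1_singletonE)
    have "cut_connected Dual S"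
    proof -
      \<comment> \<open>Deleting the empty set, which is no face, deletes nothing.\<close>
      have "S - {{}} = S" using empty_not_face by (simp add: S_def)
      then show ?thesis using dual_cut_connected[OF k(2), of "{}"] by (simp add: S_def)
    qed
    moreover have "cut_connected Dual (S - {x})" for x
      using dual_cut_connected[OF k(2)] unfolding S_def .
    ultimately have "cut_connected Dual (S - X)" using X' by (metis Diff_empty)
    then show ?thesis
      using connected_induce_iff[OF sym_dual, of "S - X"] by (simp only: induce_induce[OF Diff_subset])
  qed
  ultimately show ?thesis unfolding k_connected_def earlier_Vd_Suc[OF k(2)] S_def[symmetric] by simp
qed

lemma connected_dual: "connected Dual"
proof -
  have "dg F \<le> K - 1" if "F \<in> faces G arev cw" for F using dg_less[OF that] by linarith
  then have "{F \<in> faces G arev cw. dg F \<le> K - 1} - {{}} = faces G arev cw"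
    using empty_not_face by blast
  then have "cut_connected Dual (faces G arev cw)"
    using dual_cut_connected[of "K - 1" "{}"] K3 by simp
  then have "connected (Dual \<restriction> faces G arev cw)" using connected_induce_iff[OF sym_dual] by blast
  moreover have "Dual \<restriction> faces G arev cw = Dual"
    by (auto simp: induce_subgraph_def dual_graph_def right_face_def intro!: lf_in_faces)
  ultimately show ?thesis by simp
qed

text \<open>Translates a cut between groups into a cut of the numbering, as required by
  \<open>cut_orbit\<close>.\<close>

lemma grp_pos_cut:
  assumes j: "j \<le> K" and v: "v \<in> verts G"
  shows "grp v < j \<longleftrightarrow> pos v < length (concat (take j Vs))"
proof -
  note bounds = list_pos_concat_bounds[OF dist grp_less[OF v] grp_mem[OF v]]
  show ?thesis
  proof (cases "grp v < j")
    case True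
    then have "length (concat (take (Suc (grp v)) Vs)) \<le> length (concat (take j Vs))"
      by (intro length_concat_take_mono) simp
    then show ?thesis using True bounds(2) by simp
  next
    case False
    then have "length (concat (take j Vs)) \<le> length (concat (take (grp v) Vs))"
      by (intro length_concat_take_mono) simp
    then show ?thesis using False bounds(1) by simp
  qed
qed

text \<open>Both faces at an edge have tops at least as high as its ends, and one of them has its
  top exactly in the higher group of the two ends. For the edge between \<open>v1\<close> and
  \<open>v2\<close> that face is replaced by \<open>vs\<close>, the last dual vertex.\<close>

lemma dual_arcs:
  assumes k: "1 \<le> k" "k < K - 1"
  shows "arcs (Dual \<restriction> earlier Vd (Suc k)) =
    {a \<in> arcs G. K - k \<le> grp (tail G a) \<or> K - k \<le> grp (head G a)}"
proof -
  have "dg (lf a) \<le> k \<and> dg (lf (arev a)) \<le> k \<longleftrightarrow> K - k \<le> grp (tail G a) \<or> K - k \<le> grp (head G a)"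
    if a: "a \<in> arcs G" for a
  proof
    assume "K - k \<le> grp (tail G a) \<or> K - k \<le> grp (head G a)"
    moreover have "grp (tail G a) \<le> sg (lf a)" "grp (head G a) \<le> sg (lf a)"
      "grp (tail G a) \<le> sg (lf (arev a))" "grp (head G a) \<le> sg (lf (arev a))"
      using sg_tail[of a a] sg_head[of a a] sg_tail[of "arev a" "arev a"] sg_head[of "arev a" "arev a"] a by simp_all
    ultimately show "dg (lf a) \<le> k \<and> dg (lf (arev a)) \<le> k"
      using dg_le[OF lf_in_faces[OF a]] dg_le[OF lf_in_faces[of "arev a"]] a k by fastforce
  next
    assume dg: "dg (lf a) \<le> k \<and> dg (lf (arev a)) \<le> k"
    show "K - k \<le> grp (tail G a) \<or> K - k \<le> grp (head G a)"
    proof (rule ccontr)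
      assume no: "\<not> ?thesis"
      define m where "m = max (grp (tail G a)) (grp (head G a))"
      have m: "m < K - k" using no by (auto simp: m_def)
      show False
      proof (cases "m = 0")
        case True
        then have "a = r \<or> a = arev r" using group_0_arc[OF a] by (simp add: m_def)
        then have "lf a = vs \<or> lf (arev a) = vs" by (auto simp: vs_def)
        then show False using dg dg_vs k by auto
      next
        case False
        have mK: "m < K - 1" using m k by simp
        have "sg (lf a) = m \<or> sg (lf (arev a)) = m"
          by (rule inner_side[OF _ mK a]) (use False in \<open>auto simp: m_def\<close>)
        then have "dg (lf a) = K - m \<or> dg (lf (arev a)) = K - m"
          using mK dg_inner by metis
        moreover have "k < K - m" using m k by linarith
        ultimately show False using dg by linarith
      qed
    qed
  qed
  then show ?thesis using earlier_Vd_Suc[of k] k by auto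
qed

text \<open>An instance of \<open>cut_orbit\<close> for the cut below the last \<open>k\<close>
  groups. The reference arc \<open>arev b\<close>, from \<open>vn\<close> to \<open>v1\<close>,
  crosses every such cut.\<close>

lemma dual_outer_face:
  assumes k: "1 \<le> k" "k < K - 1"
  shows "left_face arev (induced_cw cwd (arcs (Dual \<restriction> earlier Vd (Suc k)))) (arev b) =
    {a \<in> arcs G. grp (head G a) < K - k \<and> K - k \<le> grp (tail G a)}"
proof -
  define n where "n = length (concat (take (K - k) Vs))"
  have cut: "grp v < K - k \<longleftrightarrow> pos v < n" if "v \<in> verts G" for v
    using grp_pos_cut[of "K - k"] that by (simp add: n_def)
  have A: "arcs (Dual \<restriction> earlier Vd (Suc k)) = {a \<in> arcs G. n \<le> pos (tail G a) \<or> n \<le> pos (head G a)}"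
    unfolding dual_arcs[OF k] using cut by (auto simp flip: not_less)
  have B: "{a \<in> arcs G. grp (head G a) < K - k \<and> K - k \<le> grp (tail G a)} =
      {a \<in> arcs G. pos (head G a) < n \<and> n \<le> pos (tail G a)}"
    using cut by (auto simp flip: not_less)
  have "0 < K - k" "K - k \<le> K - 1" using k by linarith+
  then have "arev b \<in> {a \<in> arcs G. grp (head G a) < K - k \<and> K - k \<le> grp (tail G a)}"
    using arcs_rb(2) b grp_v by simp
  then show ?thesis unfolding A B by (rule cut_orbit)
qed

text \<open>The full dual also contains the edge between \<open>v1\<close> and \<open>v2\<close>, so
  this time the cut isolates \<open>v1\<close> alone.\<close>

lemma dual_outer_face_last:
  "left_face arev (induced_cw cwd (arcs (Dual \<restriction> earlier Vd K))) (arev b) = {a \<in> arcs G. head G a = v1}"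
proof -
  have v1_iff: "pos v < 1 \<longleftrightarrow> v = v1" if "v \<in> verts G" for v
    using pos_eqD[OF that grp_v(4)] pos_v1 by auto
  have eK: "earlier Vd K = faces G arev cw" unfolding earlier_Vd[OF order_refl] using dg_less by blast
  have arcs_K: "arcs (Dual \<restriction> earlier Vd K) = arcs G"
    unfolding eK induce_subgraph_arcs by (simp cong: conj_cong)
  have one: "1 \<le> pos v \<longleftrightarrow> v \<noteq> v1" if "v \<in> verts G" for v using v1_iff[OF that] by linarith
  have A: "arcs (Dual \<restriction> earlier Vd K) = {a \<in> arcs G. 1 \<le> pos (tail G a) \<or> 1 \<le> pos (head G a)}"
  proof -
    have "1 \<le> pos (tail G a) \<or> 1 \<le> pos (head G a)" if a: "a \<in> arcs G" for a
    proof (cases "tail G a = v1")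
      case True
      then have "head G a \<noteq> v1" using no_loops[OF a] by simp
      then show ?thesis using one[OF head_in_verts[OF a]] by simp
    next
      case False
      then show ?thesis using one[OF tail_in_verts[OF a]] by simp
    qed
    then show ?thesis unfolding arcs_K by blast
  qed
  have B: "{a \<in> arcs G. head G a = v1} = {a \<in> arcs G. pos (head G a) < 1 \<and> 1 \<le> pos (tail G a)}"
  proof -
    have "head G a = v1 \<longleftrightarrow> pos (head G a) < 1 \<and> 1 \<le> pos (tail G a)" if "a \<in> arcs G" for a
      unfolding v1_iff[OF head_in_verts[OF that]] one[OF tail_in_verts[OF that]] using no_loops[OF that] by metis
    then show ?thesis by blast
  qed
  have "arev b \<in> {a \<in> arcs G. head G a = v1}" using arcs_rb b by simp
  then show ?thesis unfolding A B by (rule cut_orbit)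
qed

text \<open>Arcs of the face that stay below the group lead to later dual groups by
  \<open>noncap\<close>; the exception \<open>arev r\<close> lies on \<open>vs\<close> and is
  excluded by \<open>2 \<le> j\<close>. What remains are edges at the vertex of the group. The first
  chord and the reversed last chord drop out because the faces on their left are outside
  \<open>DG j\<close>.\<close>

lemma cap_arc:
  assumes j: "2 \<le> j" "j < K" "length (Vs ! j) = 1" and a: "a \<in> arcs G" "lf a \<in> set (DG j)"
    and dg: "dg (lf (arev a)) \<le> K - j"
  obtains (down) p where "Suc p < length (chords j)" "a = chords j ! Suc p"
    | (up) p where "Suc p < length (chords j)" "a = arev (chords j ! p)"
proof -
  have j1: "1 \<le> j" using j by simp
  note D = DG_sg[OF j1 j(2) a(2)]
  have le: "grp (tail G a) \<le> j" "grp (head G a) \<le> j" using sg_tail[of a a] sg_head[of a a] a D by simp_all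
  have "\<not> (grp (tail G a) < j \<and> grp (head G a) < j)"
  proof
    assume "grp (tail G a) < j \<and> grp (head G a) < j"
    then have "dg (lf a) < dg (lf (arev a)) \<or> a = arev r" using noncap[OF a(1)] D by simp
    moreover have "dg (lf a) = K - j" by (rule dg_DG[OF j1 j(2) a(2)])
    ultimately have "lf a = vs" using dg by (auto simp: vs_def)
    then show False using D sg_vs j by simp
  qed
  moreover have "\<not> (grp (tail G a) = j \<and> grp (head G a) = j)"
    using group_eq_singleton[OF j(2,3) tail_in_verts[OF a(1)] head_in_verts[OF a(1)]] no_loops[OF a(1)] by blast
  ultimately consider "grp (tail G a) = j" "grp (head G a) < j" | "grp (head G a) = j" "grp (tail G a) < j"
    using le by linarith
  then show thesis
  proof cases
    case 1
    have "a \<noteq> arev b" using D by (auto simp: f2_def)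
    then have "a \<in> set (chords j)" using chordsD(3)[OF j1 j(2)] a 1 by simp
    then obtain q where q: "q < length (chords j)" "a = chords j ! q" by (auto simp: in_set_conv_nth)
    have "q \<noteq> 0" using chordsD(7)[OF j1 j(2)] chords_ends(1)[OF j1 j(2)] a(2) q(2) by (cases q) auto
    then show thesis using down[of "q - 1"] q by simp
  next
    case 2
    have "a \<noteq> b" using D arcs_rb by auto
    then have "arev a \<in> set (chords j)" using chordsD(3)[OF j1 j(2)] a 2 by simp
    then obtain q where q: "q < length (chords j)" "arev a = chords j ! q" by (auto simp: in_set_conv_nth)
    have aq: "a = arev (chords j ! q)" by (simp flip: q(2))
    have "q \<noteq> length (chords j) - 1"
    proof
      assume "q = length (chords j) - 1"
      then have "a = arev (last (chords j))" using aq chords_ends(2)[OF j1 j(2)] by simp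
      then show False using chordsD(8)[OF j1 j(2)] a(2) by simp
    qed
    then have "Suc q < length (chords j)" using q(1) by linarith
    then show thesis using up aq by blast
  qed
qed

lemma exit_noncap:
  assumes j: "1 \<le> j" "j < K" and e: "e \<in> set (chords j)" "lf e \<in> set (DG j)"
  shows "dg (lf e) < dg (lf (arev (nxt e))) \<or> nxt e = arev r"
proof -
  have e': "e \<in> arcs G" "grp (tail G e) = j" "grp (head G e) < j" using e chordsD(3)[OF j] by auto
  have D: "sg (lf e) = j" "lf e \<noteq> fo" using DG_sg[OF j e(2)] by auto
  have "grp (head G (nxt e)) < j" using exit_arc[of e] e' D by simp
  then show ?thesis using noncap[of "nxt e"] e' D by simp
qed

lemma entry_noncap:
  assumes j: "1 \<le> j" "j < K" and e: "e \<in> set (chords j)" "lf (arev e) \<in> set (DG j)"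
  shows "dg (lf (arev e)) < dg (lf (arev (cwd (arev e)))) \<or> cwd (arev e) = arev r"
proof -
  have e': "e \<in> arcs G" "grp (tail G e) = j" "grp (head G e) < j" using e chordsD(3)[OF j] by auto
  have D: "sg (lf (arev e)) = j" "lf (arev e) \<noteq> fo" using DG_sg[OF j e(2)] by auto
  have "grp (tail G (cwd (arev e))) < j" using entry_arc[of "arev e"] e' D by simp
  moreover have "head G (cwd (arev e)) = head G e" using head_cwd[of "arev e"] e' by simp
  ultimately show ?thesis using noncap[of "cwd (arev e)"] e' D by simp
qed

lemma dual_nbrs: "v \<in> nbrs_in Dual F A \<longleftrightarrow> v \<in> A \<and> (\<exists>a\<in>arcs G. lf a = F \<and> lf (arev a) = v)"
  by (auto simp: nbrs_in_def dual_dominates)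

lemma nth_DG:
  assumes "F \<in> set (DG j)"
  obtains i where "Suc i < length (chords j)" "F = lf (chords j ! Suc i)" "F = DG j ! i" "i < length (DG j)"
proof -
  obtain i where "i < length (DG j)" "F = DG j ! i" using assms by (auto simp: in_set_conv_nth)
  then show thesis using that[of i] length_DG[of j] DG_nth[of i j] by simp
qed

text \<open>After a chord the boundary of the face continues below the group, and crossing it there
  leads to a later dual group. The exception \<open>arev r\<close> lies on \<open>vs\<close>, which
  is not in a group considered here.\<close>

lemma dual_later_nbr:
  assumes k: "1 \<le> k" "k < K - 1" and F: "F \<in> set (DG (K - k))"
  shows "nbrs_in Dual F (later Vd k) \<noteq> {}"
proof -
  define j where "j = K - k"
  have j: "1 \<le> j" "j < K" "2 \<le> j" using k by (auto simp: j_def)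
  obtain i where i: "Suc i < length (chords j)" "F = lf (chords j ! Suc i)"
    using nth_DG F unfolding j_def by metis
  define e where "e = chords j ! Suc i"
  have e: "e \<in> set (chords j)" "lf e \<in> set (DG j)" using i F by (simp_all add: e_def j_def)
  have eG: "e \<in> arcs G" using e chordsD(3)[OF j(1,2)] by simp
  have "nxt e \<noteq> arev r"
  proof
    assume "nxt e = arev r"
    then have "lf e = vs" using lf_nxt[of e] by (simp add: vs_def)
    then show False using DG_sg[OF j(1,2) e(2)] sg_vs j by simp
  qed
  then have "dg (lf e) < dg (lf (arev (nxt e)))" using exit_noncap[OF j(1,2) e] by blast
  moreover have "dg (lf e) = k" using dg_DG[OF j(1,2) e(2)] k by (simp add: j_def)
  ultimately have "lf (arev (nxt e)) \<in> later Vd k" using later_Vd[of k] k eG by simp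
  moreover have "lf (nxt e) = F" using i by (simp add: e_def)
  ultimately have "lf (arev (nxt e)) \<in> nbrs_in Dual F (later Vd k)"
    unfolding dual_nbrs using eG by (intro conjI bexI[of _ "nxt e"]) auto
  then show ?thesis by blast
qed

lemma dual_earlier_nbr:
  assumes k: "1 \<le> k" "k < K"
  shows "lf (hd (chords (K - k))) \<in> nbrs_in Dual (hd (DG (K - k))) (earlier Vd k)"
    and "lf (arev (last (chords (K - k)))) \<in> nbrs_in Dual (last (DG (K - k))) (earlier Vd k)"
proof -
  have j: "1 \<le> K - k" "K - k < K" "K - (K - k) = k" using k by auto
  have h: "hd (chords (K - k)) \<in> arcs G" "last (chords (K - k)) \<in> arcs G"
    using chords_ends(3,4)[OF j(1,2)] chordsD(3)[OF j(1,2)] by auto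
  have sym: "v \<rightarrow>\<^bsub>Dual\<^esub> u" if "u \<rightarrow>\<^bsub>Dual\<^esub> v" for u v
    using sym_dual that by (auto simp: symmetric_def sym_def)
  show "lf (hd (chords (K - k))) \<in> nbrs_in Dual (hd (DG (K - k))) (earlier Vd k)"
    using sym[OF DG_path(2)[OF j(1,2)]] chords_outer(1)[OF j(1,2)] h j(3) earlier_Vd[of k] k
    by (simp add: nbrs_in_def)
  show "lf (arev (last (chords (K - k)))) \<in> nbrs_in Dual (last (DG (K - k))) (earlier Vd k)"
    using DG_path(3)[OF j(1,2)] chords_outer(2)[OF j(1,2)] h j(3) earlier_Vd[of k] k
    by (simp add: nbrs_in_def)
qed

text \<open>At the two ends of the path, the attachment faces stand in for the missing predecessor
  and successor. In this form the statement serves both adjacency within the path and neighbours in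
  earlier groups.\<close>

lemma cap_nbr:
  assumes k: "1 \<le> k" "k < K - 1" "length (Vs ! (K - k)) = 1" and i: "i < length (DG (K - k))"
    and a: "a \<in> arcs G" "lf a = DG (K - k) ! i" "dg (lf (arev a)) \<le> k"
  shows "lf (arev a) = (if i = 0 then lf (hd (chords (K - k))) else DG (K - k) ! (i - 1)) \<or>
    lf (arev a) = (if Suc i = length (DG (K - k)) then lf (arev (last (chords (K - k)))) else DG (K - k) ! Suc i)"
proof -
  define j where "j = K - k"
  have j: "1 \<le> j" "j < K" "2 \<le> j" "K - j = k" "length (Vs ! j) = 1" using k by (auto simp: j_def)
  define es where "es = chords j"
  have len: "length es = Suc (length (DG j))" using length_DG[of j] chordsD(1)[OF j(1,2)] by (simp add: es_def)
  have D: "lf a \<in> set (DG j)" using a(2) i by (simp add: j_def)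
  have index: "p = i" if "Suc p < length es" "lf a = lf (es ! Suc p)" for p
  proof -
    have "DG j ! p = DG j ! i" using that a(2) DG_nth[of p j] by (simp add: es_def j_def)
    moreover have "p < length (DG j)" using that(1) len by simp
    ultimately show ?thesis
      using nth_eq_iff_index_eq[OF chordsD(5)[OF j(1,2)], of p i] i by (simp add: j_def)
  qed
  show ?thesis
    unfolding j_def[symmetric]
  proof (rule cap_arc[OF j(3,2,5) a(1) D])
    show "dg (lf (arev a)) \<le> K - j" using a(3) j(4) by simp
  next
    fix p assume p: "Suc p < length (chords j)" "a = chords j ! Suc p"
    then have ai: "a = es ! Suc i" using index[of p] by (simp add: es_def)
    have "lf (arev a) = (if Suc i = length (DG j) then lf (arev (last es)) else DG j ! Suc i)"
    proof (cases "Suc i = length (DG j)")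
      case True
      then show ?thesis using ai chords_ends(2)[OF j(1,2)] len by (simp add: es_def)
    next
      case False
      then have "Suc (Suc i) < length es" using i len by (simp add: j_def)
      then show ?thesis
        using False ai chordsD(4)[OF j(1,2), of "Suc i"] DG_nth[of "Suc i" j] by (simp add: es_def)
    qed
    then show "lf (arev a) = (if i = 0 then lf (hd (chords j)) else DG j ! (i - 1)) \<or>
      lf (arev a) = (if Suc i = length (DG j) then lf (arev (last (chords j))) else DG j ! Suc i)"
      unfolding es_def by (rule disjI2)
  next
    fix p assume p: "Suc p < length (chords j)" "a = arev (chords j ! p)"
    then have "lf a = lf (es ! Suc p)" using chordsD(4)[OF j(1,2)] by (simp add: es_def)
    then have ai: "arev a = es ! i" using index[of p] p by (simp add: es_def)
    have "lf (arev a) = (if i = 0 then lf (hd es) else DG j ! (i - 1))"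
    proof (cases i)
      case 0
      then show ?thesis using ai chords_ends(1)[OF j(1,2)] by (simp add: es_def)
    next
      case (Suc q)
      then show ?thesis using ai DG_nth[of q j] i len by (simp add: es_def j_def)
    qed
    then show "lf (arev a) = (if i = 0 then lf (hd (chords j)) else DG j ! (i - 1)) \<or>
      lf (arev a) = (if Suc i = length (DG j) then lf (arev (last (chords j))) else DG j ! Suc i)"
      unfolding es_def by (rule disjI1)
  qed
qed

lemma dual_earlier_arc:
  assumes k: "1 \<le> k" "k < K - 1" "length (Vs ! (K - k)) = 1" and i: "i < length (DG (K - k))"
    and v: "v \<in> nbrs_in Dual (DG (K - k) ! i) (earlier Vd k)"
  shows "i = 0 \<and> v = lf (hd (chords (K - k))) \<or>
    Suc i = length (DG (K - k)) \<and> v = lf (arev (last (chords (K - k))))"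
proof -
  have j: "1 \<le> K - k" "K - k < K" "K - (K - k) = k" using k by auto
  obtain a where a: "a \<in> arcs G" "lf a = DG (K - k) ! i" "lf (arev a) = v" and "v \<in> earlier Vd k"
    using v unfolding dual_nbrs by blast
  then have dgv: "dg v < k" using earlier_Vd[of k] k by simp
  then have "v \<noteq> DG (K - k) ! p" if "p < length (DG (K - k))" for p
    using that dg_DG[OF j(1,2), of v] j(3) by auto
  then have "v \<noteq> DG (K - k) ! (i - 1)" "Suc i \<noteq> length (DG (K - k)) \<Longrightarrow> v \<noteq> DG (K - k) ! Suc i"
    using i by simp_all
  then show ?thesis using cap_nbr[OF k i a(1,2)] a(3) dgv by (simp split: if_splits)
qed

lemma dual_chain_adjacent:
  assumes k: "1 \<le> k" "k < K - 1" "length (Vs ! (K - k)) = 1"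
    and i: "i < length (DG (K - k))" and i': "i' < length (DG (K - k))"
    and adj: "DG (K - k) ! i \<rightarrow>\<^bsub>Dual\<^esub> DG (K - k) ! i'"
  shows "i' = Suc i \<or> i = Suc i'"
proof -
  have j: "1 \<le> K - k" "K - k < K" "K - (K - k) = k" using k by auto
  obtain a where a: "a \<in> arcs G" "lf a = DG (K - k) ! i" "lf (arev a) = DG (K - k) ! i'"
    using adj unfolding dual_dominates by blast
  have D: "DG (K - k) ! i' \<in> set (DG (K - k))" using i' by simp
  have "dg (lf (arev a)) \<le> k" using dg_DG[OF j(1,2) D] a(3) j(3) by simp
  note nbr = cap_nbr[OF k i a(1,2) this, unfolded a(3)]
  have ends: "DG (K - k) ! i' \<noteq> lf (hd (chords (K - k)))" "DG (K - k) ! i' \<noteq> lf (arev (last (chords (K - k))))"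
    using D chordsD(7,8)[OF j(1,2)] by metis+
  have index: "i' = p" if "DG (K - k) ! i' = DG (K - k) ! p" "p < length (DG (K - k))" for p
    using that nth_eq_iff_index_eq[OF chordsD(5)[OF j(1,2)] i'] by simp
  show ?thesis
    using nbr
  proof
    assume *: "DG (K - k) ! i' = (if i = 0 then lf (hd (chords (K - k))) else DG (K - k) ! (i - 1))"
    then have "i \<noteq> 0" using ends(1) by metis
    then show ?thesis using * index[of "i - 1"] i by simp
  next
    assume *: "DG (K - k) ! i' =
      (if Suc i = length (DG (K - k)) then lf (arev (last (chords (K - k)))) else DG (K - k) ! Suc i)"
    then have "Suc i \<noteq> length (DG (K - k))" using ends(2) by metis
    then show ?thesis using * index[of "Suc i"] i by simp
  qed
qed

text \<open>A chain of \<open>G\<close>, or a vertex with two chords, yields one face and hence a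
  singleton-group. A path of several faces can only come from a single vertex. \<open>F\<close>
  stands for the outer face, represented by the arcs across the cut.\<close>

lemma dual_group:
  assumes k: "1 \<le> k" "k < K - 1"
    and F: "\<And>a. \<lbrakk>a \<in> arcs G; grp (head G a) < K - k; K - k \<le> grp (tail G a)\<rbrakk> \<Longrightarrow> a \<in> F"
  shows "singleton_group Dual Vd k \<or> chain_group Dual F Vd k"
proof -
  define j where "j = K - k"
  have j: "1 \<le> j" "j < K" "2 \<le> j" "K - j = k" using k by (auto simp: j_def)
  have kK: "k < K" using k by simp
  have V: "Vd ! k = DG j" using Vd_nth[of k] k by (simp add: j_def)
  have later: "nbrs_in Dual z (later Vd k) \<noteq> {}" if "z \<in> set (DG j)" for z
    using dual_later_nbr[OF k] that by (simp add: j_def)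
  have fin: "finite (nbrs_in Dual z (earlier Vd k))" for z
    using finite_faces earlier_Vd[of k] kK by (simp add: nbrs_in_def)
  note outer = dual_earlier_nbr[OF k(1) kK, folded j_def]
  have ne: "DG j \<noteq> []" by (rule DG_path(4)[OF j(1,2)])
  show ?thesis
  proof (cases "length (DG j) = 1")
    case True
    then obtain z where z: "DG j = [z]" by (auto simp: length_Suc_conv)
    have "{lf (hd (chords j)), lf (arev (last (chords j)))} \<subseteq> nbrs_in Dual z (earlier Vd k)"
      using outer z by simp
    then have "card {lf (hd (chords j)), lf (arev (last (chords j)))} \<le> card (nbrs_in Dual z (earlier Vd k))"
      by (rule card_mono[OF fin])
    then have "2 \<le> card (nbrs_in Dual z (earlier Vd k))" using chordsD(9)[OF j(1,2)] by simp
    then show ?thesis using V z later[of z] by (auto simp: singleton_group_def)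
  next
    case False
    then have n2: "2 \<le> length (DG j)" using ne by (cases "DG j"; cases "tl (DG j)") auto
    then have single: "length (Vs ! j) = 1" using chordsD(10)[OF j(1,2)] length_DG[of j] by force
    note k' = k single[unfolded j_def]
    note arc = dual_earlier_arc[OF k', folded j_def]
    have hd_last: "hd (DG j) = DG j ! 0" "last (DG j) = DG j ! (length (DG j) - 1)"
      using ne by (simp_all add: hd_conv_nth last_conv_nth)
    have sym: "v \<rightarrow>\<^bsub>Dual\<^esub> u" if "u \<rightarrow>\<^bsub>Dual\<^esub> v" for u v
      using sym_dual that by (auto simp: symmetric_def sym_def)
    have "chain_group Dual F Vd k"
      unfolding chain_group_def Let_def V
    proof (intro conjI allI impI ballI)
      show "2 \<le> length (DG j)" by (rule n2)
      fix i assume i: "i < length (DG j)"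
      fix i' assume i': "i' < length (DG j)"
      show "DG j ! i \<rightarrow>\<^bsub>Dual\<^esub> DG j ! i' \<longleftrightarrow> i' = Suc i \<or> i = Suc i'"
      proof
        assume "DG j ! i \<rightarrow>\<^bsub>Dual\<^esub> DG j ! i'"
        then show "i' = Suc i \<or> i = Suc i'"
          using dual_chain_adjacent[OF k'] i i' by (simp add: j_def)
      next
        assume "i' = Suc i \<or> i = Suc i'"
        then show "DG j ! i \<rightarrow>\<^bsub>Dual\<^esub> DG j ! i'"
        proof
          assume "i' = Suc i"
          then show ?thesis using DG_path(1)[OF j(1,2), of i] i' by simp
        next
          assume "i = Suc i'"
          then show ?thesis using sym[OF DG_path(1)[OF j(1,2), of i']] i by simp
        qed
      qed
    next
      \<comment> \<open>Chord \<open>Suc i\<close> has the face at index \<open>i\<close> on its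
        left and the following one on its right, and it descends across the cut.\<close>
      fix i assume i: "Suc i < length (DG j)"
      define a where "a = chords j ! Suc i"
      have len: "Suc (Suc i) < length (chords j)" using i length_DG[of j] by simp
      then have "a \<in> set (chords j)" by (simp add: a_def)
      then have a: "a \<in> arcs G" "grp (tail G a) = j" "grp (head G a) < j" using chordsD(3)[OF j(1,2)] by auto
      then have "a \<in> F" using F[of a] by (simp add: j_def)
      moreover have "lf a = DG j ! i" using DG_nth[of i j] len by (simp add: a_def)
      moreover have "lf (arev a) = DG j ! Suc i"
        using chordsD(4)[OF j(1,2), of "Suc i"] DG_nth[of "Suc i" j] len by (simp add: a_def)
      ultimately show "\<exists>a\<in>F. tail Dual a = DG j ! i \<and> head Dual a = DG j ! Suc i" by auto
    next
      have "nbrs_in Dual (hd (DG j)) (earlier Vd k) = {lf (hd (chords j))}"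
      proof (intro set_eqI iffI)
        fix v assume "v \<in> nbrs_in Dual (hd (DG j)) (earlier Vd k)"
        then have v: "v \<in> nbrs_in Dual (DG j ! 0) (earlier Vd k)" by (simp only: hd_last)
        have "0 < length (DG j)" "Suc 0 \<noteq> length (DG j)" using n2 by linarith+
        then show "v \<in> {lf (hd (chords j))}" using arc[OF _ v] by blast
      qed (use outer in simp)
      then show "card (nbrs_in Dual (hd (DG j)) (earlier Vd k)) = 1" by simp
      have "nbrs_in Dual (last (DG j)) (earlier Vd k) = {lf (arev (last (chords j)))}"
      proof (intro set_eqI iffI)
        fix v assume "v \<in> nbrs_in Dual (last (DG j)) (earlier Vd k)"
        then have v: "v \<in> nbrs_in Dual (DG j ! (length (DG j) - 1)) (earlier Vd k)" by (simp only: hd_last)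
        have l: "length (DG j) - 1 < length (DG j)" "length (DG j) - 1 \<noteq> 0" using n2 by linarith+
        show "v \<in> {lf (arev (last (chords j)))}" using arc[OF l(1) v] l(2) by (elim disjE) simp_all
      qed (use outer in simp)
      then show "card (nbrs_in Dual (last (DG j)) (earlier Vd k)) = 1" by simp
    next
      fix i assume i: "0 < i \<and> Suc i < length (DG j)"
      show "nbrs_in Dual (DG j ! i) (earlier Vd k) = {}"
      proof (rule equals0I)
        fix v assume v: "v \<in> nbrs_in Dual (DG j ! i) (earlier Vd k)"
        have "i < length (DG j)" "i \<noteq> 0" "Suc i \<noteq> length (DG j)" using i by linarith+
        then show False using arc[OF _ v] by blast
      qed
    next
      fix z assume "z \<in> set (DG j)"
      then show "nbrs_in Dual z (later Vd k) \<noteq> {}" by (rule later)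
    qed
    then show ?thesis ..
  qed
qed

lemma last_Vd: "last Vd = [vs]"
proof -
  have "Vd \<noteq> []" by (simp add: Vd_def)
  then have "last Vd = Vd ! (K - 1)" using length_Vd by (simp add: last_conv_nth)
  moreover have "1 \<le> K - 1" "K - 1 < K" "K - (K - 1) = 1" using K3 by linarith+
  ultimately show ?thesis using Vd_nth[of "K - 1"] DG_1 by simp
qed

lemma hd_Vd: "hd Vd = [fo, f2]" by (simp add: Vd_def)

text \<open>The reference arc is \<open>arev b\<close>, from \<open>f2\<close> to \<open>fo\<close>,
  and the arc from the first to the last dual vertex is \<open>r\<close>, from \<open>fo\<close> to
  \<open>vs\<close>. Both have head \<open>v1\<close> in \<open>G\<close>, so both lie on the dual
  face around \<open>v1\<close>.\<close>

lemma canonical_ordering_dual: "canonical_ordering Dual arev cwd (left_face arev cwd (arev b)) Vd"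
proof -
  have in1: "left_face arev cwd (arev b) = in_arcs G v1"
    using left_face_dual[of "arev b"] arcs_rb b by simp
  have rb: "arev b \<in> in_arcs G v1" "r \<in> in_arcs G v1" using arcs_rb r b by (auto simp: in_arcs_def)
  have "Vd ! k \<noteq> []" if "k < K" for k
  proof (cases "k = 0")
    case False
    then show ?thesis using DG_path(4)[of "K - k"] Vd_nth[of k] that by simp
  qed (simp add: Vd_0)
  then have nonempty: "[] \<notin> set Vd" by (auto simp: in_set_conv_nth length_Vd)
  have step: "let H = Dual \<restriction> earlier Vd (Suc k); F = left_face arev (induced_cw cwd (arcs H)) (arev b)
      in k_connected 2 H \<and> arev b \<in> arcs H \<and> set (Vd ! k) \<subseteq> tail Dual ` F \<and>
         (k < length Vd - 1 \<longrightarrow> singleton_group Dual Vd k \<or> chain_group Dual F Vd k)"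
    if k: "1 \<le> k" "k < length Vd" for k
  proof -
    have kK: "k < K" using k length_Vd by simp
    define F where "F = left_face arev (induced_cw cwd (arcs (Dual \<restriction> earlier Vd (Suc k)))) (arev b)"
    have "arev b \<in> arcs (Dual \<restriction> earlier Vd (Suc k))"
      using earlier_Vd_Suc[OF kK] arcs_rb fo f2_face dg_fo by (simp add: f2_def)
    moreover have "set (Vd ! k) \<subseteq> lf ` F"
    proof (cases "k = K - 1")
      case True
      have "Suc k = K" using True kK by linarith
      then have F: "F = {a \<in> arcs G. head G a = v1}" unfolding F_def using dual_outer_face_last by (simp only:)
      \<comment> \<open>The arc before \<open>arev r\<close> on the boundary of \<open>vs\<close>
        ends in \<open>v1\<close>, the tail of \<open>arev r\<close>.\<close>
      have "cwd (arev r) \<in> F" unfolding F using head_cwd[of "arev r"] arcs_rb(1) r(3) by simp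
      moreover have "vs = lf (cwd (arev r))" by (simp add: vs_def)
      ultimately have "vs \<in> lf ` F" by (rule rev_image_eqI)
      moreover have "K - k = 1" using True K3 by linarith
      then have "Vd ! k = [vs]" using Vd_nth[OF k(1) kK] DG_1 by simp
      ultimately show ?thesis by simp
    next
      case False
      then have k': "1 \<le> k" "k < K - 1" using k kK by auto
      have j: "1 \<le> K - k" "K - k < K" using k' by auto
      show ?thesis
      proof
        fix z assume "z \<in> set (Vd ! k)"
        then have "z \<in> set (DG (K - k))" using Vd_nth[OF k(1) kK] by simp
        then obtain i where i: "Suc i < length (chords (K - k))" "z = lf (chords (K - k) ! Suc i)"
          by (rule nth_DG)
        have "chords (K - k) ! Suc i \<in> F"
          unfolding F_def dual_outer_face[OF k'] using chordsD(3)[OF j, of "chords (K - k) ! Suc i"] i(1) by simp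
        then show "z \<in> lf ` F" using i(2) by simp
      qed
    qed
    moreover have "singleton_group Dual Vd k \<or> chain_group Dual F Vd k" if "k < length Vd - 1"
    proof (rule dual_group[OF k(1)])
      show k': "k < K - 1" using that length_Vd by simp
      show "a \<in> F" if "a \<in> arcs G" "grp (head G a) < K - k" "K - k \<le> grp (tail G a)" for a
        unfolding F_def dual_outer_face[OF k(1) k'] using that by simp
    qed
    ultimately show ?thesis
      using dual_two_connected[OF k(1) kK] by (simp add: Let_def F_def)
  qed
  have ends: "tail Dual (arev b) = f2" "head Dual (arev b) = fo" "tail Dual r = fo" "head Dual r = vs"
    using arcs_rb by (simp_all add: f2_def vs_def)
  show ?thesis
    unfolding canonical_ordering_def in1
    apply (intro conjI)
        apply (use length_Vd K3 in linarith)
       apply (rule nonempty)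
      apply (rule distinct_Vd)
     apply (simp only: dual_simps set_Vd)
    apply (rule exI[of _ fo], rule exI[of _ f2], rule exI[of _ vs], rule bexI[OF _ rb(1)], rule bexI[OF _ rb(2)])
    apply (intro conjI allI impI hd_Vd last_Vd ends step)
     apply simp_all
    done
qed

end

section \<open>Labels of the dual\<close>

context canonical_plane
begin

lemma directed_iff:
  assumes a: "a \<in> arcs G" "grp (tail G a) \<noteq> grp (head G a)"
  shows "a \<in> directed_arcs G Vs \<longleftrightarrow> a = arev b \<or> grp (tail G a) < grp (head G a) \<and> a \<noteq> b"
proof -
  have "tail G a = vn \<and> head G a = v1 \<longleftrightarrow> a = arev b"
    using same_ends[of a "arev b"] a(1) b arcs_rb by auto
  moreover have "tail G a = v1 \<and> head G a = vn \<longleftrightarrow> a = b"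
    using same_ends[of a b] a(1) b arcs_rb by auto
  moreover have "tail G a \<in> set (concat Vs)" "head G a \<in> set (concat Vs)"
    unfolding Vs_props(4) using a(1) by simp_all
  ultimately show ?thesis
    using directed_arcs_iff[OF dist a(1) _ _ a(2)] hd_Vs last_Vs by simp
qed

lemma intra_iff:
  assumes "a \<in> arcs G"
  shows "intra_edge G Vs a \<longleftrightarrow> grp (tail G a) = grp (head G a)"
  by (rule intra_edge_iff[OF dist]) (use assms in \<open>simp_all only: Vs_props(4) tail_in_verts head_in_verts\<close>)

lemma directed_into_group:
  assumes c: "c \<in> arcs G" "grp (tail G c) = k" "1 \<le> k" "grp (head G c) \<noteq> k"
  shows "arev c \<in> directed_arcs G Vs \<longleftrightarrow> c \<in> set (chords k)"
proof -
  have k: "k < K" using c grp_less[of "tail G c"] by simp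
  have "c \<noteq> b" using c b grp_v by auto
  then have "arev c \<noteq> arev b" by simp
  moreover have "arev c = b \<longleftrightarrow> c = arev b" by (metis arev_arev)
  ultimately have "arev c \<in> directed_arcs G Vs \<longleftrightarrow> grp (head G c) < k \<and> c \<noteq> arev b"
    using directed_iff[of "arev c"] c by auto
  then show ?thesis using chordsD(3)[OF c(3) k] c by auto
qed

lemma directed_asym:
  assumes "a \<in> arcs G" "grp (tail G a) \<noteq> grp (head G a)" "a \<in> directed_arcs G Vs" "arev a \<in> directed_arcs G Vs"
  shows False
proof -
  have eq: "arev a = b \<longleftrightarrow> a = arev b" by (metis arev_arev)
  have ne: "arev b \<noteq> b" using arev_neq arcs_rb by blast
  have "a = arev b \<or> grp (tail G a) < grp (head G a) \<and> a \<noteq> b"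
    using directed_iff[of a] assms by blast
  moreover have "a = b \<or> grp (head G a) < grp (tail G a) \<and> a \<noteq> arev b"
    using directed_iff[of "arev a"] assms eq by auto
  ultimately show False using ne by auto
qed

text \<open>By \<open>dual_simple\<close>, \<open>arev r\<close> is the only arc from the last dual
  vertex \<open>vs\<close> to the first one, \<open>fo\<close>; it is the edge with the exceptional
  direction.\<close>

lemma dual_directed_iff:
  assumes a: "a \<in> arcs G" "dg (lf a) \<noteq> dg (lf (arev a))"
  shows "a \<in> directed_arcs Dual Vd \<longleftrightarrow> a = arev r \<or> dg (lf a) < dg (lf (arev a)) \<and> a \<noteq> r"
proof -
  have F: "lf a \<in> faces G arev cw" "lf (arev a) \<in> faces G arev cw" using a by simp_all
  have "lf a = vs \<and> lf (arev a) = fo \<longleftrightarrow> a = arev r"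
  proof
    assume "lf a = vs \<and> lf (arev a) = fo"
    then show "a = arev r" using arcs_rb by (intro dual_simple[OF a(1)]) (simp_all add: vs_def)
  qed (use arcs_rb in \<open>simp add: vs_def\<close>)
  moreover have "lf a = fo \<and> lf (arev a) = vs \<longleftrightarrow> a = r"
  proof
    assume "lf a = fo \<and> lf (arev a) = vs"
    then show "a = r" using arcs_rb by (intro dual_simple[OF a(1)]) (simp_all add: vs_def)
  qed (use arcs_rb in \<open>simp add: vs_def\<close>)
  ultimately show ?thesis
    using directed_arcs_iff[OF distinct_Vd, of a Dual] a hd_Vd last_Vd
    unfolding set_Vd by (simp add: group_Vd[OF F(1)] group_Vd[OF F(2)])
qed

lemma dual_intra_iff: "a \<in> arcs G \<Longrightarrow> intra_edge Dual Vd a \<longleftrightarrow> dg (lf a) = dg (lf (arev a))"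
  using intra_edge_iff[OF distinct_Vd, of Dual a] unfolding set_Vd by (simp add: group_Vd)

lemma dual_not_directed:
  assumes y: "y \<in> arcs G" "lf y \<noteq> fo" and out: "dg (lf y) < dg (lf (arev y)) \<or> y = arev r"
  shows "arev y \<notin> directed_arcs Dual Vd"
  using out
proof
  assume lt: "dg (lf y) < dg (lf (arev y))"
  have "y \<noteq> r" using y arcs_rb by auto
  then have "arev y \<noteq> arev r" by simp
  then show ?thesis using dual_directed_iff[of "arev y"] lt y by auto
next
  assume eq: "y = arev r"
  have "dg fo \<noteq> dg vs" using dg_fo dg_vs K3 by simp
  then have "dg (lf r) \<noteq> dg (lf (arev r))" using arcs_rb by (simp add: vs_def)
  moreover have "r \<noteq> arev r" using arev_neq[of r] arcs_rb by auto
  ultimately show ?thesis using dual_directed_iff[of r] arcs_rb eq by simp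
qed

lemma chords_directed:
  assumes j: "1 \<le> j" "j < K"
  shows "hd (chords j) \<in> directed_arcs Dual Vd" "arev (last (chords j)) \<in> directed_arcs Dual Vd"
    and "dg (lf (hd (chords j))) < dg (lf (arev (hd (chords j))))"
    and "dg (lf (arev (last (chords j)))) < dg (lf (last (chords j)))"
    and "lf (arev (hd (chords j))) = hd (DG j)" "lf (last (chords j)) = last (DG j)"
proof -
  have ne: "DG j \<noteq> []" by (rule DG_path(4)[OF j])
  have arcs: "hd (chords j) \<in> arcs G" "last (chords j) \<in> arcs G"
    "grp (tail G (hd (chords j))) = j" "grp (tail G (last (chords j))) = j" "grp (head G (last (chords j))) < j"
    using chords_ends(3,4)[OF j] chordsD(3)[OF j] by auto
  show hd: "lf (arev (hd (chords j))) = hd (DG j)"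
    using chordsD(4)[OF j, of 0] chordsD(1)[OF j] chords_ends(1)[OF j] DG_nth[of 0 j] ne by (simp add: hd_conv_nth)
  show last: "lf (last (chords j)) = last (DG j)" using ne by (simp add: DG_def last_map last_tl)
  have in_DG: "hd (DG j) \<in> set (DG j)" "last (DG j) \<in> set (DG j)" using ne by simp_all
  show lt1: "dg (lf (hd (chords j))) < dg (lf (arev (hd (chords j))))"
    using chords_outer(1)[OF j] dg_DG[OF j in_DG(1)] hd by simp
  show lt2: "dg (lf (arev (last (chords j)))) < dg (lf (last (chords j)))"
    using chords_outer(2)[OF j] dg_DG[OF j in_DG(2)] last by simp
  have "hd (chords j) \<noteq> r" using arcs(3) r grp_v j by auto
  then show "hd (chords j) \<in> directed_arcs Dual Vd" using dual_directed_iff[of "hd (chords j)"] lt1 arcs by simp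
  have "arev (last (chords j)) \<noteq> r"
  proof
    assume "arev (last (chords j)) = r"
    then have "head G r = tail G (last (chords j))" using arcs(2) by (metis head_arev)
    then show False using arcs(4) r grp_v j by simp
  qed
  then show "arev (last (chords j)) \<in> directed_arcs Dual Vd"
    using dual_directed_iff[of "arev (last (chords j))"] lt2 arcs by simp
qed

lemma Vd_DG:
  assumes j: "1 \<le> j" "j < K"
  shows "1 \<le> K - j" "K - j < length Vd" "Vd ! (K - j) = DG j"
  using Vd_nth[of "K - j"] length_Vd j by auto

text \<open>Clockwise order at a dual vertex reverses the boundary walk, so \<open>nxt e\<close>
  comes just before \<open>e\<close>. It stays below the group and is therefore outgoing, which
  makes \<open>e\<close> the first incoming edge of a single face. In a longer path,
  \<open>e\<close> is the inter-edge at the last face.\<close>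

lemma last_chord_label:
  assumes j: "1 \<le> j" "j < K"
  shows "labelled Dual arev cwd Vd (last (chords j)) SouthEast"
proof -
  define e where "e = last (chords j)"
  have e: "e \<in> set (chords j)" using chords_ends(4)[OF j] by (simp add: e_def)
  have eG: "e \<in> arcs G" using e chordsD(3)[OF j] by blast
  have le: "lf e = last (DG j)" using chords_directed(6)[OF j] by (simp add: e_def)
  have ne: "DG j \<noteq> []" by (rule DG_path(4)[OF j])
  have mem: "lf e \<in> set (DG j)" using le ne by simp
  have dir: "arev e \<in> directed_arcs Dual Vd" using chords_directed(2)[OF j] by (simp add: e_def)
  note V = Vd_DG[OF j]
  have "labelled Dual arev cwd Vd e SouthEast"
  proof (cases "length (DG j) = 1")
    case True
    then have D: "Vd ! (K - j) = [lf e]" using V(3) le by (auto simp: length_Suc_conv)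
    have "arev (nxt e) \<notin> directed_arcs Dual Vd"
    proof (rule dual_not_directed)
      show "lf (nxt e) \<noteq> fo" using DG_sg[OF j mem] by simp
      show "dg (lf (nxt e)) < dg (lf (arev (nxt e))) \<or> nxt e = arev r"
        using exit_noncap[OF j e mem] by simp
    qed (use eG in simp)
    then have "labelled Dual arev cwd Vd (cwd (nxt e)) SouthEast"
      using eG dir by (intro labelled.single_first[OF V(1,2) D]) simp_all
    then show ?thesis by simp
  next
    case False
    then have "2 \<le> length (DG j)" using ne by (cases "DG j"; cases "tl (DG j)") auto
    moreover have "\<not> intra_edge Dual Vd e"
      using dual_intra_iff[OF eG] chords_directed(4)[OF j] by (simp add: e_def)
    ultimately show ?thesis
      using eG le dir by (intro labelled.chain_last[OF V(1,2,3)]) simp_all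
  qed
  then show ?thesis by (simp add: e_def)
qed

text \<open>Mirror image: \<open>cwd (arev e)\<close> comes just after \<open>arev e\<close>
  clockwise and is outgoing, so \<open>arev e\<close> is the last incoming edge of a single face. In
  a longer path it is the inter-edge at the first face.\<close>

lemma first_chord_label:
  assumes j: "1 \<le> j" "j < K"
  shows "labelled Dual arev cwd Vd (arev (hd (chords j))) SouthWest"
proof -
  define e where "e = hd (chords j)"
  have e: "e \<in> set (chords j)" using chords_ends(3)[OF j] by (simp add: e_def)
  have eG: "e \<in> arcs G" using e chordsD(3)[OF j] by blast
  have le: "lf (arev e) = hd (DG j)" using chords_directed(5)[OF j] by (simp add: e_def)
  have ne: "DG j \<noteq> []" by (rule DG_path(4)[OF j])
  have mem: "lf (arev e) \<in> set (DG j)" using le ne by simp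
  have dir: "e \<in> directed_arcs Dual Vd" using chords_directed(1)[OF j] by (simp add: e_def)
  note V = Vd_DG[OF j]
  have "labelled Dual arev cwd Vd (arev e) SouthWest"
  proof (cases "length (DG j) = 1")
    case True
    then have D: "Vd ! (K - j) = [lf (arev e)]" using V(3) le by (auto simp: length_Suc_conv)
    have "arev (cwd (arev e)) \<notin> directed_arcs Dual Vd"
    proof (rule dual_not_directed)
      show "lf (cwd (arev e)) \<noteq> fo" using DG_sg[OF j mem] by simp
      show "dg (lf (cwd (arev e))) < dg (lf (arev (cwd (arev e)))) \<or> cwd (arev e) = arev r"
        using entry_noncap[OF j e mem] by simp
    qed (use eG in simp)
    then show ?thesis
      using eG dir by (intro labelled.single_last[OF V(1,2) D]) simp_all
  next
    case False
    then have "2 \<le> length (DG j)" using ne by (cases "DG j"; cases "tl (DG j)") auto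
    moreover have "\<not> intra_edge Dual Vd (arev e)"
      using dual_intra_iff[of "arev e"] eG chords_directed(3)[OF j] by (simp add: e_def)
    ultimately show ?thesis
      using eG le dir by (intro labelled.chain_first[OF V(1,2,3)]) simp_all
  qed
  then show ?thesis by (simp add: e_def)
qed

text \<open>The boundary arcs before and after a chain arc also touch the chain. The faces beyond
  all three have higher tops, so all three are incoming at the single face of the chain, and the
  middle one is labelled \<open>South\<close>. The edge between \<open>v1\<close> and
  \<open>v2\<close> is dual to the one from the last to the first dual vertex.\<close>

lemma intra_label:
  assumes a: "a \<in> arcs G" "intra_edge G Vs a"
  shows "label_edge Dual arev cwd Vd South a"
proof -
  have eq: "grp (tail G a) = grp (head G a)" using intra_iff a by blast
  define m where "m = grp (tail G a)"
  show ?thesis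
  proof (cases "m = 0")
    case True
    then have "a = r \<or> a = arev r" using group_0_arc[OF a(1)] eq by (simp add: m_def)
    moreover have "labelled Dual arev cwd Vd r South"
      by (rule labelled.last_to_first) (use arcs_rb hd_Vd last_Vd in \<open>simp_all add: vs_def\<close>)
    ultimately show ?thesis by (auto simp: label_edge_def)
  next
    case False
    have m: "1 \<le> m" "m < K" using False grp_less[of "tail G a"] a(1) by (auto simp: m_def)
    obtain q where q: "q = a \<or> q = arev a" "length (Vs ! m) \<noteq> 1" "q \<in> arcs G" "DG m = [lf q]"
      "grp (tail G q) = m" "grp (head G q) = m"
      using intra_arc[OF m a(1)] eq m_def by metis
    note V = Vd_DG[OF m, unfolded q(4)]
    have dgq: "dg (lf q) = K - m" "sg (lf q) = m" using dg_DG[OF m, of "lf q"] DG_sg[OF m, of "lf q"] q(4) by auto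
    have dir: "arev y \<in> directed_arcs Dual Vd"
      if y: "y \<in> arcs G" "lf y = lf q" "grp (tail G y) = m \<or> grp (head G y) = m" for y
    proof -
      have "m \<le> sg (lf (arev y))"
        using sg_tail[of "arev y" "arev y"] sg_head[of "arev y" "arev y"] y by auto
      moreover have "sg (lf (arev y)) \<noteq> m \<or> lf (arev y) = fo \<or> lf (arev y) = f2"
      proof (rule ccontr)
        assume "\<not> ?thesis"
        then have "lf (arev y) \<in> set (DG m)" using chordsD(6)[OF m] y(1) by auto
        then show False using lf_arev_neq[OF y(1)] y(2) q(4) by simp
      qed
      ultimately have lt: "dg (lf (arev y)) < K - m" using sg_less[of "arev y"] y(1) m by (auto simp: dg_def)
      have "arev y \<noteq> r"
      proof
        assume "arev y = r"
        then have "grp (tail G y) = 0" "grp (head G y) = 0" using y(1) r grp_v by (metis head_arev tail_arev)+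
        then show False using y(3) False by simp
      qed
      then show ?thesis using dual_directed_iff[of "arev y"] y lt dgq by simp
    qed
    have "arev (nxt q) \<in> directed_arcs Dual Vd" by (rule dir) (use q in simp_all)
    moreover have "arev q \<in> directed_arcs Dual Vd" by (rule dir) (use q in simp_all)
    moreover have "arev (cwd q) \<in> directed_arcs Dual Vd" by (rule dir) (use q head_cwd[of q] in simp_all)
    ultimately have "labelled Dual arev cwd Vd (cwd (nxt q)) South"
      using q(3) by (intro labelled.single_middle[OF V]) simp_all
    then show ?thesis using q(1) by (auto simp: label_edge_def)
  qed
qed

text \<open>Excludes a wrap-around. The face clockwise after the last chord is neither in
  \<open>DG k\<close> nor the left face of the first chord, while every chord has one of these on
  its left.\<close>

lemma cw_chord:
  assumes k: "1 \<le> k" "k < K" "Vs ! k = [z]" and e: "e \<in> set (chords k)" "cw e \<in> set (chords k)"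
  obtains i where "Suc i < length (chords k)" "e = chords k ! i" "cw e = chords k ! Suc i"
proof -
  define es where "es = chords k"
  have tail: "tail G x = z \<and> x \<in> arcs G" if "x \<in> set es" for x
  proof -
    have x: "x \<in> arcs G" "grp (tail G x) = k" using that chordsD(3)[OF k(1,2)] by (auto simp: es_def)
    then show ?thesis using grp_mem[of "tail G x"] k(3) by auto
  qed
  obtain i where i: "i < length es" "e = es ! i" using e(1) by (auto simp: es_def in_set_conv_nth)
  have lf_e: "lf (cw e) = lf (arev e)" by (rule lf_cw)
  have "Suc i < length es"
  proof (rule ccontr)
    assume "\<not> ?thesis"
    then have "i = length es - 1" using i by simp
    then have "e = last es" using chords_ends(2)[OF k(1,2)] i by (simp add: es_def)
    then have ends: "lf (cw e) \<notin> set (DG k)" "lf (cw e) \<noteq> lf (hd es)"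
      using chordsD(8,9)[OF k(1,2)] lf_e by (auto simp: es_def)
    obtain p where p: "p < length es" "cw e = es ! p" using e(2) by (auto simp: es_def in_set_conv_nth)
    show False
    proof (cases p)
      case 0
      then show False using ends(2) p chords_ends(1)[OF k(1,2)] by (simp add: es_def)
    next
      case (Suc q)
      then have "lf (cw e) = DG k ! q" using p DG_nth[of q k] by (simp add: es_def)
      then show False using ends(1) p Suc length_DG[of k] by (simp add: es_def)
    qed
  qed
  moreover have "cw e = es ! Suc i"
  proof (rule corner_unique)
    show "cw e \<in> arcs G" "es ! Suc i \<in> arcs G" "tail G (cw e) = tail G (es ! Suc i)"
      using tail[of "cw e"] tail[of "es ! Suc i"] e(2) calculation by (auto simp: es_def)
    show "lf (cw e) = lf (es ! Suc i)" using lf_e chordsD(4)[OF k(1,2), of i] i calculation by (simp add: es_def)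
  qed
  ultimately show thesis using that i by (simp add: es_def)
qed

lemma singleton_directed:
  assumes k: "1 \<le> k" "k < K" "Vs ! k = [z]" and c: "c \<in> arcs G" "tail G c = z"
  shows "arev c \<in> directed_arcs G Vs \<longleftrightarrow> c \<in> set (chords k)"
proof (rule directed_into_group[OF c(1) _ k(1)])
  show t: "grp (tail G c) = k" using in_group[OF k(2), of z] k(3) c by simp
  show "grp (head G c) \<noteq> k"
    using group_eq_singleton[OF k(2), of "tail G c" "head G c"] k(3) c no_loops[OF c(1)] t by auto
qed

lemma pred_chord:
  assumes k: "1 \<le> k" "k < K" "Vs ! k = [z]" and i: "Suc i < length (chords k)"
  shows "cw (chords k ! i) = chords k ! Suc i"
proof (rule corner_unique)
  have t: "x \<in> arcs G \<and> tail G x = z" if "x \<in> set (chords k)" for x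
    using that chordsD(3)[OF k(1,2)] grp_mem[of "tail G x"] k(3) by auto
  show "cw (chords k ! i) \<in> arcs G" "chords k ! Suc i \<in> arcs G"
    "tail G (cw (chords k ! i)) = tail G (chords k ! Suc i)"
    using t[of "chords k ! i"] t[of "chords k ! Suc i"] i by auto
  show "lf (cw (chords k ! i)) = lf (chords k ! Suc i)"
    using lf_cw chordsD(4)[OF k(1,2) i] by metis
qed

text \<open>A \<open>South\<close> edge at a singleton-group has chords as both its clockwise
  neighbours, so it is neither the first nor the last chord and both its faces are in
  \<open>DG k\<close>. The edge between \<open>v1\<close> and \<open>vn\<close> separates
  \<open>fo\<close> from \<open>f2\<close>.\<close>

lemma south_dual_intra:
  assumes a: "a \<in> arcs G" "label_edge G arev cw Vs South a"
  shows "intra_edge Dual Vd a"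
proof -
  have *: "dg (lf c) = dg (lf (arev c))" if "labelled G arev cw Vs c South" "c \<in> arcs G" for c
    using that(1)
  proof cases
    case (single_middle k z b0)
    have k: "1 \<le> k" "k < K" "Vs ! k = [z]" using single_middle by simp_all
    note dir = singleton_directed[OF k]
    have mem: "b0 \<in> set (chords k)" "cw b0 \<in> set (chords k)" "cw (cw b0) \<in> set (chords k)"
      using dir[of b0] dir[of "cw b0"] dir[of "cw (cw b0)"] single_middle by simp_all
    obtain i where i: "Suc i < length (chords k)" "cw b0 = chords k ! Suc i"
      using cw_chord[OF k mem(1,2)] by blast
    obtain p where p: "Suc p < length (chords k)" "cw b0 = chords k ! p" "cw (cw b0) = chords k ! Suc p"
      using cw_chord[OF k mem(2,3)] by blast
    have "lf (cw b0) = DG k ! i" using DG_nth[of i k] i by simp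
    moreover have "lf (arev (cw b0)) = DG k ! p"
      using chordsD(4)[OF k(1,2) p(1)] DG_nth[of p k] p by simp
    moreover have "DG k ! i \<in> set (DG k)" "DG k ! p \<in> set (DG k)" using i p length_DG[of k] by simp_all
    ultimately show ?thesis using dg_DG[OF k(1,2)] single_middle(1) by simp
  next
    case last_to_first
    then have "c = b" using same_ends[of c b] b arcs_rb hd_Vs last_Vs by simp
    then show ?thesis using dg_fo arcs_rb by (simp add: f2_def)
  qed
  show ?thesis
    using a(2) *[of a] *[of "arev a"] a(1) dual_intra_iff[OF a(1)] by (auto simp: label_edge_def)
qed

text \<open>Both kinds of group give the last chord: at a singleton-group it is the last incoming
  edge, and for a chain, whose chords start with the edge at its last vertex, it is the edge below
  the first vertex.\<close>

lemma labelled_SW: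
  assumes "labelled G arev cw Vs c SouthWest"
  obtains k where "1 \<le> k" "k < K" "c = last (chords k)" "arev c \<in> directed_arcs G Vs"
    "grp (tail G c) \<noteq> grp (head G c)" "c \<in> arcs G"
  using assms
proof cases
  case (single_last k z)
  have k: "1 \<le> k" "k < K" "Vs ! k = [z]" using single_last by simp_all
  note dir = singleton_directed[OF k]
  have c: "c \<in> set (chords k)" using dir[of c] single_last by simp
  then obtain i where i: "i < length (chords k)" "c = chords k ! i" by (auto simp: in_set_conv_nth)
  have "\<not> Suc i < length (chords k)"
  proof
    assume s: "Suc i < length (chords k)"
    then have "cw c \<in> set (chords k)" using pred_chord[OF k s] i by simp
    then show False using dir[of "cw c"] single_last by simp
  qed
  then have "i = length (chords k) - 1" using i by simp
  then have "c = last (chords k)" using i chords_ends(2)[OF k(1,2)] by simp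
  moreover have "grp (tail G c) \<noteq> grp (head G c)" using c chordsD(3)[OF k(1,2)] by auto
  ultimately show thesis using that k single_last by blast
next
  case (chain_first k zs)
  have k: "1 \<le> k" "k < K" and nz: "length (Vs ! k) \<noteq> 1" using chain_first by auto
  have ne: "grp (tail G c) \<noteq> grp (head G c)" using intra_iff chain_first by blast
  have "zs \<noteq> []" using chain_first by auto
  then have t: "grp (tail G c) = k" using in_group[OF k(2), of "tail G c"] chain_first by simp
  then have c: "c \<in> set (chords k)" using directed_into_group[of c k] chain_first ne k by simp
  obtain x y where xy: "chords k = [x, y]"
    using chordsD(10)[OF k nz] by (auto simp: length_Suc_conv numeral_2_eq_2)
  have "distinct zs" using dist chain_first(2,3) by (metis distinct_concat_iff nth_mem)
  then have "hd zs \<noteq> last zs" using chain_first(4)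
    by (cases zs) (auto split: if_splits)
  then have "c = last (chords k)" using c xy chordsD(11)[OF k nz] chain_first by auto
  then show thesis using that k ne chain_first by blast
qed

lemma labelled_SE:
  assumes "labelled G arev cw Vs c SouthEast"
  obtains k where "1 \<le> k" "k < K" "c = hd (chords k)" "arev c \<in> directed_arcs G Vs"
    "grp (tail G c) \<noteq> grp (head G c)" "c \<in> arcs G"
  using assms
proof cases
  case (single_first k z b0)
  have k: "1 \<le> k" "k < K" "Vs ! k = [z]" using single_first by simp_all
  note dir = singleton_directed[OF k]
  have c: "c \<in> set (chords k)" using dir[of c] single_first by simp
  then obtain i where i: "i < length (chords k)" "c = chords k ! i" by (auto simp: in_set_conv_nth)
  have "i = 0"
  proof (rule ccontr)
    assume "i \<noteq> 0"
    then obtain p where p: "i = Suc p" by (cases i) auto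
    then have "cw (chords k ! p) = cw b0" using pred_chord[OF k, of p] i single_first(1) by simp
    then have "b0 \<in> set (chords k)" using i p by (metis Suc_lessD cw_eq_iff nth_mem)
    then show False using dir[of b0] single_first by simp
  qed
  then have "c = hd (chords k)" using i chords_ends(1)[OF k(1,2)] by simp
  moreover have "grp (tail G c) \<noteq> grp (head G c)" using c chordsD(3)[OF k(1,2)] by auto
  moreover have "c \<in> arcs G" "arev c \<in> directed_arcs G Vs" using single_first by simp_all
  ultimately show thesis by (intro that[OF k(1,2)])
next
  case (chain_last k zs)
  have k: "1 \<le> k" "k < K" and nz: "length (Vs ! k) \<noteq> 1" using chain_last(1-4) by simp_all
  have ne: "grp (tail G c) \<noteq> grp (head G c)" using intra_iff chain_last by blast
  have "zs \<noteq> []" using chain_last by auto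
  then have t: "grp (tail G c) = k" using in_group[OF k(2), of "tail G c"] chain_last by simp
  then have c: "c \<in> set (chords k)" using directed_into_group[of c k] chain_last ne k by simp
  obtain x y where xy: "chords k = [x, y]"
    using chordsD(10)[OF k nz] by (auto simp: length_Suc_conv numeral_2_eq_2)
  have "distinct zs" using dist chain_last(2,3) by (metis distinct_concat_iff nth_mem)
  then have "hd zs \<noteq> last zs" using chain_last(4)
    by (cases zs) (auto split: if_splits)
  then have "c = hd (chords k)" using c xy chordsD(12)[OF k nz] chain_last by auto
  then show thesis using that k ne chain_last by blast
qed

text \<open>The label sits at the upper end, thus on \<open>arev a\<close>; on \<open>a\<close> it
  would make both orientations directed. So \<open>arev a\<close> is a last chord, and the dual arc
  \<open>a\<close> leads from an attachment face into the last face of the group.\<close>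

lemma SW_dual:
  assumes a: "a \<in> directed_arcs G Vs" "label_edge G arev cw Vs SouthWest a"
  shows "label_edge Dual arev cwd Vd SouthEast a \<and> a \<in> directed_arcs Dual Vd"
proof -
  have "\<not> labelled G arev cw Vs a SouthWest"
    using labelled_SW[of a] directed_asym[of a] a(1) by metis
  then have "labelled G arev cw Vs (arev a) SouthWest" using a(2) by (simp add: label_edge_def)
  then obtain k where k: "1 \<le> k" "k < K" "arev a = last (chords k)" by (rule labelled_SW)
  then have "a = arev (last (chords k))" by (metis arev_arev)
  then show ?thesis
    using last_chord_label[OF k(1,2)] chords_directed(2)[OF k(1,2)] k(3) by (simp add: label_edge_def)
qed

lemma SE_dual:
  assumes a: "a \<in> directed_arcs G Vs" "label_edge G arev cw Vs SouthEast a"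
  shows "label_edge Dual arev cwd Vd SouthWest a \<and> arev a \<in> directed_arcs Dual Vd"
proof -
  have "\<not> labelled G arev cw Vs a SouthEast"
    using labelled_SE[of a] directed_asym[of a] a(1) by metis
  then have "labelled G arev cw Vs (arev a) SouthEast" using a(2) by (simp add: label_edge_def)
  then obtain k where k: "1 \<le> k" "k < K" "arev a = hd (chords k)" by (rule labelled_SE)
  then have "a = arev (hd (chords k))" by (metis arev_arev)
  then show ?thesis
    using first_chord_label[OF k(1,2)] chords_directed(1)[OF k(1,2)] k(3) by (simp add: label_edge_def)
qed

lemma plane_embedding_dual_G: "plane_embedding Dual arev cwd"
proof (rule plane_embedding_dual[OF connected_dual])
  fix v assume v: "v \<in> verts G"
  show "out_arcs G v \<noteq> {}"
  proof (cases "v = v1")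
    case True
    then show ?thesis using b arcs_rb by (auto simp: out_arcs_def)
  next
    case False
    then show ?thesis using lower[OF v] by (auto simp: out_arcs_def)
  qed
qed

end

lemma plane_graphI:
  assumes "graph G" "plane_embedding G arev cw"
  shows "plane_graph G arev cw"
proof -
  interpret graph G by (rule assms)
  interpret bidirected_digraph G arev using assms(2) by (simp add: plane_embedding_def)
  show ?thesis
    by unfold_locales (use assms(2) in \<open>auto simp: plane_embedding_def\<close>)
qed

lemma canonical_planeI:
  assumes G: "graph G" "plane_embedding G arev cw" "k_connected 3 G" and fo: "fo \<in> faces G arev cw"
    and ord: "canonical_ordering G arev cw fo Vs"
  obtains v1 v2 vn r b where "canonical_plane G arev cw fo Vs v1 v2 vn r b"
proof -
  obtain v1 v2 vn r b where *: "r \<in> fo" "b \<in> fo" "hd Vs = [v1, v2]" "tail G r = v2" "head G r = v1"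
    "last Vs = [vn]" "tail G b = v1" "head G b = vn"
    and step: "\<And>k. \<lbrakk>1 \<le> k; k < length Vs\<rbrakk> \<Longrightarrow>
           (let H = G \<restriction> earlier Vs (Suc k);
                F = left_face arev (induced_cw cw (arcs H)) r
            in k_connected 2 H \<and> r \<in> arcs H \<and> set (Vs ! k) \<subseteq> tail G ` F \<and>
               (k < length Vs - 1 \<longrightarrow> singleton_group G Vs k \<or> chain_group G F Vs k))"
    using ord unfolding canonical_ordering_def by blast
  have props: "2 \<le> length Vs" "[] \<notin> set Vs" "distinct (concat Vs)" "set (concat Vs) = verts G"
    using ord unfolding canonical_ordering_def by blast+
  have "canonical_plane G arev cw fo Vs v1 v2 vn r b"
  proof (intro canonical_plane.intro canonical_plane_axioms.intro plane_graphI G fo * props)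
    fix k assume k: "1 \<le> k" "k < length Vs"
    then show "k_connected 2 (G \<restriction> earlier Vs (Suc k))" "r \<in> arcs (G \<restriction> earlier Vs (Suc k))"
      using step[OF k] by (simp_all only: Let_def)
  next
    fix k assume k: "1 \<le> k" "k < length Vs - 1"
    then have "k < length Vs" by simp
    then show "singleton_group G Vs k \<or>
      chain_group G (left_face arev (induced_cw cw (arcs (G \<restriction> earlier Vs (Suc k)))) r) Vs k"
      using step[OF k(1)] k(2) by (simp only: Let_def)
  qed
  then show thesis by (rule that)
qed

theorem theorem2:
  fixes G :: "('a, 'b) pre_digraph" and arev cw :: "'b \<Rightarrow> 'b"
    and fo :: "'b set" and Vs :: "'a list list"
  assumes "graph G" and "plane_embedding G arev cw" and "k_connected 3 G"
    and "fo \<in> faces G arev cw" and "canonical_ordering G arev cw fo Vs"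
  shows "\<exists>cw' fo' Vs'.
    plane_embedding (dual_graph G arev cw) arev cw' \<and>
    fo' \<in> faces (dual_graph G arev cw) arev cw' \<and>
    canonical_ordering (dual_graph G arev cw) arev cw' fo' Vs' \<and>
    (\<forall>a \<in> arcs G. intra_edge G Vs a \<longrightarrow>
       label_edge (dual_graph G arev cw) arev cw' Vs' South a) \<and>
    (\<forall>a \<in> arcs G. label_edge G arev cw Vs South a \<longrightarrow>
       intra_edge (dual_graph G arev cw) Vs' a) \<and>
    (\<forall>a \<in> directed_arcs G Vs. label_edge G arev cw Vs SouthWest a \<longrightarrow>
       label_edge (dual_graph G arev cw) arev cw' Vs' SouthEast a \<and>
       a \<in> directed_arcs (dual_graph G arev cw) Vs') \<and>
    (\<forall>a \<in> directed_arcs G Vs. label_edge G arev cw Vs SouthEast a \<longrightarrow>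
       label_edge (dual_graph G arev cw) arev cw' Vs' SouthWest a \<and>
       arev a \<in> directed_arcs (dual_graph G arev cw) Vs')"
proof -
  obtain v1 v2 vn r b where "canonical_plane G arev cw fo Vs v1 v2 vn r b"
    using canonical_planeI[OF assms] .
  then interpret canonical_plane G arev cw fo Vs v1 v2 vn r b .
  have "left_face arev cwd (arev b) \<in> faces Dual arev cwd"
    using arcs_rb by (simp add: faces_def)
  then show ?thesis
    using plane_embedding_dual_G canonical_ordering_dual intra_label south_dual_intra SW_dual SE_dual
    by blast
qed

end
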